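(* Let $1<p<\infty$ and $\alpha\in[0,1)$. Let $\omega:\mathbb{R}^d\to(0,\infty)$ be a weight belonging to $A_p^\alpha$. Then the maximal operator $\mathcal{H}^*$ is bounded on $L^p(\mathbb{R}^d,\omega(x)e^{-\frac p2|x|^2}dx)$, that is, there is a constant $C>0$ such that $$\|\mathcal{H}^*(f)\|_{L^p(\mathbb{R}^d,\omega(x)e^{-\frac p2|x|^2}dx)}\le C\|f\|_{L^p(\mathbb{R}^d,\omega(x)e^{-\frac p2|x|^2}dx)}$$ for all $f\in L^p(\mathbb{R}^d,\omega(x)e^{-\frac p2|x|^2}dx)$.
   Context: A weight is a (measurable) function $\omega:\mathbb{R}^d\to(0,\infty)$. Ornstein-Uhlenbeck semigroup and maximal operator: for $t>0$, $\mathcal{H}_tf(x)=\int_{\mathbb{R}^d}M_t(x,y)f(y)\,dy$ with $M_t(x,y)=\left(\frac{1}{\pi(1-e^{-2t})}\right)^{d/2}\exp\left(-\frac{|e^{-t}x-y|^2}{1-e^{-2t}}\right)$, and $\mathcal{H}^*(f)(x)=\sup_{t>0}\mathcal{H}_t(|f|)(x)$. Grid $\Delta^\alpha$: for $n\ge1$ let $\delta_n^\alpha$ be the unique nonnegative integer $k$ with $2^{-k}\le n^{-\alpha}<2^{-k+1}$, and $\Delta_n^\alpha=\{m+[0,2^{-\delta_n^\alpha})^d:\ 2^{\delta_n^\alpha}m\in\mathbb{Z}^d,\ m+[0,2^{-\delta_n^\alpha})^d\subseteq[-(n+1),n+1)^d\setminus[-n,n)^d\}$; also $\delta_0^\alpha=-1$,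 $\Delta_0^\alpha=\{[-1,1)^d\}$. Put $\Delta^\alpha=\bigcup_{n\ge0}\Delta_n^\alpha$ (a partition of $\mathbb{R}^d$). $l(Q)$ is the side length of a cube $Q$; $\rho(Q,Q')=\inf\{\|x-y\|_\infty:x\in Q,y\in Q'\}$ and $\rho(x,Q)=\rho(\{x\},Q)$. The dyadic subcubes of a cube are those obtained by repeated bisection into $2^d$ congruent cubes. Region $N_\alpha(Q)$: for every $Q\in\Delta^\alpha$ one fixes once and for all a cube $N_\alpha(Q)$ of side length $4l(Q)$ which is a finite union of cubes of $\Delta^\alpha$, contains every $Q'\in\Delta^\alpha$ with $\rho(Q,Q')<l(Q)$, has $Q$ as a dyadic subcube, and contains $\{x\in\mathbb{R}^d:\rho(x,Q)<l(Q)\}$. (Such a cube exists but need not be unique.) Weight class: $\omega\in A_p^\alpha$ iff $[\omega]_{A_p^\alpha}:=\sup_{R\in\Delta^\alpha}\sup_{Q\subseteq N_\alpha(R)}\left(\frac1{|Q|}\int_Q\omega\,dx\right)^{1/p}\left(\frac1{|Q|}\int_Q\omega^{-\frac1{p-1}}dx\right)^{\frac{p-1}p}<\infty$, the inner supremum being over all cubes $Q\subseteq N_\alpha(R)$ with sides parallel to the axes. *)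

theory Defs
  imports "HOL-Analysis.Analysis"
begin

section \<open>Real powers and $L^p$ norms with values in the extended nonnegative reals\<close>

text \<open>Only positive exponents are intended: then infinity is mapped to infinity and 0 to 0.\<close>

definition enn_powr :: "ennreal \<Rightarrow> real \<Rightarrow> ennreal" where
  "enn_powr x a = (if x = \<infinity> then \<infinity> else ennreal (enn2real x powr a))"

definition Lp_norm :: "real \<Rightarrow> 'a measure \<Rightarrow> ('a \<Rightarrow> ennreal) \<Rightarrow> ennreal" where
  "Lp_norm p M g = enn_powr (\<integral>\<^sup>+ x. enn_powr (g x) p \<partial>M) (1 / p)"

definition Lp_space :: "real \<Rightarrow> 'a measure \<Rightarrow> ('a \<Rightarrow> complex) set" where
  "Lp_space p M = {f \<in> borel_measurable M. Lp_norm p M (\<lambda>x. ennreal (norm (f x))) < \<infinity>}"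


section \<open>The Ornstein-Uhlenbeck maximal operator\<close>

definition OU_kernel :: "real \<Rightarrow> real^'d \<Rightarrow> real^'d \<Rightarrow> real" where
  "OU_kernel t x y =
     (1 / (pi * (1 - exp (- 2 * t)))) powr (real CARD('d) / 2) *
     exp (- ((norm (exp (- t) *\<^sub>R x - y))\<^sup>2 / (1 - exp (- 2 * t))))"

text \<open>The semigroup on nonnegative functions, where the integral always exists in $[0,\infty]$.
  The maximal operator only involves the semigroup applied to the modulus of $f$.\<close>

definition OU_semigroup :: "real \<Rightarrow> (real^'d \<Rightarrow> ennreal) \<Rightarrow> real^'d \<Rightarrow> ennreal" where
  "OU_semigroup t g x = (\<integral>\<^sup>+ y. ennreal (OU_kernel t x y) * g y \<partial>lebesgue)"

definition OU_maximal :: "(real^'d \<Rightarrow> complex) \<Rightarrow> real^'d \<Rightarrow> ennreal" where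
  "OU_maximal f x = (SUP t\<in>{0<..}. OU_semigroup t (\<lambda>y. ennreal (norm (f y))) x)"


section \<open>Cubes\<close>

definition cube :: "real^'d \<Rightarrow> real \<Rightarrow> (real^'d) set" where
  "cube c s = {x. \<forall>i. c $ i \<le> x $ i \<and> x $ i < c $ i + s}"

definition side_length :: "(real^'d) set \<Rightarrow> real" where
  "side_length Q = (THE s. 0 < s \<and> (\<exists>c. Q = cube c s))"

definition rho :: "(real^'d) set \<Rightarrow> (real^'d) set \<Rightarrow> real" where
  "rho A B = Inf {infnorm (x - y) | x y. x \<in> A \<and> y \<in> B}"

inductive_set dyadic_subcubes :: "(real^'d) set \<Rightarrow> (real^'d) set set" for Q where
  self: "Q \<in> dyadic_subcubes Q"
| bisect: "\<lbrakk>cube c s \<in> dyadic_subcubes Q; 0 < s; \<forall>i. e $ i \<in> {0, 1}\<rbrakk>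
     \<Longrightarrow> cube (c + (s / 2) *\<^sub>R e) (s / 2) \<in> dyadic_subcubes Q"


section \<open>The grid\<close>

definition grid_level :: "real \<Rightarrow> nat \<Rightarrow> int" where
  "grid_level \<alpha> n =
     (if n = 0 then - 1
      else int (THE k. 2 powr (- real k) \<le> real n powr (- \<alpha>) \<and>
                       real n powr (- \<alpha>) < 2 powr (- real k + 1)))"

definition grid_shell :: "real \<Rightarrow> nat \<Rightarrow> (real^'d) set set" where
  "grid_shell \<alpha> n =
     (if n = 0 then {cube (vec (- 1)) 2}
      else {cube m (2 powi (- grid_level \<alpha> n)) | m.
              (\<forall>i. 2 powi (grid_level \<alpha> n) * m $ i \<in> \<int>) \<and>
              cube m (2 powi (- grid_level \<alpha> n)) \<subseteq>
                cube (vec (- (real n + 1))) (2 * (real n + 1)) - cube (vec (- real n)) (2 * real n)})"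

definition grid :: "real \<Rightarrow> (real^'d) set set" where
  "grid \<alpha> = (\<Union>n. grid_shell \<alpha> n)"

text \<open>\<open>N\<close> is an admissible choice of the regions $N_\alpha(Q)$; its values off the grid are irrelevant.\<close>

definition admissible_regions :: "real \<Rightarrow> ((real^'d) set \<Rightarrow> (real^'d) set) \<Rightarrow> bool" where
  "admissible_regions \<alpha> N \<longleftrightarrow>
     (\<forall>Q \<in> grid \<alpha>.
        (\<exists>c. N Q = cube c (4 * side_length Q)) \<and>
        (\<exists>F. finite F \<and> F \<subseteq> grid \<alpha> \<and> N Q = \<Union>F) \<and>
        (\<forall>Q' \<in> grid \<alpha>. rho Q Q' < side_length Q \<longrightarrow> Q' \<subseteq> N Q) \<and>
        Q \<in> dyadic_subcubes (N Q) \<and>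
        {x. rho {x} Q < side_length Q} \<subseteq> N Q)"


section \<open>Weights\<close>

definition weight :: "(real^'d \<Rightarrow> real) \<Rightarrow> bool" where
  "weight \<omega> \<longleftrightarrow> \<omega> \<in> borel_measurable lebesgue \<and> (\<forall>x. 0 < \<omega> x)"

definition average :: "(real^'d) set \<Rightarrow> (real^'d \<Rightarrow> real) \<Rightarrow> ennreal" where
  "average Q g = (\<integral>\<^sup>+ x\<in>Q. ennreal (g x) \<partial>lebesgue) / emeasure lebesgue Q"

text \<open>Half-open cubes suffice in the inner supremum: since \<open>N R\<close> is a half-open cube, any open or
  closed cube contained in it has its half-open version contained in it too, with the same averages.\<close>

definition Ap_constant ::
  "real \<Rightarrow> ((real^'d) set \<Rightarrow> (real^'d) set) \<Rightarrow> real \<Rightarrow> (real^'d \<Rightarrow> real) \<Rightarrow> ennreal" where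
  "Ap_constant \<alpha> N p \<omega> =
     (SUP R \<in> grid \<alpha>. SUP Q \<in> {cube c s | c s. 0 < s \<and> cube c s \<subseteq> N R}.
        enn_powr (average Q \<omega>) (1 / p) *
        enn_powr (average Q (\<lambda>x. \<omega> x powr (- (1 / (p - 1))))) ((p - 1) / p))"

definition Ap_class ::
  "real \<Rightarrow> ((real^'d) set \<Rightarrow> (real^'d) set) \<Rightarrow> real \<Rightarrow> (real^'d \<Rightarrow> real) set" where
  "Ap_class \<alpha> N p = {\<omega>. weight \<omega> \<and> Ap_constant \<alpha> N p \<omega> < \<infinity>}"

definition gaussian_weighted_measure :: "real \<Rightarrow> (real^'d \<Rightarrow> real) \<Rightarrow> (real^'d) measure" where
  "gaussian_weighted_measure p \<omega> =
     density lebesgue (\<lambda>x. ennreal (\<omega> x * exp (- (p / 2) * (norm x)\<^sup>2)))"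

end

theory Submission
  imports Defs
begin

text \<open>Multiplying by the square root of the Gaussian turns the claim into the boundedness on
  $L^p(\omega)$ of the maximal operator of the Mehler kernel. With
  $s = (1 - e^{-t}) / (1 + e^{-t})$ this kernel is at most
  $s^{-d/2} \exp (- (|x - y|^2 / s + s |x + y|^2) / 4)$, and the exponent controls
  $|x - y| (|x| + |y|)$ uniformly in $s$.

  For $|x - y|$ below the scale $(1 + |x|)^{-\alpha}$ of the grid the operator is dominated by dyadic
  maximal operators over those cubes of finitely many shifted dyadic grids that lie in some region
  $N_\alpha(R)$. These families are laminar, so Doob's inequality holds for every measure, and
  Lerner's iteration of two weighted maximal operators gives the weighted bound.

  For larger $|x - y|$ a chain of adjacent cubes joining x to y shows that the masses of the dual weight
  near x and near y differ by at most a factor $\exp (C |x - y| (|x| + |y|)^\alpha)$. Since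
  $\alpha < 1$, the kernel beats this factor, and Hoelder's inequality finishes the proof.\<close>

section \<open>Powers of extended nonnegative reals\<close>

text \<open>The obstacle: A_p^\<alpha> controls the weight only on cubes of size comparable to (1 +
  |x|)^(-\<alpha>) or smaller, and masses may grow exponentially beyond that scale, so no estimate
  may involve a large cube. The supremum over t has to be removed differently in the two regimes.
  Near x the kernel is cut into dyadic shells, whose contributions form a geometric series bounded
  uniformly in s. Far from x the factor s^(-d/2) is traded for a power of |x| + |y|, which leaves
  one kernel for all times. For this kernel a Schur test works, with the kernel split into two
  square roots: the dual factor at x is at most a multiple of the dual mass of a cube around x, and
  A_p pairs this mass with that of the weight at the same place.

  The threshold 1/24 between near and far is 1/2 * 1/2 * 1/6: a neighbourhood of x of width (1 +
  |x|)^(-\<alpha>) / 2 lies in a region N, rounding to a power of 2 costs a factor 2, and the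
  one-third trick leaves a box of half-side one sixth of the cube. The radius
  \<open>\<rho> powr (- \<alpha>) / 8\<close> of the chains leaves room for a doubled cube inside
  the same neighbourhood.\<close>

lemma enn_powr_ennreal: "0 \<le> r \<Longrightarrow> enn_powr (ennreal r) a = ennreal (r powr a)"
  by (simp add: enn_powr_def)

lemma enn_powr_top [simp]: "enn_powr top a = top"
  by (simp add: enn_powr_def)

lemma enn_powr_0 [simp]: "enn_powr 0 a = 0"
  by (simp add: enn_powr_def)

lemma enn_powr_one [simp]: "enn_powr x 1 = x"
  by (cases x) (auto simp: enn_powr_ennreal)

lemma enn_powr_1 [simp]: "enn_powr 1 a = 1"
  using enn_powr_ennreal[of 1 a] by simp

lemma enn_powr_eq_0_iff [simp]: "enn_powr x a = 0 \<longleftrightarrow> x = 0"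
  by (cases x) (auto simp: enn_powr_ennreal)

lemma enn_powr_eq_top_iff [simp]: "enn_powr x a = top \<longleftrightarrow> x = top"
  by (cases x) (auto simp: enn_powr_ennreal)

lemma enn_powr_less_top_iff [simp]: "enn_powr x a < top \<longleftrightarrow> x < top"
  by (metis enn_powr_eq_top_iff less_top)

lemma enn_powr_mono: "0 \<le> a \<Longrightarrow> x \<le> y \<Longrightarrow> enn_powr x a \<le> enn_powr y a"
  by (cases x; cases y) (auto simp: enn_powr_ennreal top_unique intro!: ennreal_leI powr_mono2)

lemma enn_powr_mult: "enn_powr (x * y) a = enn_powr x a * enn_powr y a"
proof (cases "x = 0 \<or> y = 0")
  case False
  then show ?thesis
    by (cases x; cases y)
      (auto simp: enn_powr_ennreal ennreal_mult[symmetric] powr_mult ennreal_mult_top ennreal_top_mult)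
qed auto

lemma enn_powr_powr: "enn_powr (enn_powr x a) b = enn_powr x (a * b)"
  by (cases x) (auto simp: enn_powr_ennreal powr_powr)

lemma enn_powr_inverse_cancel [simp]:
  "a \<noteq> 0 \<Longrightarrow> enn_powr (enn_powr x a) (1 / a) = x"
  "a \<noteq> 0 \<Longrightarrow> enn_powr (enn_powr x (1 / a)) a = x"
  by (simp_all add: enn_powr_powr)

lemma measurable_enn_powr [measurable]:
  assumes [measurable]: "f \<in> borel_measurable M"
  shows "(\<lambda>x. enn_powr (f x) a) \<in> borel_measurable M"
proof -
  have "{x \<in> space M. f x = \<infinity>} \<in> sets M"
    unfolding infinity_ennreal_def by measurable
  then show ?thesis
    unfolding enn_powr_def by (intro measurable_If) auto
qed

text \<open>For a > 0 the power is an order isomorphism whose inverse is the power 1 / a, so it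
  commutes with arbitrary suprema.\<close>

lemma enn_powr_SUP:
  assumes "0 < a" "I \<noteq> {}"
  shows "enn_powr (SUP i\<in>I. f i) a = (SUP i\<in>I. enn_powr (f i) a)"
proof (rule antisym)
  let ?S = "SUP i\<in>I. enn_powr (f i) a"
  have "(SUP i\<in>I. f i) \<le> enn_powr ?S (1 / a)"
  proof (rule SUP_least)
    fix i assume "i \<in> I"
    then have "enn_powr (enn_powr (f i) a) (1 / a) \<le> enn_powr ?S (1 / a)"
      using assms by (intro enn_powr_mono SUP_upper) auto
    then show "f i \<le> enn_powr ?S (1 / a)" using assms by simp
  qed
  then have "enn_powr (SUP i\<in>I. f i) a \<le> enn_powr (enn_powr ?S (1 / a)) a"
    using assms by (intro enn_powr_mono) auto
  then show "enn_powr (SUP i\<in>I. f i) a \<le> ?S" using assms by simp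
  show "?S \<le> enn_powr (SUP i\<in>I. f i) a"
    using assms by (intro SUP_least enn_powr_mono SUP_upper) auto
qed

lemma enn_powr_sum_le:
  assumes "0 \<le> a"
  shows "enn_powr (x + y) a \<le> ennreal (2 powr a) * (enn_powr x a + enn_powr y a)"
proof -
  have "enn_powr (x + y) a \<le> enn_powr (2 * max x y) a"
    using assms by (intro enn_powr_mono) (auto simp: mult_2 intro!: add_mono)
  also have "\<dots> = ennreal (2 powr a) * enn_powr (max x y) a"
    using enn_powr_ennreal[of 2 a] by (simp add: enn_powr_mult)
  also have "\<dots> \<le> ennreal (2 powr a) * (enn_powr x a + enn_powr y a)"
    by (intro mult_left_mono) (auto simp: max_def)
  finally show ?thesis .
qed

section \<open>Young's and Hoelder's inequalities in [0, infinity]\<close>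

lemma conjugate_exponent_gt_1:
  fixes p q :: real
  assumes "1 < p" "1 / p + 1 / q = 1"
  shows "1 < q"
proof -
  have "0 < 1 / p" "1 / p < 1" using assms by auto
  then have "0 < 1 / q" "1 / q < 1" using assms by linarith+
  then show ?thesis by (simp add: divide_less_eq_1 zero_less_divide_iff split: if_splits)
qed

lemma ennreal_Young:
  assumes "1 < p" "1 / p + 1 / q = 1"
  shows "x * y \<le> ennreal (1 / p) * enn_powr x p + ennreal (1 / q) * enn_powr y q"
proof -
  note q = conjugate_exponent_gt_1[OF assms]
  show ?thesis
  proof (cases "x = 0 \<or> y = 0 \<or> x = top \<or> y = top")
    case True
    then show ?thesis using assms q
      by (auto simp: ennreal_mult_top ennreal_top_mult)
  next
    case False
    then obtain a b where ab: "x = ennreal a" "y = ennreal b" "0 \<le> a" "0 \<le> b"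
      by (metis ennreal_cases)
    have "a * b \<le> a powr p / p + b powr q / q"
      using assms q ab by (intro Youngs_inequality) auto
    then have "ennreal (a * b) \<le> ennreal (1 / p * a powr p + 1 / q * b powr q)"
      by (intro ennreal_leI) simp
    then show ?thesis using ab assms q
      by (simp add: enn_powr_ennreal flip: ennreal_mult ennreal_plus)
  qed
qed

text \<open>Both factors are normalised to unit norm and Young's inequality is integrated; 1/p + 1/q
  = 1 is then the bound for the normalised integral.\<close>

lemma nn_integral_Holder:
  assumes pq: "1 < p" "1 / p + 1 / q = 1"
    and [measurable]: "f \<in> borel_measurable M" "g \<in> borel_measurable M"
  shows "(\<integral>\<^sup>+x. f x * g x \<partial>M) \<le>
    enn_powr (\<integral>\<^sup>+x. enn_powr (f x) p \<partial>M) (1 / p) * enn_powr (\<integral>\<^sup>+x. enn_powr (g x) q \<partial>M) (1 / q)"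
    (is "_ \<le> enn_powr ?A _ * enn_powr ?B _")
proof -
  note q = conjugate_exponent_gt_1[OF pq]
  show ?thesis
  proof (cases "?A = 0 \<or> ?B = 0")
    \<comment> \<open>Since 0 * top = 0 in \<open>ennreal\<close>, a zero norm next to an infinite
      one makes the right side 0, so the integrand itself must vanish almost everywhere.\<close>
    case True
    then have "AE x in M. f x = 0 \<or> g x = 0"
    proof
      assume "?A = 0"
      then have "AE x in M. f x = 0" by (subst (asm) nn_integral_0_iff_AE) auto
      then show ?thesis by auto
    next
      assume "?B = 0"
      then have "AE x in M. g x = 0" by (subst (asm) nn_integral_0_iff_AE) auto
      then show ?thesis by auto
    qed
    then have "(\<integral>\<^sup>+x. f x * g x \<partial>M) = (\<integral>\<^sup>+x. 0 \<partial>M)"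
      by (intro nn_integral_cong_AE) auto
    then show ?thesis by simp
  next
    case False
    show ?thesis
    proof (cases "?A = top \<or> ?B = top")
      case True
      then have "enn_powr ?A (1 / p) * enn_powr ?B (1 / q) = top" using False
        by (auto simp: ennreal_mult_eq_top_iff)
      then show ?thesis by simp
    next
      case fin: False
      obtain A B where AB: "?A = ennreal A" "?B = ennreal B" "0 < A" "0 < B"
        using False fin by (metis ennreal_cases ennreal_0 order.not_eq_order_implies_strict)
      define a b where "a = A powr (1 / p)" and "b = B powr (1 / q)"
      have ab: "0 < a" "0 < b" "a powr p = A" "b powr q = B"
        using AB q pq(1) by (simp_all add: a_def b_def powr_powr)
      have 1: "(\<integral>\<^sup>+x. f x * g x \<partial>M) = ennreal (a * b) * (\<integral>\<^sup>+x. (ennreal (1 / a) * f x) * (ennreal (1 / b) * g x) \<partial>M)"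
      proof (subst nn_integral_cmult[symmetric])
        have *: "ennreal (a * b) * (ennreal (1 / a) * ennreal (1 / b)) = 1"
          using ab by (simp flip: ennreal_mult)
        have "ennreal (a * b) * (ennreal (1 / a) * u * (ennreal (1 / b) * v)) = u * v" for u v
        proof -
          have "ennreal (a * b) * (ennreal (1 / a) * u * (ennreal (1 / b) * v)) =
              (ennreal (a * b) * (ennreal (1 / a) * ennreal (1 / b))) * (u * v)"
            by (simp only: mult_ac)
          then show ?thesis by (simp only: * mult_1)
        qed
        then show "(\<integral>\<^sup>+x. f x * g x \<partial>M) =
            (\<integral>\<^sup>+x. ennreal (a * b) * (ennreal (1 / a) * f x * (ennreal (1 / b) * g x)) \<partial>M)"
          by simp
      qed measurable
      have "(\<integral>\<^sup>+x. (ennreal (1 / a) * f x) * (ennreal (1 / b) * g x) \<partial>M) \<le>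
         (\<integral>\<^sup>+x. ennreal (1 / p) * (ennreal (1 / A) * enn_powr (f x) p) + ennreal (1 / q) * (ennreal (1 / B) * enn_powr (g x) q) \<partial>M)"
      proof (rule nn_integral_mono)
        fix x
        have *: "enn_powr (ennreal (1 / a)) p = ennreal (1 / A)" "enn_powr (ennreal (1 / b)) q = ennreal (1 / B)"
          using ab by (simp_all add: enn_powr_ennreal powr_divide)
        show "(ennreal (1 / a) * f x) * (ennreal (1 / b) * g x) \<le> 
           ennreal (1 / p) * (ennreal (1 / A) * enn_powr (f x) p) + ennreal (1 / q) * (ennreal (1 / B) * enn_powr (g x) q)"
          using ennreal_Young[OF pq, of "ennreal (1 / a) * f x" "ennreal (1 / b) * g x"]
          by (simp add: enn_powr_mult *)
      qed
      also have "\<dots> = ennreal (1 / p) * (ennreal (1 / A) * ?A) + ennreal (1 / q) * (ennreal (1 / B) * ?B)"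
        by (simp add: nn_integral_add nn_integral_cmult)
      also have "\<dots> = 1"
        using AB pq q by (simp add: ennreal_mult[symmetric] ennreal_plus[symmetric] del: ennreal_plus)
      finally have "(\<integral>\<^sup>+x. f x * g x \<partial>M) \<le> ennreal (a * b) * 1"
        unfolding 1 by (intro mult_left_mono) auto
      also have "\<dots> = enn_powr ?A (1 / p) * enn_powr ?B (1 / q)"
        unfolding AB(1,2) a_def b_def using AB(3,4) by (simp add: enn_powr_ennreal ennreal_mult)
      finally show ?thesis .
    qed
  qed
qed

section \<open>The maximal operator of a laminar family\<close>

definition laminar :: "'a set set \<Rightarrow> bool" where
  "laminar F \<longleftrightarrow> (\<forall>P\<in>F. \<forall>Q\<in>F. P \<inter> Q = {} \<or> P \<subseteq> Q \<or> Q \<subseteq> P)"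

definition mean :: "'a measure \<Rightarrow> ('a \<Rightarrow> ennreal) \<Rightarrow> 'a set \<Rightarrow> ennreal" where
  "mean M g P = (\<integral>\<^sup>+x\<in>P. g x \<partial>M) / emeasure M P"

definition maximal :: "'a measure \<Rightarrow> 'a set set \<Rightarrow> ('a \<Rightarrow> ennreal) \<Rightarrow> 'a \<Rightarrow> ennreal" where
  "maximal M F g x = (SUP P\<in>F. mean M g P * indicator P x)"

lemma mean_le_maximal: "P \<in> F \<Longrightarrow> x \<in> P \<Longrightarrow> mean M g P \<le> maximal M F g x"
  unfolding maximal_def by (rule SUP_upper2[of P]) auto

lemma measurable_maximal [measurable]:
  "countable F \<Longrightarrow> F \<subseteq> sets M \<Longrightarrow> maximal M F g \<in> borel_measurable M"
  unfolding maximal_def[abs_def] by (intro borel_measurable_SUP) auto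

lemma maximal_empty [simp]: "maximal M {} g x = 0"
  by (simp add: maximal_def bot_ennreal)

lemma maximal_insert: "maximal M (insert P F) g x = max (mean M g P * indicator P x) (maximal M F g x)"
  by (simp add: maximal_def sup_max)

lemma nn_integral_split_set:
  assumes [measurable]: "f \<in> borel_measurable M" "P \<in> sets M"
  shows "(\<integral>\<^sup>+x. f x \<partial>M) = (\<integral>\<^sup>+x\<in>-P. f x \<partial>M) + (\<integral>\<^sup>+x\<in>P. f x \<partial>M)"
proof -
  have [measurable]: "(\<lambda>x. indicator (- P) x :: ennreal) \<in> borel_measurable M"
    unfolding indicator_def by measurable
  show ?thesis
    by (subst nn_integral_add[symmetric]) (auto intro!: nn_integral_cong split: split_indicator)
qed

text \<open>Removing a minimal member P of the family, the maximal function of the remaining family is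
  constant on P; this turns Doob's inequality into Young's inequality for two numbers.\<close>

lemma maximal_finite_Doob:
  fixes q :: real
  assumes "1 < q" and g [measurable]: "g \<in> borel_measurable M"
    and "finite F" "laminar F" "F \<subseteq> sets M"
    and "\<And>P. P \<in> F \<Longrightarrow> 0 < emeasure M P" "\<And>P. P \<in> F \<Longrightarrow> emeasure M P < top"
    and "\<And>P. P \<in> F \<Longrightarrow> (\<integral>\<^sup>+x\<in>P. g x \<partial>M) < top"
  shows "(\<integral>\<^sup>+x. enn_powr (maximal M F g x) q \<partial>M) < top \<and>
    (\<integral>\<^sup>+x. enn_powr (maximal M F g x) q \<partial>M) \<le>
      ennreal (q / (q - 1)) * (\<integral>\<^sup>+x. g x * enn_powr (maximal M F g x) (q - 1) \<partial>M)"
  using assms(3-)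
\<comment> \<open>Finiteness is carried through the induction: it makes the part off P a real number
  here, and it later allows dividing by a power of the integral.\<close>
proof (induction "card F" arbitrary: F)
  case 0
  then show ?case by simp
next
  case (Suc n)
  from Suc.hyps(2) have "F \<noteq> {}" by auto
  then obtain P where P: "P \<in> F" and Pmin: "\<And>Q. Q \<in> F \<Longrightarrow> Q \<subseteq> P \<Longrightarrow> Q = P"
    using finite_has_minimal[OF Suc.prems(1)] by metis
  define G where "G = F - {P}"
  have F: "F = insert P G" "P \<notin> G" using P by (auto simp: G_def)
  have IH: "(\<integral>\<^sup>+x. enn_powr (maximal M G g x) q \<partial>M) < top \<and>
    (\<integral>\<^sup>+x. enn_powr (maximal M G g x) q \<partial>M) \<le>
      ennreal (q / (q - 1)) * (\<integral>\<^sup>+x. g x * enn_powr (maximal M G g x) (q - 1) \<partial>M)"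
  proof (rule Suc.hyps(1))
    show "n = card G" using Suc.hyps(2) P Suc.prems(1) by (simp add: G_def)
    show "laminar G" using Suc.prems(2) by (auto simp: G_def laminar_def)
  qed (use Suc.prems in \<open>auto simp: G_def\<close>)
  have [measurable]: "P \<in> sets M" "maximal M G g \<in> borel_measurable M" "maximal M F g \<in> borel_measurable M"
    using P Suc.prems(1,3) by (auto intro!: measurable_maximal intro: countable_finite simp: G_def)
  have "P \<noteq> {}" using Suc.prems(4)[OF P] by (metis emeasure_empty less_irrefl)
  then obtain x0 where x0: "x0 \<in> P" by blast
  define c a where "c = maximal M G g x0" and "a = mean M g P"
  \<comment> \<open>By laminarity and minimality, any other member that meets P contains P.\<close>
  have c: "maximal M G g x = c" if "x \<in> P" for x
    unfolding c_def maximal_def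
  proof (rule SUP_cong)
    fix Q assume "Q \<in> G"
    then have "Q \<in> F" "Q \<noteq> P" by (auto simp: G_def)
    then have "Q \<inter> P = {} \<or> P \<subseteq> Q"
      using Suc.prems(2) P Pmin[of Q] unfolding laminar_def by metis
    then show "mean M g Q * indicator Q x = mean M g Q * indicator Q x0"
      using that x0 by (auto split: split_indicator)
  qed simp
  have off: "maximal M F g x = maximal M G g x" if "x \<notin> P" for x
    using that by (simp add: F maximal_insert)
  have on: "maximal M F g x = max a c" if "x \<in> P" for x
    using that c by (simp add: F maximal_insert a_def)
  show ?case
  \<comment> \<open>If the mean over P does not exceed c, adding P changes nothing; otherwise the
    value on P rises from c to a.\<close>
  proof (cases "a \<le> c")
    case True
    then have "maximal M F g x = maximal M G g x" for x
      using on off c by (cases "x \<in> P") (auto simp: max_def)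
    then show ?thesis using IH by simp
  next
    case False
    then have max: "max a c = a" by auto
    define A B where "A = (\<integral>\<^sup>+x\<in>-P. enn_powr (maximal M G g x) q \<partial>M)"
      and "B = (\<integral>\<^sup>+x\<in>-P. g x * enn_powr (maximal M G g x) (q - 1) \<partial>M)"
    define m where "m = measure M P"
    have m: "emeasure M P = ennreal m" "0 < m"
    proof -
      show *: "emeasure M P = ennreal m"
        unfolding m_def using Suc.prems(5)[OF P] less_top by (intro emeasure_eq_ennreal_measure) blast
      show "0 < m" using Suc.prems(4)[OF P] unfolding * by simp
    qed
    have intP: "(\<integral>\<^sup>+x\<in>P. g x \<partial>M) = a * ennreal m"
      using m by (simp add: a_def mean_def ennreal_divide_times ennreal_mult_divide_eq)
    have "a < top" using Suc.prems(6)[OF P] m unfolding intP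
      unfolding ennreal_mult_less_top by auto
    with False obtain a' c' where ac: "a = ennreal a'" "c = ennreal c'" "0 \<le> a'" "0 \<le> c'"
      by (metis ennreal_cases not_le order.strict_trans order.irrefl)
    have eqs: "(\<integral>\<^sup>+x. enn_powr (maximal M G g x) q \<partial>M) = A + enn_powr c q * ennreal m"
      "(\<integral>\<^sup>+x. enn_powr (maximal M F g x) q \<partial>M) = A + enn_powr a q * ennreal m"
      "(\<integral>\<^sup>+x. g x * enn_powr (maximal M G g x) (q - 1) \<partial>M) = B + enn_powr c (q - 1) * (a * ennreal m)"
      "(\<integral>\<^sup>+x. g x * enn_powr (maximal M F g x) (q - 1) \<partial>M) = B + enn_powr a (q - 1) * (a * ennreal m)"
    proof -
      have "(\<integral>\<^sup>+x\<in>P. enn_powr (maximal M H g x) q \<partial>M) = enn_powr d q * ennreal m"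
        "(\<integral>\<^sup>+x\<in>P. g x * enn_powr (maximal M H g x) (q - 1) \<partial>M) = enn_powr d (q - 1) * (a * ennreal m)"
        if "\<And>x. x \<in> P \<Longrightarrow> maximal M H g x = d" for H d
      proof -
        have "(\<integral>\<^sup>+x\<in>P. enn_powr (maximal M H g x) q \<partial>M) = (\<integral>\<^sup>+x. enn_powr d q * indicator P x \<partial>M)"
          using that by (intro nn_integral_cong) (auto split: split_indicator)
        then show "(\<integral>\<^sup>+x\<in>P. enn_powr (maximal M H g x) q \<partial>M) = enn_powr d q * ennreal m"
          using m by (simp add: nn_integral_cmult_indicator)
        have "(\<integral>\<^sup>+x\<in>P. g x * enn_powr (maximal M H g x) (q - 1) \<partial>M) =
            (\<integral>\<^sup>+x. enn_powr d (q - 1) * (g x * indicator P x) \<partial>M)"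
          using that by (intro nn_integral_cong) (auto split: split_indicator simp: mult.commute)
        also have "\<dots> = enn_powr d (q - 1) * (\<integral>\<^sup>+x\<in>P. g x \<partial>M)"
          by (rule nn_integral_cmult) measurable
        finally show "(\<integral>\<^sup>+x\<in>P. g x * enn_powr (maximal M H g x) (q - 1) \<partial>M) = enn_powr d (q - 1) * (a * ennreal m)"
          by (simp only: intP)
      qed
      note * = this[of G c, OF c] this[of F a, OF on[unfolded max]]
      have AB: "A = (\<integral>\<^sup>+x\<in>-P. enn_powr (maximal M F g x) q \<partial>M)"
        "B = (\<integral>\<^sup>+x\<in>-P. g x * enn_powr (maximal M F g x) (q - 1) \<partial>M)"
        unfolding A_def B_def using off by (auto intro!: nn_integral_cong split: split_indicator)
      have split: "(\<integral>\<^sup>+x. enn_powr (maximal M H g x) q \<partial>M) = (\<integral>\<^sup>+x\<in>-P. enn_powr (maximal M H g x) q \<partial>M) +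
          (\<integral>\<^sup>+x\<in>P. enn_powr (maximal M H g x) q \<partial>M)"
        "(\<integral>\<^sup>+x. g x * enn_powr (maximal M H g x) (q - 1) \<partial>M) =
          (\<integral>\<^sup>+x\<in>-P. g x * enn_powr (maximal M H g x) (q - 1) \<partial>M) +
          (\<integral>\<^sup>+x\<in>P. g x * enn_powr (maximal M H g x) (q - 1) \<partial>M)"
        if [measurable]: "maximal M H g \<in> borel_measurable M" for H
        by (rule nn_integral_split_set; measurable)+
      show "(\<integral>\<^sup>+x. enn_powr (maximal M G g x) q \<partial>M) = A + enn_powr c q * ennreal m"
        by (subst split) (simp_all only: * A_def \<open>maximal M G g \<in> borel_measurable M\<close>)
      show "(\<integral>\<^sup>+x. enn_powr (maximal M F g x) q \<partial>M) = A + enn_powr a q * ennreal m"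
        by (subst split) (simp_all only: * AB \<open>maximal M F g \<in> borel_measurable M\<close>)
      show "(\<integral>\<^sup>+x. g x * enn_powr (maximal M G g x) (q - 1) \<partial>M) = B + enn_powr c (q - 1) * (a * ennreal m)"
        by (subst split) (simp_all only: * B_def \<open>maximal M G g \<in> borel_measurable M\<close>)
      show "(\<integral>\<^sup>+x. g x * enn_powr (maximal M F g x) (q - 1) \<partial>M) = B + enn_powr a (q - 1) * (a * ennreal m)"
        by (subst split) (simp_all only: * AB \<open>maximal M F g \<in> borel_measurable M\<close>)
    qed
    from IH have "A < top" unfolding eqs by simp
    then obtain A' where A': "A = ennreal A'" "0 \<le> A'" by (cases A) auto
    show ?thesis
    proof
      show "(\<integral>\<^sup>+x. enn_powr (maximal M F g x) q \<partial>M) < top"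
        unfolding eqs using \<open>A < top\<close> \<open>a < top\<close> by (simp add: ennreal_mult_less_top)
      show "(\<integral>\<^sup>+x. enn_powr (maximal M F g x) q \<partial>M) \<le>
        ennreal (q / (q - 1)) * (\<integral>\<^sup>+x. g x * enn_powr (maximal M F g x) (q - 1) \<partial>M)"
      proof (cases B)
        case top
        then show ?thesis unfolding eqs using \<open>1 < q\<close> by (simp add: ennreal_mult_top)
      next
        case (real B')
        have "A' + c' powr q * m \<le> q / (q - 1) * (B' + c' powr (q - 1) * (a' * m))"
          using IH \<open>1 < q\<close> ac A' m real unfolding eqs
          by (simp add: enn_powr_ennreal flip: ennreal_mult ennreal_plus)
        \<comment> \<open>Young's inequality with exponents q and q / (q - 1). It bounds the old
          term on P by c^q m + a^q m / (q - 1), and 1 / (q - 1) + 1 = q / (q - 1) is exactly the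
          constant claimed.\<close>
        moreover have "a' * c' powr (q - 1) \<le> a' powr q / q + (c' powr (q - 1)) powr (q / (q - 1)) / (q / (q - 1))"
          using \<open>1 < q\<close> ac by (intro Youngs_inequality) (auto simp: field_simps)
        then have "q / (q - 1) * (a' * c' powr (q - 1)) \<le> a' powr q / (q - 1) + c' powr q"
        proof -
          have e: "(c' powr (q - 1)) powr (q / (q - 1)) = c' powr q"
            using \<open>1 < q\<close> by (simp add: powr_powr)
          assume "a' * c' powr (q - 1) \<le> a' powr q / q + (c' powr (q - 1)) powr (q / (q - 1)) / (q / (q - 1))"
          then have "q / (q - 1) * (a' * c' powr (q - 1)) \<le> q / (q - 1) * (a' powr q / q + c' powr q / (q / (q - 1)))"
            using \<open>1 < q\<close> unfolding e by (intro mult_left_mono) auto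
          also have "\<dots> = a' powr q / (q - 1) + c' powr q"
            using \<open>1 < q\<close> by (simp add: distrib_left)
          finally show ?thesis .
        qed
        then have "q / (q - 1) * (a' * c' powr (q - 1)) * m \<le> (a' powr q / (q - 1) + c' powr q) * m"
          using m by (intro mult_right_mono) auto
        ultimately have "A' \<le> q / (q - 1) * B' + a' powr q / (q - 1) * m"
          by (simp add: algebra_simps)
        moreover have "a' powr q / (q - 1) * m + a' powr q * m = q / (q - 1) * (a' powr q * m)"
          using \<open>1 < q\<close> by (simp add: field_simps)
        moreover have "a' powr q = a' powr (q - 1) * a'"
          using ac \<open>1 < q\<close> by (cases "a' = 0") (auto simp: powr_diff)
        ultimately have "A' + a' powr q * m \<le> q / (q - 1) * (B' + a' powr (q - 1) * (a' * m))"
          by (simp add: algebra_simps)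
        then show ?thesis unfolding eqs using \<open>1 < q\<close> ac A' m real
          by (simp add: enn_powr_ennreal flip: ennreal_mult ennreal_plus)
      qed
    qed
  qed
qed

text \<open>Hoelder's inequality applied to Doob's estimate gives X <= q' G^(1/q) X^(1/q') for the
  two integrals X and G. Dividing by X^(1/q') is legitimate because X is finite for a finite
  family.\<close>

lemma maximal_finite_bound:
  fixes q :: real
  assumes "1 < q" and g [measurable]: "g \<in> borel_measurable M"
    and F: "finite F" "laminar F" "F \<subseteq> sets M"
    and pos: "\<And>P. P \<in> F \<Longrightarrow> 0 < emeasure M P" "\<And>P. P \<in> F \<Longrightarrow> emeasure M P < top"
  shows "(\<integral>\<^sup>+x. enn_powr (maximal M F g x) q \<partial>M) \<le>
    ennreal ((q / (q - 1)) powr q) * (\<integral>\<^sup>+x. enn_powr (g x) q \<partial>M)" (is "?X \<le> _ * ?G")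
proof (cases "?G = top")
  case True
  then show ?thesis using \<open>1 < q\<close> by (simp add: ennreal_mult_top)
next
  case False
  define q' where "q' = q / (q - 1)"
  have q': "1 < q'" "1 / q + 1 / q' = 1" using \<open>1 < q\<close> by (auto simp: q'_def field_simps)
  have fin: "(\<integral>\<^sup>+x\<in>P. g x \<partial>M) < top" if "P \<in> F" for P
  proof -
    have [measurable]: "P \<in> sets M" using F that by auto
    have "(\<integral>\<^sup>+x. enn_powr (indicator P x) q' \<partial>M) = (\<integral>\<^sup>+x. indicator P x \<partial>M)"
      by (intro nn_integral_cong) (auto split: split_indicator)
    then have *: "(\<integral>\<^sup>+x. enn_powr (indicator P x) q' \<partial>M) = emeasure M P"
      by simp
    have "(\<integral>\<^sup>+x\<in>P. g x \<partial>M) \<le> enn_powr ?G (1 / q) * enn_powr (emeasure M P) (1 / q')"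
      unfolding *[symmetric] by (rule nn_integral_Holder[OF \<open>1 < q\<close> q'(2)]) measurable
    also have "\<dots> < top"
      unfolding ennreal_mult_less_top enn_powr_less_top_iff using False pos(2)[OF that] less_top by blast
    finally show ?thesis .
  qed
  have D: "?X < top" "?X \<le> ennreal q' * (\<integral>\<^sup>+x. g x * enn_powr (maximal M F g x) (q - 1) \<partial>M)"
    using maximal_finite_Doob[OF \<open>1 < q\<close> g F pos fin] by (simp_all add: q'_def)
  have [measurable]: "maximal M F g \<in> borel_measurable M"
    using F by (intro measurable_maximal countable_finite)
  note D(2)
  also have "(\<integral>\<^sup>+x. g x * enn_powr (maximal M F g x) (q - 1) \<partial>M) \<le>
      enn_powr ?G (1 / q) * enn_powr (\<integral>\<^sup>+x. enn_powr (enn_powr (maximal M F g x) (q - 1)) q' \<partial>M) (1 / q')"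
    by (rule nn_integral_Holder[OF \<open>1 < q\<close> q'(2)]) measurable
  also have "(\<integral>\<^sup>+x. enn_powr (enn_powr (maximal M F g x) (q - 1)) q' \<partial>M) = ?X"
    using \<open>1 < q\<close> by (simp add: enn_powr_powr q'_def)
  finally have *: "?X \<le> ennreal q' * (enn_powr ?G (1 / q) * enn_powr ?X (1 / q'))"
    by (simp add: mult_left_mono)
  show ?thesis
  proof (cases "?X = 0")
    case False
    obtain X G where X: "?X = ennreal X" "0 \<le> X" and G: "?G = ennreal G" "0 \<le> G"
      using D(1) \<open>?G \<noteq> top\<close> by (metis ennreal_cases less_top)
    have "0 < X" using X False by (metis ennreal_0 le_less)
    have "X \<le> q' * (G powr (1 / q) * X powr (1 / q'))"
      using * q' \<open>1 < q\<close> unfolding X(1) G(1) using X(2) G(2) by (simp add: enn_powr_ennreal flip: ennreal_mult)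
    moreover have "X = X powr (1 / q) * X powr (1 / q')"
      using \<open>0 < X\<close> q' by (simp flip: powr_add)
    ultimately have "X powr (1 / q) * X powr (1 / q') \<le> (q' * G powr (1 / q)) * X powr (1 / q')"
      by (simp add: mult.assoc)
    then have "X powr (1 / q) \<le> q' * G powr (1 / q)"
      using \<open>0 < X\<close> by simp
    then have "(X powr (1 / q)) powr q \<le> (q' * G powr (1 / q)) powr q"
      using \<open>1 < q\<close> by (intro powr_mono2) auto
    then have "X \<le> q' powr q * G"
      using \<open>1 < q\<close> q' X G by (simp add: powr_mult powr_powr)
    then show ?thesis unfolding X(1) G(1) q'_def[symmetric] using G(2) by (simp flip: ennreal_mult)
  qed simp
qed

text \<open>The constant for finite families does not depend on the family, so an exhaustion by
  finite subfamilies and monotone convergence suffice.\<close>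

theorem maximal_bound:
  fixes q :: real
  assumes "1 < q" and g [measurable]: "g \<in> borel_measurable M"
    and F: "countable F" "laminar F" "F \<subseteq> sets M"
    and pos: "\<And>P. P \<in> F \<Longrightarrow> 0 < emeasure M P" "\<And>P. P \<in> F \<Longrightarrow> emeasure M P < top"
  shows "(\<integral>\<^sup>+x. enn_powr (maximal M F g x) q \<partial>M) \<le>
    ennreal ((q / (q - 1)) powr q) * (\<integral>\<^sup>+x. enn_powr (g x) q \<partial>M)"
proof (cases "F = {}")
  case False
  define H where "H n = from_nat_into F ` {..n}" for n
  have H: "finite (H n)" "H n \<subseteq> F" "H n \<noteq> {}" for n
    using from_nat_into[OF False] by (auto simp: H_def)
  have HF: "F = (\<Union>n. H n)"
    using range_from_nat_into[OF False F(1)] unfolding H_def by blast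
  have "maximal M F g x = (SUP n. maximal M (H n) g x)" for x
    unfolding maximal_def by (subst HF) (rule SUP_UNION)
  then have eq: "enn_powr (maximal M F g x) q = (SUP n. enn_powr (maximal M (H n) g x) q)" for x
    using \<open>1 < q\<close> by (simp add: enn_powr_SUP)
  have [measurable]: "maximal M (H n) g \<in> borel_measurable M" for n
    using F H[of n] by (intro measurable_maximal countable_finite) auto
  have "(\<integral>\<^sup>+x. enn_powr (maximal M F g x) q \<partial>M) = (SUP n. \<integral>\<^sup>+x. enn_powr (maximal M (H n) g x) q \<partial>M)"
    unfolding eq
  proof (rule nn_integral_monotone_convergence_SUP)
    show "incseq (\<lambda>n x. enn_powr (maximal M (H n) g x) q)"
      using \<open>1 < q\<close> unfolding maximal_def
      by (intro monoI le_funI enn_powr_mono SUP_subset_mono) (auto simp: H_def)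
  qed measurable
  also have "\<dots> \<le> ennreal ((q / (q - 1)) powr q) * (\<integral>\<^sup>+x. enn_powr (g x) q \<partial>M)"
  proof (rule SUP_least, rule maximal_finite_bound[OF \<open>1 < q\<close> g])
    fix n
    show "laminar (H n)" using F(2) H(2)[of n] unfolding laminar_def by blast
  qed (use H F pos in blast)+
  finally show ?thesis .
qed simp

text \<open>Lerner's argument: the mean of g over a member P is dominated by iterating the maximal
  operators with respect to the dual weight and to the weight itself, whose bounds do not depend
  on the weight.\<close>

theorem Muckenhoupt_laminar:
  fixes p K :: real and \<omega> :: "'a \<Rightarrow> real"
  assumes "1 < p" "0 < K" and \<omega> [measurable]: "\<omega> \<in> borel_measurable M" and pos: "\<And>x. 0 < \<omega> x"
    and F: "countable F" "laminar F" "F \<subseteq> sets M"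
    and Ap: "\<And>P. P \<in> F \<Longrightarrow> \<exists>m W V. 0 < m \<and> 0 < W \<and> 0 < V \<and> emeasure M P = ennreal m \<and>
      (\<integral>\<^sup>+x\<in>P. ennreal (\<omega> x) \<partial>M) = ennreal W \<and>
      (\<integral>\<^sup>+x\<in>P. ennreal (\<omega> x powr (- (1 / (p - 1)))) \<partial>M) = ennreal V \<and>
      W * V powr (p - 1) \<le> K * m powr p"
    and g [measurable]: "g \<in> borel_measurable M"
  shows "(\<integral>\<^sup>+x. ennreal (\<omega> x) * enn_powr (maximal M F g x) p \<partial>M) \<le>
    ennreal (K powr (p / (p - 1)) * p powr (p / (p - 1)) * (p / (p - 1)) powr p) *
    (\<integral>\<^sup>+x. ennreal (\<omega> x) * enn_powr (g x) p \<partial>M)"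
proof -
  define \<sigma> where "\<sigma> x = \<omega> x powr (- (1 / (p - 1)))" for x
  define p' where "p' = p / (p - 1)"
  have p': "1 < p'" "p' / (p' - 1) = p" "(p - 1) * p' = p" "1 / (p - 1) * p = p'"
    using \<open>1 < p\<close> by (auto simp: p'_def field_simps)
  have \<sigma>: "0 < \<sigma> x" for x using pos[of x] by (simp add: \<sigma>_def)
  have [measurable]: "\<sigma> \<in> borel_measurable M" unfolding \<sigma>_def[abs_def] by measurable
  define Mw Mv where "Mw = density M (\<lambda>x. ennreal (\<omega> x))" and "Mv = density M (\<lambda>x. ennreal (\<sigma> x))"
  have [measurable_cong]: "sets Mw = sets M" "sets Mv = sets M" by (auto simp: Mw_def Mv_def)
  have int_w: "(\<integral>\<^sup>+x. f x \<partial>Mw) = (\<integral>\<^sup>+x. ennreal (\<omega> x) * f x \<partial>M)" if "f \<in> borel_measurable M" for f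
    unfolding Mw_def using that by (intro nn_integral_density) measurable
  have int_v: "(\<integral>\<^sup>+x. f x \<partial>Mv) = (\<integral>\<^sup>+x. ennreal (\<sigma> x) * f x \<partial>M)" if "f \<in> borel_measurable M" for f
    unfolding Mv_def using that by (intro nn_integral_density) measurable
  have [measurable]: "P \<in> sets M" if "P \<in> F" for P using F that by auto
  have em_w: "emeasure Mw P = (\<integral>\<^sup>+x\<in>P. ennreal (\<omega> x) \<partial>M)" if "P \<in> F" for P
    using that unfolding Mw_def by (intro emeasure_density) auto
  have em_v: "emeasure Mv P = (\<integral>\<^sup>+x\<in>P. ennreal (\<sigma> x) \<partial>M)" if "P \<in> F" for P
    using that unfolding Mv_def by (intro emeasure_density) auto
  \<comment> \<open>\<open>h0\<close> is the maximal function of g / \<sigma> for the dual weight.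
    The factor 1 / \<omega> in \<open>h\<close> turns integrals of \<open>h\<close> against \<omega>
    into plain integrals of the power p - 1 of \<open>h0\<close>.\<close>
  define h0 where "h0 = maximal Mv F (\<lambda>x. ennreal (1 / \<sigma> x) * g x)"
  define h where "h x = ennreal (1 / \<omega> x) * enn_powr (h0 x) (p - 1)" for x
  have "h0 \<in> borel_measurable Mv" unfolding h0_def using F by (intro measurable_maximal) (auto simp: Mv_def)
  then have [measurable]: "h0 \<in> borel_measurable M" by (simp add: Mv_def)
  have h [measurable]: "h \<in> borel_measurable M" unfolding h_def[abs_def] by measurable
  have "maximal Mw F h \<in> borel_measurable Mw" using F by (intro measurable_maximal) (auto simp: Mw_def)
  then have [measurable]: "maximal Mw F h \<in> borel_measurable M" by (simp add: Mw_def)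
  \<comment> \<open>Let m' be the \<sigma>-mean of g / \<sigma> over P, so that the mean of g is m'
    V / m and m' <= \<open>h0\<close> on P. Then (mean of g)^(p-1) = (m'^(p-1) m) (V^(p-1) / m^p),
    the first factor is at most W times the \<omega>-mean of \<open>h\<close>, and A_p bounds W
    V^(p-1) / m^p by K.\<close>
  have mean: "enn_powr (mean M g P) (p - 1) \<le> ennreal K * mean Mw h P" if P: "P \<in> F" for P
  proof -
    have [measurable]: "P \<in> sets M" using F P by auto
    obtain m W V where mWV: "0 < m" "0 < W" "0 < V" "emeasure M P = ennreal m"
      "emeasure Mw P = ennreal W" "emeasure Mv P = ennreal V" "W * V powr (p - 1) \<le> K * m powr p"
      using Ap[OF P] em_w[OF P] em_v[OF P] unfolding \<sigma>_def by auto
    define m' where "m' = mean Mv (\<lambda>x. ennreal (1 / \<sigma> x) * g x) P"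
    have "(\<integral>\<^sup>+x\<in>P. ennreal (1 / \<sigma> x) * g x \<partial>Mv) = (\<integral>\<^sup>+x\<in>P. g x \<partial>M)"
    proof (subst int_v)
      have "ennreal (\<sigma> x) * (ennreal (1 / \<sigma> x) * g x * indicator P x) = g x * indicator P x" for x
      proof -
        have "ennreal (\<sigma> x) * ennreal (1 / \<sigma> x) = 1" using \<sigma>[of x] by (simp flip: ennreal_mult)
        then show ?thesis by (metis mult.assoc mult_1)
      qed
      then show "(\<integral>\<^sup>+x. ennreal (\<sigma> x) * (ennreal (1 / \<sigma> x) * g x * indicator P x) \<partial>M) = (\<integral>\<^sup>+x\<in>P. g x \<partial>M)"
        by simp
    qed measurable
    then have g_eq: "(\<integral>\<^sup>+x\<in>P. g x \<partial>M) = m' * ennreal V"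
      using mWV by (simp add: m'_def mean_def ennreal_divide_times ennreal_mult_divide_eq)
    have "enn_powr m' (p - 1) * ennreal m = (\<integral>\<^sup>+x. enn_powr m' (p - 1) * indicator P x \<partial>M)"
      using mWV by (simp add: nn_integral_cmult_indicator)
    also have "\<dots> \<le> (\<integral>\<^sup>+x. ennreal (\<omega> x) * (h x * indicator P x) \<partial>M)"
    proof (rule nn_integral_mono)
      fix x
      have "enn_powr m' (p - 1) * indicator P x \<le> enn_powr (h0 x) (p - 1) * indicator P x"
        using mean_le_maximal[OF P, of x Mv] \<open>1 < p\<close>
        by (auto simp: m'_def h0_def split: split_indicator intro!: enn_powr_mono)
      also have "\<dots> = ennreal (\<omega> x) * (h x * indicator P x)"
      proof -
        have "ennreal (\<omega> x) * ennreal (1 / \<omega> x) = 1" using pos[of x] by (simp flip: ennreal_mult)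
        then show ?thesis unfolding h_def by (metis mult.assoc mult_1)
      qed
      finally show "enn_powr m' (p - 1) * indicator P x \<le> ennreal (\<omega> x) * (h x * indicator P x)" .
    qed
    also have "\<dots> = (\<integral>\<^sup>+x\<in>P. h x \<partial>Mw)" by (rule int_w[symmetric]) measurable
    also have "\<dots> = mean Mw h P * ennreal W"
      using mWV by (simp add: mean_def ennreal_divide_times ennreal_mult_divide_eq)
    finally have *: "enn_powr m' (p - 1) * ennreal m \<le> mean Mw h P * ennreal W" .
    define c where "c = V powr (p - 1) / m powr p"
    have c: "0 \<le> c" "c * W \<le> K" "m * c = (V / m) powr (p - 1)"
      using mWV by (auto simp: c_def field_simps powr_divide powr_diff)
    have "mean M g P = m' * ennreal (V / m)"
      unfolding mean_def g_eq using mWV by (simp add: divide_ennreal[symmetric] ennreal_times_divide)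
    then have "enn_powr (mean M g P) (p - 1) = (enn_powr m' (p - 1) * ennreal m) * ennreal c"
      using mWV c by (simp add: enn_powr_mult enn_powr_ennreal mult.assoc flip: ennreal_mult)
    also have "\<dots> \<le> (mean Mw h P * ennreal W) * ennreal c"
      by (intro mult_right_mono *) simp
    also have "\<dots> = ennreal (c * W) * mean Mw h P"
      using mWV c by (simp add: ennreal_mult mult_ac)
    also have "\<dots> \<le> ennreal K * mean Mw h P"
      using c by (intro mult_right_mono ennreal_leI) auto
    finally show ?thesis .
  qed
  have ptw: "maximal M F g x \<le> enn_powr (ennreal K * maximal Mw F h x) (1 / (p - 1))" for x
    unfolding maximal_def[of M]
  proof (rule SUP_least)
    fix P assume P: "P \<in> F"
    show "mean M g P * indicator P x \<le> enn_powr (ennreal K * maximal Mw F h x) (1 / (p - 1))"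
    proof (cases "x \<in> P")
      case True
      have "enn_powr (enn_powr (mean M g P) (p - 1)) (1 / (p - 1)) \<le> enn_powr (ennreal K * maximal Mw F h x) (1 / (p - 1))"
        using \<open>1 < p\<close> P True
        by (intro enn_powr_mono order_trans[OF mean[OF P]] mult_left_mono mean_le_maximal) auto
      then show ?thesis using \<open>1 < p\<close> True by simp
    qed simp
  qed
  have "(\<integral>\<^sup>+x. ennreal (\<omega> x) * enn_powr (maximal M F g x) p \<partial>M) \<le>
      (\<integral>\<^sup>+x. ennreal (K powr p') * (ennreal (\<omega> x) * enn_powr (maximal Mw F h x) p') \<partial>M)"
  proof (rule nn_integral_mono)
    fix x
    have "enn_powr (maximal M F g x) p \<le> enn_powr (enn_powr (ennreal K * maximal Mw F h x) (1 / (p - 1))) p"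
      using \<open>1 < p\<close> by (intro enn_powr_mono ptw) auto
    also have "\<dots> = ennreal (K powr p') * enn_powr (maximal Mw F h x) p'"
      unfolding enn_powr_powr p' using \<open>0 < K\<close> by (simp add: enn_powr_mult enn_powr_ennreal)
    finally have "ennreal (\<omega> x) * enn_powr (maximal M F g x) p \<le>
        ennreal (\<omega> x) * (ennreal (K powr p') * enn_powr (maximal Mw F h x) p')"
      by (rule mult_left_mono) simp
    then show "ennreal (\<omega> x) * enn_powr (maximal M F g x) p \<le>
        ennreal (K powr p') * (ennreal (\<omega> x) * enn_powr (maximal Mw F h x) p')"
      by (simp only: mult.left_commute)
  qed
  also have "\<dots> = ennreal (K powr p') * (\<integral>\<^sup>+x. ennreal (\<omega> x) * enn_powr (maximal Mw F h x) p' \<partial>M)"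
    by (rule nn_integral_cmult) measurable
  also have "(\<integral>\<^sup>+x. ennreal (\<omega> x) * enn_powr (maximal Mw F h x) p' \<partial>M) = (\<integral>\<^sup>+x. enn_powr (maximal Mw F h x) p' \<partial>Mw)"
    by (rule int_w[symmetric]) measurable
  also have "\<dots> \<le> ennreal ((p' / (p' - 1)) powr p') * (\<integral>\<^sup>+x. enn_powr (h x) p' \<partial>Mw)"
    using p' F
  proof (intro maximal_bound)
    fix P assume P: "P \<in> F"
    show "0 < emeasure Mw P" "emeasure Mw P < top"
      using Ap[OF P] em_w[OF P] by auto
  qed (auto simp: Mw_def h)
  also have "(\<integral>\<^sup>+x. enn_powr (h x) p' \<partial>Mw) = (\<integral>\<^sup>+x. ennreal (\<omega> x) * enn_powr (h x) p' \<partial>M)"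
    by (rule int_w) measurable
  \<comment> \<open>The exponents match because 1 - p' = -1 / (p - 1), hence \<omega>^(1 - p') =
    \<sigma>.\<close>
  also have "\<dots> = (\<integral>\<^sup>+x. ennreal (\<sigma> x) * enn_powr (h0 x) p \<partial>M)"
  proof (rule nn_integral_cong)
    fix x
    have "\<omega> x * (1 / \<omega> x) powr p' = \<omega> x powr (1 - p')" using pos[of x] by (simp add: powr_divide powr_diff)
    also have "1 - p' = - (1 / (p - 1))" using \<open>1 < p\<close> by (simp add: p'_def field_simps)
    finally have "ennreal (\<omega> x) * ennreal ((1 / \<omega> x) powr p') = ennreal (\<sigma> x)"
      using pos[of x] by (simp add: \<sigma>_def flip: ennreal_mult)
    then show "ennreal (\<omega> x) * enn_powr (h x) p' = ennreal (\<sigma> x) * enn_powr (h0 x) p"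
      unfolding h_def enn_powr_mult enn_powr_powr p' using pos[of x]
      by (simp add: enn_powr_ennreal flip: mult.assoc)
  qed
  also have "\<dots> = (\<integral>\<^sup>+x. enn_powr (h0 x) p \<partial>Mv)"
    by (rule int_v[symmetric]) measurable
  also have "\<dots> \<le> ennreal ((p / (p - 1)) powr p) * (\<integral>\<^sup>+x. enn_powr (ennreal (1 / \<sigma> x) * g x) p \<partial>Mv)"
    using \<open>1 < p\<close> F unfolding h0_def
  proof (intro maximal_bound)
    fix P assume P: "P \<in> F"
    show "0 < emeasure Mv P" "emeasure Mv P < top"
      using Ap[OF P] em_v[OF P] by (auto simp: \<sigma>_def)
  next
    show "(\<lambda>x. ennreal (1 / \<sigma> x) * g x) \<in> borel_measurable Mv" by measurable
  qed (auto simp: Mv_def)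
  also have "(\<integral>\<^sup>+x. enn_powr (ennreal (1 / \<sigma> x) * g x) p \<partial>Mv) =
      (\<integral>\<^sup>+x. ennreal (\<sigma> x) * enn_powr (ennreal (1 / \<sigma> x) * g x) p \<partial>M)"
    by (rule int_v) measurable
  \<comment> \<open>The dual matching: \<sigma>^(1 - p) = \<omega>.\<close>
  also have "\<dots> = (\<integral>\<^sup>+x. ennreal (\<omega> x) * enn_powr (g x) p \<partial>M)"
  proof (rule nn_integral_cong)
    fix x
    have "\<sigma> x * (1 / \<sigma> x) powr p = \<sigma> x powr (1 - p)" using \<sigma>[of x] by (simp add: powr_divide powr_diff)
    also have "\<dots> = \<omega> x powr (- (1 / (p - 1)) * (1 - p))" by (simp only: \<sigma>_def powr_powr)
    also have "- (1 / (p - 1)) * (1 - p) = 1" using \<open>1 < p\<close> by (simp add: field_simps)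
    also have "\<omega> x powr 1 = \<omega> x" using pos[of x] by simp
    finally have "ennreal (\<sigma> x) * ennreal ((1 / \<sigma> x) powr p) = ennreal (\<omega> x)"
      using \<sigma>[of x] by (simp flip: ennreal_mult)
    then show "ennreal (\<sigma> x) * enn_powr (ennreal (1 / \<sigma> x) * g x) p = ennreal (\<omega> x) * enn_powr (g x) p"
      unfolding enn_powr_mult using \<sigma>[of x] by (simp add: enn_powr_ennreal flip: mult.assoc)
  qed
  finally have "(\<integral>\<^sup>+x. ennreal (\<omega> x) * enn_powr (maximal M F g x) p \<partial>M) \<le>
      ennreal (K powr p') * (ennreal (p powr p') * (ennreal ((p / (p - 1)) powr p) *
        (\<integral>\<^sup>+x. ennreal (\<omega> x) * enn_powr (g x) p \<partial>M)))"
    unfolding p' by (simp add: mult_left_mono)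
  then show ?thesis
    by (simp add: p'_def ennreal_mult mult.assoc)
qed

section \<open>Cubes\<close>

lemma mem_cube: "x \<in> cube c s \<longleftrightarrow> (\<forall>i. c $ i \<le> x $ i \<and> x $ i < c $ i + s)"
  by (simp add: cube_def)

lemma cube_borel [measurable]: "cube c s \<in> sets borel"
proof -
  have "cube c s = (\<Inter>i. {x. c $ i \<le> x $ i} \<inter> {x. x $ i < c $ i + s})"
    by (auto simp: cube_def)
  also have "\<dots> \<in> sets borel"
    by (intro sets.countable_INT'' sets.Int borel_closed borel_open closed_halfspace_component_ge_cart
        open_halfspace_component_lt_cart) auto
  finally show ?thesis .
qed

lemma cube_lebesgue [measurable]: "cube c s \<in> sets lebesgue"
  using cube_borel by (simp add: lborelD)

text \<open>The half-open cube is squeezed between an open and a closed box of equal volume.\<close>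

lemma emeasure_cube:
  fixes c :: "real^'d"
  assumes "0 \<le> s"
  shows "emeasure lebesgue (cube c s) = ennreal (s ^ CARD('d))"
proof -
  define u where "u = c + s *\<^sub>R One"
  have u: "u \<bullet> b = c \<bullet> b + s" if "b \<in> Basis" for b
    using that by (simp add: u_def inner_add_left)
  have ui: "u $ i = c $ i + s" for i
    using u[of "axis i 1"] by (simp add: inner_axis)
  have le: "c \<bullet> b \<le> u \<bullet> b" if "b \<in> Basis" for b using u[OF that] assms by simp
  have "(\<Prod>b\<in>Basis. (u - c) \<bullet> b) = s ^ CARD('d)"
    using u by (simp add: inner_diff_left)
  then have bx: "emeasure lborel (box c u) = ennreal (s ^ CARD('d))"
    "emeasure lborel (cbox c u) = ennreal (s ^ CARD('d))"
    using le by (simp_all add: emeasure_lborel_box_eq emeasure_lborel_cbox_eq)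
  have "box c u \<subseteq> cube c s" "cube c s \<subseteq> cbox c u"
    by (auto simp: mem_box_cart mem_cube ui less_imp_le)
  then have "emeasure lborel (box c u) \<le> emeasure lborel (cube c s)"
    "emeasure lborel (cube c s) \<le> emeasure lborel (cbox c u)"
    by (auto intro!: emeasure_mono)
  then show ?thesis unfolding bx by (simp add: antisym)
qed

section \<open>Shifted dyadic cubes\<close>

text \<open>Encoded by integer parts, so that the index in a coarse generation is the integer
  quotient of the index in a finer one and nesting needs no geometry. The generation is natural:
  sides never exceed 1.\<close>

definition dcube :: "real^'d \<Rightarrow> nat \<Rightarrow> int^'d \<Rightarrow> (real^'d) set" where
  "dcube \<delta> k m = {y. \<forall>i. \<lfloor>2 ^ k * (y $ i - \<delta> $ i)\<rfloor> = m $ i}"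

text \<open>The shift does not depend on the generation, so for each b the cubes of all sizes form a
  single laminar family.\<close>

definition shift :: "bool^'d \<Rightarrow> real^'d" where
  "shift b = (\<chi> i. if b $ i then 1 / 3 else 0)"

lemma dcube_eq_cube: "dcube \<delta> k m = cube (\<chi> i. \<delta> $ i + real_of_int (m $ i) / 2 ^ k) (1 / 2 ^ k)"
  unfolding dcube_def cube_def
  by (auto simp: floor_eq_iff field_simps)

lemma dcube_subset:
  assumes "k \<le> k'" "x \<in> dcube \<delta> k m" "x \<in> dcube \<delta> k' m'"
  shows "dcube \<delta> k' m' \<subseteq> dcube \<delta> k m"
proof
  fix y assume y: "y \<in> dcube \<delta> k' m'"
  have "\<lfloor>2 ^ k * (z :: real)\<rfloor> = \<lfloor>2 ^ k' * z\<rfloor> div 2 ^ (k' - k)" for z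
  proof -
    have "2 ^ k * z = 2 ^ k' * z / real_of_int (2 ^ (k' - k))"
    proof -
      have "(2::real) ^ k' = 2 ^ (k' - k) * 2 ^ k" using assms(1) by (simp flip: power_add)
      then show ?thesis by simp
    qed
    then show ?thesis by (simp only: floor_divide_real_eq_div[of "2 ^ (k' - k)"] zero_le_power zero_le_numeral)
  qed
  then show "y \<in> dcube \<delta> k m" using assms(2,3) y unfolding dcube_def by simp
qed

lemma laminar_dcubes: "laminar {P. \<exists>k m. P = dcube \<delta> k m \<and> Q P}"
  unfolding laminar_def using dcube_subset[of _ _ _ \<delta>] nat_le_linear by (smt (verit) disjoint_iff mem_Collect_eq)

lemma countable_dcubes: "countable {P. \<exists>k m. P = dcube \<delta> k m \<and> Q P}"
proof -
  have "countable (range (\<lambda>(k, m). dcube \<delta> k m))" by simp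
  then show ?thesis by (rule countable_subset[rotated]) auto
qed

lemma floor_constant_near:
  fixes b b' :: real
  assumes "\<bar>b' - b\<bar> < r" "\<And>n::int. r \<le> \<bar>b - n\<bar>"
  shows "\<lfloor>b'\<rfloor> = \<lfloor>b\<rfloor>"
proof (rule ccontr)
  assume "\<lfloor>b'\<rfloor> \<noteq> \<lfloor>b\<rfloor>"
  then consider "\<lfloor>b'\<rfloor> < \<lfloor>b\<rfloor>" | "\<lfloor>b\<rfloor> < \<lfloor>b'\<rfloor>" by linarith
  then show False
  proof cases
    case 1
    then have "b' < \<lfloor>b\<rfloor>" by linarith
    then show ?thesis using assms(1) assms(2)[of "\<lfloor>b\<rfloor>"] by linarith
  next
    case 2
    then have "b < \<lfloor>b'\<rfloor>" "\<lfloor>b'\<rfloor> \<le> b'" by linarith+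
    then show ?thesis using assms(1) assms(2)[of "\<lfloor>b'\<rfloor>"] by linarith
  qed
qed

text \<open>The one-third trick: since 3 does not divide a power of 2, the endpoints of the two grids of
  the same generation are a third of a cell apart.\<close>

lemma one_third_trick:
  fixes x :: "real^'d"
  obtains b m where "{y. \<forall>i. \<bar>y $ i - x $ i\<bar> < 1 / (6 * 2 ^ k)} \<subseteq> dcube (shift b) k m" "x \<in> dcube (shift b) k m"
proof -
  have "\<exists>e. \<forall>n::int. 1 / 6 \<le> \<bar>2 ^ k * (x $ i - (if e then 1 / 3 else 0)) - n\<bar>" for i
  proof (rule ccontr)
    assume "\<not> ?thesis"
    then have "\<exists>n::int. \<bar>2 ^ k * (x $ i - (if e then 1 / 3 else 0)) - n\<bar> < 1 / 6" for e
      by (meson not_le)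
    from this[of False] this[of True] obtain n n' :: int where
      "\<bar>2 ^ k * x $ i - n\<bar> < 1 / 6" "\<bar>2 ^ k * (x $ i - 1 / 3) - n'\<bar> < 1 / 6" by auto
    \<comment> \<open>The two offsets differ by 2^k / 3, which would lie within 1/6 + 1/6 of an
      integer; multiplying by 3 forces 2^k to be a multiple of 3.\<close>
    then have "\<bar>2 ^ k - real_of_int (3 * (n - n'))\<bar> < 1"
      unfolding right_diff_distrib abs_less_iff by simp
    then have "\<bar>real_of_int (2 ^ k - 3 * (n - n'))\<bar> < 1" by simp
    then have "\<bar>2 ^ k - 3 * (n - n')\<bar> < 1" by linarith
    then have "2 ^ k = 3 * (n - n')" by linarith
    then have "(3::int) dvd 2 ^ k" by (rule dvdI)
    moreover have "prime (3::int)" by simp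
    ultimately have "(3::int) dvd 2" using prime_dvd_power by blast
    then show False by simp
  qed
  then obtain b where b: "\<And>i n. 1 / 6 \<le> \<bar>2 ^ k * (x $ i - (if b i then 1 / 3 else 0)) - real_of_int n\<bar>"
    by metis
  define B where "B = (\<chi> i. b i)"
  define m where "m = (\<chi> i. \<lfloor>2 ^ k * (x $ i - shift B $ i)\<rfloor>)"
  have "y \<in> dcube (shift B) k m" if "\<forall>i. \<bar>y $ i - x $ i\<bar> < 1 / (6 * 2 ^ k)" for y
    unfolding dcube_def m_def
  proof (simp, intro allI floor_constant_near)
    fix i
    have "\<bar>2 ^ k * (y $ i - shift B $ i) - 2 ^ k * (x $ i - shift B $ i)\<bar> = 2 ^ k * \<bar>y $ i - x $ i\<bar>"
      by (simp add: abs_mult flip: right_diff_distrib)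
    also have "\<dots> < 2 ^ k * (1 / (6 * 2 ^ k))"
      using that by (intro mult_strict_left_mono) auto
    finally show "\<bar>2 ^ k * (y $ i - shift B $ i) - 2 ^ k * (x $ i - shift B $ i)\<bar> < 1 / 6" by simp
  qed (use b in \<open>auto simp: shift_def B_def\<close>)
  moreover have "x \<in> dcube (shift B) k m" by (simp add: dcube_def m_def)
  ultimately show thesis using that[of B m] by blast
qed

section \<open>Gaussian averages at small distances\<close>

text \<open>\<open>G\<close> selects the cubes on which the A_p condition is available; a subfamily
  of a laminar family is laminar.\<close>

definition dyadic_family :: "((real^'d) set \<Rightarrow> bool) \<Rightarrow> bool^'d \<Rightarrow> (real^'d) set set" where
  "dyadic_family G b = {P. \<exists>k m. P = dcube (shift b) k m \<and> G P}"

definition dyadic_maximal :: "((real^'d) set \<Rightarrow> bool) \<Rightarrow> (real^'d \<Rightarrow> ennreal) \<Rightarrow> real^'d \<Rightarrow> ennreal" where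
  "dyadic_maximal G g x = (SUP b. maximal lebesgue (dyadic_family G b) g x)"

text \<open>\<open>G\<close> is demanded of every cube of generation k around x because the
  one-third trick does not tell which shift captures the box.\<close>

lemma nn_integral_box_le_maximal:
  fixes x :: "real^'d"
  assumes "\<And>b m. x \<in> dcube (shift b) k m \<Longrightarrow> G (dcube (shift b) k m)"
    and [measurable]: "g \<in> borel_measurable lebesgue"
  shows "(\<integral>\<^sup>+y\<in>{y. \<forall>i. \<bar>y $ i - x $ i\<bar> < 1 / (6 * 2 ^ k)}. g y \<partial>lebesgue) \<le>
     ennreal (1 / 2 ^ (k * CARD('d))) * dyadic_maximal G g x"
proof -
  obtain b m where bm: "{y. \<forall>i. \<bar>y $ i - x $ i\<bar> < 1 / (6 * 2 ^ k)} \<subseteq> dcube (shift b) k m" "x \<in> dcube (shift b) k m"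
    by (rule one_third_trick)
  define P where "P = dcube (shift b) k m"
  have eP: "emeasure lebesgue P = ennreal (1 / 2 ^ (k * CARD('d)))"
    unfolding P_def dcube_eq_cube by (subst emeasure_cube) (auto simp: power_mult power_divide)
  have P: "P \<in> dyadic_family G b" "x \<in> P"
    using assms(1) bm by (auto simp: dyadic_family_def P_def)
  have "(\<integral>\<^sup>+y\<in>{y. \<forall>i. \<bar>y $ i - x $ i\<bar> < 1 / (6 * 2 ^ k)}. g y \<partial>lebesgue) \<le> (\<integral>\<^sup>+y\<in>P. g y \<partial>lebesgue)"
    using bm unfolding P_def by (intro nn_integral_mono) (auto split: split_indicator)
  also have "\<dots> = emeasure lebesgue P * mean lebesgue g P"
    unfolding mean_def eP by (simp add: ennreal_times_divide ennreal_mult_divide_eq mult.commute)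
  also have "mean lebesgue g P \<le> maximal lebesgue (dyadic_family G b) g x"
    by (rule mean_le_maximal[OF P])
  also have "\<dots> \<le> dyadic_maximal G g x"
    unfolding dyadic_maximal_def by (rule SUP_upper) simp
  finally show ?thesis unfolding eP by (simp add: mult_left_mono)
qed

lemma power_le_fact_exp:
  fixes v :: real
  assumes "0 \<le> v"
  shows "v ^ n \<le> fact n * exp v"
proof -
  have "(\<Sum>k\<in>{n}. v ^ k /\<^sub>R fact k) \<le> (\<Sum>k. v ^ k /\<^sub>R fact k)"
    using assms by (intro sum_le_suminf[OF summable_exp_generic]) auto
  then have "v ^ n /\<^sub>R fact n \<le> exp v" unfolding exp_def by simp
  then show ?thesis by (simp add: field_simps)
qed

text \<open>From u^n <= 1 + u^(2n) and a single term of the exponential series of u^2 / 8. The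
  Gaussian is traded for a power: n = d + 1 produces a convergent sum over shells, n = d cancels
  \<tau>^(-d).\<close>

lemma exp_neg_square_le:
  fixes u :: real
  assumes "0 < u"
  shows "exp (- (u\<^sup>2 / 8)) \<le> (1 + 8 ^ n * fact n) / u ^ n"
proof -
  have le: "(u\<^sup>2 / 8) ^ n / fact n \<le> exp (u\<^sup>2 / 8)"
    using power_le_fact_exp[of "u\<^sup>2 / 8" n] by (simp add: pos_divide_le_eq mult.commute)
  have "a \<le> 1 + a\<^sup>2" for a :: real
    using zero_le_power2[of "a - 1 / 2"] by (simp add: power2_eq_square algebra_simps)
  then have "u ^ n \<le> 1 + (u ^ n)\<^sup>2" .
  also have "(u ^ n)\<^sup>2 = 8 ^ n * fact n * ((u\<^sup>2 / 8) ^ n / fact n)"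
    by (simp add: power_divide mult.commute flip: power_mult)
  also have "1 + \<dots> \<le> exp (u\<^sup>2 / 8) + 8 ^ n * fact n * exp (u\<^sup>2 / 8)"
    using le by (intro add_mono mult_left_mono) auto
  finally have "u ^ n \<le> (1 + 8 ^ n * fact n) * exp (u\<^sup>2 / 8)" by (simp add: distrib_right)
  then show ?thesis using assms by (simp add: exp_minus field_simps)
qed

text \<open>The point is uniformity in \<tau>. Shells between consecutive boxes are used down to the
  size of \<tau>; on the last box the kernel is bounded by its maximum \<tau>^(-d), which the volume
  of the box compensates.\<close>

lemma exp_kernel_near_bound:
  fixes x :: "real^'d" and \<tau> :: real
  assumes \<tau>: "0 < \<tau>"
    and G: "\<And>k b m. \<kappa> \<le> k \<Longrightarrow> x \<in> dcube (shift b) k m \<Longrightarrow> G (dcube (shift b) k m)"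
    and g [measurable]: "g \<in> borel_measurable lebesgue"
  shows "(\<integral>\<^sup>+y\<in>{y. \<forall>i. \<bar>y $ i - x $ i\<bar> < 1 / (6 * 2 ^ \<kappa>)}.
       ennreal (exp (- ((norm (x - y) / \<tau>)\<^sup>2 / 8)) / \<tau> ^ CARD('d)) * g y \<partial>lebesgue) \<le>
     ennreal (1 + 2 * ((1 + 8 ^ (CARD('d) + 1) * fact (CARD('d) + 1)) * 12 ^ (CARD('d) + 1))) * dyadic_maximal G g x"
proof -
  define d where "d = CARD('d)"
  define C where "C = (1 + 8 ^ (d + 1) * fact (d + 1)) * (12::real) ^ (d + 1)"
  have C: "0 \<le> C" by (simp add: C_def)
  define B where "B j = {y. \<forall>i. \<bar>y $ i - x $ i\<bar> < 1 / (6 * 2 ^ j)}" for j :: nat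
  have B_borel: "B j \<in> sets borel" for j
  proof -
    have "B j = (\<Inter>i. {y. \<bar>y $ i - x $ i\<bar> < 1 / (6 * 2 ^ j)})" by (auto simp: B_def)
    moreover have "open {y::real^'d. \<bar>y $ i - x $ i\<bar> < 1 / (6 * 2 ^ j)}" for i
      by (intro open_Collect_less continuous_intros)
    ultimately show ?thesis by (auto intro!: borel_open)
  qed
  then have [measurable]: "B j \<in> sets lebesgue" for j by (simp add: lborelD)
  \<comment> \<open>The first generation from \<kappa> on whose cubes are no larger than
    \<tau>.\<close>
  define N where "N = (LEAST n. \<kappa> \<le> n \<and> 1 / 2 ^ n \<le> \<tau>)"
  have "\<exists>n. \<kappa> \<le> n \<and> 1 / 2 ^ n \<le> \<tau>"
  proof -
    obtain n where "(1 / 2) ^ n < \<tau>" using real_arch_pow_inv[OF \<tau>, of "1 / 2"] by auto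
    moreover have "(1 / 2 :: real) ^ (max \<kappa> n) \<le> (1 / 2) ^ n" by (intro power_decreasing) auto
    ultimately have "1 / 2 ^ (max \<kappa> n) \<le> \<tau>" by (simp add: power_divide)
    then show ?thesis by (intro exI[of _ "max \<kappa> n"]) auto
  qed
  then have N: "\<kappa> \<le> N" "1 / 2 ^ N \<le> \<tau>" unfolding N_def by (metis (mono_tags, lifting) LeastI_ex)+
  \<comment> \<open>Minimality bounds 2^N only if N exceeds \<kappa>; for N = \<kappa> the sum over
    shells is empty and no bound is called for.\<close>
  have N': "\<tau> * 2 ^ N \<le> 2" if "\<kappa> < N"
  proof -
    have "\<not> (\<kappa> \<le> N - 1 \<and> 1 / 2 ^ (N - 1) \<le> \<tau>)"
      using that unfolding N_def by (intro not_less_Least) auto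
    then have "\<tau> < 1 / 2 ^ (N - 1)" using that by auto
    then have "\<tau> * 2 ^ (N - 1) < 1" by (simp add: field_simps)
    moreover have "(2::real) ^ N = 2 * 2 ^ (N - 1)" using that by (cases N) auto
    ultimately show ?thesis by simp
  qed
  define \<phi> where "\<phi> y = exp (- ((norm (x - y) / \<tau>)\<^sup>2 / 8)) / \<tau> ^ d" for y
  define c where "c j = C * \<tau> * 2 ^ (j * (d + 1))" for j :: nat
  have c: "0 \<le> c j" for j using C \<tau> by (simp add: c_def)
  have \<phi>N: "\<phi> y \<le> 2 ^ (N * d)" for y
  proof -
    have "\<phi> y \<le> 1 / \<tau> ^ d" unfolding \<phi>_def using \<tau> by (intro divide_right_mono) auto
    also have "1 / \<tau> ^ d \<le> 1 / (1 / 2 ^ N) ^ d"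
      using N \<tau> by (intro divide_left_mono power_mono) auto
    finally show ?thesis by (simp add: power_divide power_mult)
  qed
  \<comment> \<open>Leaving \<open>B (Suc j)\<close> means distance at least 1 / (12 * 2^j), hence
    the factor 12^(d + 1). Taking one power more than d leaves \<tau> 2^j after the volume 2^(-jd)
    is spent; these terms sum to at most \<tau> 2^N <= 2.\<close>
  have \<phi>c: "\<phi> y \<le> c j" if y: "y \<notin> B (Suc j)" for y j
  proof -
    obtain i where "1 / (6 * 2 ^ Suc j) \<le> \<bar>(x - y) $ i\<bar>"
      using y by (auto simp: B_def not_less abs_minus_commute)
    also have "\<dots> \<le> norm (x - y)" by (rule component_le_norm_cart)
    finally have n: "1 / (12 * 2 ^ j) \<le> norm (x - y)" by simp
    have n0: "0 < norm (x - y)" using n by (smt (verit) zero_less_divide_1_iff zero_less_power mult_pos_pos)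
    have "\<phi> y \<le> (1 + 8 ^ (d + 1) * fact (d + 1)) / (norm (x - y) / \<tau>) ^ (d + 1) / \<tau> ^ d"
      unfolding \<phi>_def using n0 \<tau> by (intro divide_right_mono exp_neg_square_le) auto
    also have "\<dots> = (1 + 8 ^ (d + 1) * fact (d + 1)) * \<tau> / norm (x - y) ^ (d + 1)"
      using \<tau> n0 by (simp add: power_divide field_simps)
    also have "\<dots> \<le> (1 + 8 ^ (d + 1) * fact (d + 1)) * \<tau> / (1 / (12 * 2 ^ j)) ^ (d + 1)"
      using \<tau> n n0 by (intro divide_left_mono power_mono mult_nonneg_nonneg mult_pos_pos zero_less_power) auto
    also have "\<dots> = c j"
      unfolding c_def C_def power_mult power_divide power_mult_distrib by simp
    finally show ?thesis .
  qed
  have ptw: "ennreal (\<phi> y) * indicator (B \<kappa>) y \<le>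
      ennreal (2 ^ (N * d)) * indicator (B N) y + (\<Sum>j\<in>{\<kappa>..<N}. ennreal (c j) * indicator (B j) y)" for y
  proof (cases "y \<in> B \<kappa> \<and> y \<notin> B N")
    case True
    have "\<exists>j. \<kappa> \<le> j \<and> j < N \<and> y \<in> B j \<and> y \<notin> B (Suc j)"
    proof (rule ccontr)
      assume *: "\<not> ?thesis"
      have "j \<le> N \<longrightarrow> y \<in> B j" if "\<kappa> \<le> j" for j
        using that by (induction j rule: dec_induct) (use True * in \<open>auto simp: Suc_le_eq\<close>)
      then show False using True N by auto
    qed
    then obtain j where j: "j \<in> {\<kappa>..<N}" "y \<in> B j" "y \<notin> B (Suc j)" by auto
    have "ennreal (\<phi> y) * indicator (B \<kappa>) y \<le> ennreal (c j) * indicator (B j) y"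
      using j True \<phi>c[of y j] by (simp add: ennreal_leI)
    also have "\<dots> \<le> (\<Sum>j\<in>{\<kappa>..<N}. ennreal (c j) * indicator (B j) y)"
      using j by (intro member_le_sum) auto
    finally show ?thesis by (rule order_trans) simp
  next
    case False
    then show ?thesis using \<phi>N[of y] by (auto split: split_indicator simp: ennreal_leI intro!: add_increasing2)
  qed
  have box: "(\<integral>\<^sup>+y\<in>B j. g y \<partial>lebesgue) \<le> ennreal (1 / 2 ^ (j * d)) * dyadic_maximal G g x" if "\<kappa> \<le> j" for j
    unfolding B_def d_def using that by (intro nn_integral_box_le_maximal G) auto
  have "(\<integral>\<^sup>+y\<in>B \<kappa>. ennreal (\<phi> y) * g y \<partial>lebesgue) \<le>
     (\<integral>\<^sup>+y. ennreal (2 ^ (N * d)) * (g y * indicator (B N) y) +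
        (\<Sum>j\<in>{\<kappa>..<N}. ennreal (c j) * (g y * indicator (B j) y)) \<partial>lebesgue)"
  proof (rule nn_integral_mono)
    fix y
    show "ennreal (\<phi> y) * g y * indicator (B \<kappa>) y \<le> ennreal (2 ^ (N * d)) * (g y * indicator (B N) y) +
        (\<Sum>j\<in>{\<kappa>..<N}. ennreal (c j) * (g y * indicator (B j) y))"
      using mult_left_mono[OF ptw[of y], of "g y"] by (simp only: distrib_left sum_distrib_left mult_ac zero_le)
  qed
  also have "\<dots> = ennreal (2 ^ (N * d)) * (\<integral>\<^sup>+y\<in>B N. g y \<partial>lebesgue) +
        (\<Sum>j\<in>{\<kappa>..<N}. ennreal (c j) * (\<integral>\<^sup>+y\<in>B j. g y \<partial>lebesgue))"
    by (simp add: nn_integral_add nn_integral_cmult nn_integral_sum)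
  also have "\<dots> \<le> ennreal (2 ^ (N * d)) * (ennreal (1 / 2 ^ (N * d)) * dyadic_maximal G g x) +
        (\<Sum>j\<in>{\<kappa>..<N}. ennreal (c j) * (ennreal (1 / 2 ^ (j * d)) * dyadic_maximal G g x))"
    using N by (intro add_mono mult_left_mono sum_mono box) auto
  also have "\<dots> = (ennreal 1 + (\<Sum>j\<in>{\<kappa>..<N}. ennreal (C * \<tau> * 2 ^ j))) * dyadic_maximal G g x"
  proof -
    have "ennreal (c j) * (ennreal (1 / 2 ^ (j * d)) * X) = ennreal (C * \<tau> * 2 ^ j) * X" for j and X :: ennreal
    proof -
      have "ennreal (c j) * ennreal (1 / 2 ^ (j * d)) = ennreal (C * \<tau> * 2 ^ j)"
        using c[of j] by (simp add: c_def power_add mult.assoc flip: ennreal_mult)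
      then show ?thesis by (simp flip: mult.assoc)
    qed
    moreover have "ennreal (2 ^ (N * d)) * (ennreal (1 / 2 ^ (N * d)) * X) = ennreal 1 * X" for X :: ennreal
    proof -
      have "ennreal (2 ^ (N * d)) * ennreal (1 / 2 ^ (N * d)) = ennreal 1"
        by (subst ennreal_mult[symmetric]) auto
      then show ?thesis by (simp only: mult.assoc[symmetric])
    qed
    ultimately show ?thesis by (simp only: distrib_right sum_distrib_right)
  qed
  also have "ennreal 1 + (\<Sum>j\<in>{\<kappa>..<N}. ennreal (C * \<tau> * 2 ^ j)) = ennreal (1 + (\<Sum>j\<in>{\<kappa>..<N}. C * \<tau> * 2 ^ j))"
  proof -
    have "0 \<le> C * \<tau> * 2 ^ j" for j using C \<tau> by simp
    then show ?thesis by (simp only: sum_ennreal ennreal_plus sum_nonneg zero_le_one)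
  qed
  also have "1 + (\<Sum>j\<in>{\<kappa>..<N}. C * \<tau> * 2 ^ j) \<le> 1 + 2 * C"
  proof (cases "\<kappa> < N")
    case True
    have "(\<Sum>j\<in>{\<kappa>..<N}. C * \<tau> * 2 ^ j) \<le> (\<Sum>j<N. C * \<tau> * 2 ^ j)"
      using C \<tau> by (intro sum_mono2) auto
    also have "\<dots> = C * (\<tau> * (2 ^ N - 1))"
    proof -
      have "(\<Sum>j<N. (2::real) ^ j) = 2 ^ N - 1" by (induction N) auto
      then show ?thesis by (simp only: sum_distrib_left[symmetric] mult.assoc)
    qed
    also have "\<dots> \<le> C * 2"
      using N'[OF True] C \<tau> by (intro mult_left_mono) (auto simp: algebra_simps)
    finally show ?thesis by simp
  qed (use C in auto)
  finally have "(\<integral>\<^sup>+y\<in>B \<kappa>. ennreal (\<phi> y) * g y \<partial>lebesgue) \<le> ennreal (1 + 2 * C) * dyadic_maximal G g x"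
    by (simp add: mult_right_mono ennreal_leI del: ennreal_plus)
  then show ?thesis unfolding B_def \<phi>_def C_def d_def .
qed

section \<open>The grid and the weight class\<close>

text \<open>Gives the uniqueness behind the definite description in \<open>side_length\<close>: each
  cube contains the corner of the other, so the corners agree, and then so do the sides.\<close>

lemma cube_eq_imp_side_eq:
  fixes c c' :: "real^'d"
  assumes "cube c s = cube c' s'" "0 < s" "0 < s'"
  shows "s = s'"
proof -
  have "c \<in> cube c s" "c' \<in> cube c' s'" using assms(2,3) by (simp_all add: mem_cube)
  then have cc: "c \<in> cube c' s'" "c' \<in> cube c s" using assms(1) by simp_all
  then have c: "c $ i = c' $ i" for i by (auto simp: mem_cube intro: antisym)
  have le: "t \<le> u" if "cube a t \<subseteq> cube b u" "\<And>i. a $ i = b $ i" "0 < t" "0 < u" for a b :: "real^'d" and t u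
  proof (rule ccontr)
    assume "\<not> t \<le> u"
    then have "(\<chi> i. a $ i + u) \<in> cube a t" using that by (simp add: mem_cube)
    then have "(\<chi> i. a $ i + u) \<in> cube b u" using that by auto
    then show False using that by (simp add: mem_cube)
  qed
  show ?thesis using le[of c s c' s'] le[of c' s' c s] assms c by auto
qed

lemma side_length_cube: "0 < s \<Longrightarrow> side_length (cube c s) = s"
  unfolding side_length_def using cube_eq_imp_side_eq by (intro the_equality) blast+

text \<open>Makes the definite description in \<open>grid_level\<close> meaningful; the witness is
  the ceiling of - log 2 y.\<close>

lemma grid_level_ex:
  fixes y :: real
  assumes "0 < y" "y \<le> 1"
  shows "\<exists>!k::nat. 2 powr (- real k) \<le> y \<and> y < 2 powr (- real k + 1)"
proof -
  define k where "k = nat \<lceil>- log 2 y\<rceil>"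
  have iff: "2 powr (- real k) \<le> y \<and> y < 2 powr (- real k + 1) \<longleftrightarrow> - real k \<le> log 2 y \<and> log 2 y < - real k + 1" for k
    using assms by (simp add: le_log_iff log_less_iff)
  have "log 2 y \<le> 0" using assms by simp
  then have "real k = of_int \<lceil>- log 2 y\<rceil>" unfolding k_def by simp
  then have "- real k \<le> log 2 y \<and> log 2 y < - real k + 1" by linarith
  moreover have "k' = k''" if "- real k' \<le> log 2 y \<and> log 2 y < - real k' + 1" "- real k'' \<le> log 2 y \<and> log 2 y < - real k'' + 1" for k' k''
    using that by linarith
  ultimately show ?thesis unfolding iff by blast
qed

lemma grid_level_pos:
  assumes "0 \<le> \<alpha>" "0 < n"
  obtains k :: nat where "grid_level \<alpha> n = int k" "real n powr (- \<alpha>) / 2 \<le> 1 / 2 ^ k"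
proof -
  have y: "0 < real n powr (- \<alpha>)" "real n powr (- \<alpha>) \<le> 1"
    using assms powr_mono2'[of "- \<alpha>" 1 "real n"] by auto
  obtain k :: nat where k: "2 powr (- real k) \<le> real n powr (- \<alpha>) \<and> real n powr (- \<alpha>) < 2 powr (- real k + 1)"
    using grid_level_ex[OF y] by blast
  then have "(THE k. 2 powr (- real k) \<le> real n powr (- \<alpha>) \<and> real n powr (- \<alpha>) < 2 powr (- real k + 1)) = k"
    using grid_level_ex[OF y] by (intro the1_equality) auto
  moreover have "real n powr (- \<alpha>) / 2 \<le> 1 / 2 ^ k"
  proof -
    have "2 powr (- real k + 1) = 2 / 2 ^ k"
      by (simp only: powr_add powr_minus_divide powr_realpow) simp
    then show ?thesis using k by simp
  qed
  ultimately show thesis using assms by (intro that[of k]) (auto simp: grid_level_def)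
qed

text \<open>A point of the n-th shell has norm at least n, so a cube of side at least n^(-\<alpha>)
  / 2 is large enough; the central cube has side 2.\<close>

lemma grid_cover:
  fixes x :: "real^'d"
  assumes "0 \<le> \<alpha>"
  obtains R s where "R \<in> grid \<alpha>" "x \<in> R" "side_length R = s" "1 / 2 * (1 + norm x) powr (- \<alpha>) \<le> s"
proof -
  define n where "n = (LEAST n. x \<in> cube (vec (- (real n + 1))) (2 * (real n + 1)))"
  have "\<exists>n. x \<in> cube (vec (- (real n + 1))) (2 * (real n + 1))"
  proof -
    obtain n where "norm x < real n" using reals_Archimedean2 by blast
    moreover have "\<bar>x $ i\<bar> \<le> norm x" for i by (rule component_le_norm_cart)
    ultimately have "\<bar>x $ i\<bar> < real n" for i by (meson le_less_trans)
    then have "x \<in> cube (vec (- (real n + 1))) (2 * (real n + 1))"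
      by (simp add: mem_cube abs_less_iff) (smt (verit))
    then show ?thesis by blast
  qed
  then have in_n: "x \<in> cube (vec (- (real n + 1))) (2 * (real n + 1))" unfolding n_def by (rule LeastI_ex)
  show thesis
  proof (cases "n = 0")
    case True
    show thesis
    proof (rule that)
      show "cube (vec (- 1)) 2 \<in> (grid \<alpha> :: (real^'d) set set)" unfolding grid_def by (intro UN_I[of 0]) (auto simp: grid_shell_def)
      show "x \<in> cube (vec (- 1)) 2" using in_n True by simp
      show "side_length (cube (vec (- 1) :: real^'d) 2) = 2" by (rule side_length_cube) simp
      have "(1 + norm x) powr (- \<alpha>) \<le> 1 powr (- \<alpha>)" using assms by (intro powr_mono2') auto
      then show "1 / 2 * (1 + norm x) powr (- \<alpha>) \<le> 2" by simp
    qed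
  next
    case False
    then have "n - 1 < n" by simp
    then have "x \<notin> cube (vec (- (real (n - 1) + 1))) (2 * (real (n - 1) + 1))"
      unfolding n_def by (rule not_less_Least)
    then have out: "x \<notin> cube (vec (- real n)) (2 * real n)" using False by (simp add: of_nat_diff)
    obtain k where k: "grid_level \<alpha> n = int k" "real n powr (- \<alpha>) / 2 \<le> 1 / 2 ^ k"
      using grid_level_pos[OF assms] False by blast
    define m where "m = (\<chi> i. real_of_int \<lfloor>2 ^ k * x $ i\<rfloor> / 2 ^ k)"
    have m: "m $ i \<le> x $ i" "x $ i < m $ i + 1 / 2 ^ k" for i
    proof -
      have "real_of_int \<lfloor>2 ^ k * x $ i\<rfloor> \<le> 2 ^ k * x $ i" "2 ^ k * x $ i < real_of_int \<lfloor>2 ^ k * x $ i\<rfloor> + 1"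
        by linarith+
      then show "m $ i \<le> x $ i" "x $ i < m $ i + 1 / 2 ^ k" by (simp_all add: m_def field_simps)
    qed
    \<comment> \<open>Rounding down to a multiple of 2^(-k) does not cross an integer. As the shell
      is bounded by integers, this and the companion \<open>upper\<close> keep the whole rounded
      cube inside it.\<close>
    have lower: "real_of_int z \<le> m $ i" if "real_of_int z \<le> x $ i" for z i
    proof -
      have "real_of_int (2 ^ k * z) \<le> 2 ^ k * x $ i" using that by simp
      then have "2 ^ k * z \<le> \<lfloor>2 ^ k * x $ i\<rfloor>" by (simp only: le_floor_iff)
      then have "real_of_int (2 ^ k * z) \<le> real_of_int \<lfloor>2 ^ k * x $ i\<rfloor>" by (simp only: of_int_le_iff)
      then show ?thesis by (simp add: m_def field_simps)
    qed
    have upper: "m $ i + 1 / 2 ^ k \<le> real_of_int z" if "x $ i < real_of_int z" for z i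
    proof -
      have "2 ^ k * x $ i < real_of_int (2 ^ k * z)" using that by simp
      then have "\<lfloor>2 ^ k * x $ i\<rfloor> + 1 \<le> 2 ^ k * z" by (simp only: floor_less_iff zless_imp_add1_zle)
      then have "real_of_int (\<lfloor>2 ^ k * x $ i\<rfloor> + 1) \<le> real_of_int (2 ^ k * z)" by (simp only: of_int_le_iff)
      then show ?thesis by (simp add: m_def field_simps)
    qed
    have pk: "2 powi (- int k) = (1 / 2 ^ k :: real)" "2 powi int k = (2 ^ k :: real)"
      by (simp_all add: power_int_minus divide_inverse)
    have sub: "cube m (1 / 2 ^ k) \<subseteq> cube (vec (- (real n + 1))) (2 * (real n + 1)) - cube (vec (- real n)) (2 * real n)"
    proof
      fix z assume z: "z \<in> cube m (1 / 2 ^ k)"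
      have "- (real n + 1) \<le> z $ i \<and> z $ i < real n + 1" for i
      proof -
        have "real_of_int (- int n - 1) \<le> x $ i" "x $ i < real_of_int (int n + 1)"
          using in_n by (auto simp: mem_cube dest!: spec[of _ i])
        from lower[OF this(1)] upper[OF this(2)] show ?thesis
          using z by (auto simp: mem_cube dest!: spec[of _ i])
      qed
      moreover have "\<exists>i. \<not> (- real n \<le> z $ i \<and> z $ i < real n)"
      proof -
        obtain i where "\<not> (- real n \<le> x $ i \<and> x $ i < real n)" using out by (auto simp: mem_cube)
        then consider "x $ i < real_of_int (- int n)" | "real_of_int (int n) \<le> x $ i" by fastforce
        then show ?thesis
        proof cases
          case 1
          from upper[OF this] show ?thesis using z by (intro exI[of _ i]) (auto simp: mem_cube dest!: spec[of _ i])
        next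
          case 2
          from lower[OF this] show ?thesis using z by (intro exI[of _ i]) (auto simp: mem_cube dest!: spec[of _ i])
        qed
      qed
      ultimately show "z \<in> cube (vec (- (real n + 1))) (2 * (real n + 1)) - cube (vec (- real n)) (2 * real n)"
        by (auto simp: mem_cube)
    qed
    show thesis
    proof (rule that)
      have "cube m (1 / 2 ^ k) \<in> grid_shell \<alpha> n"
        unfolding grid_shell_def k(1) pk using False sub by (auto simp: m_def intro!: exI[of _ m])
      then show "cube m (1 / 2 ^ k) \<in> grid \<alpha>" unfolding grid_def by blast
      show "x \<in> cube m (1 / 2 ^ k)" using m by (simp add: mem_cube)
      show "side_length (cube m (1 / 2 ^ k)) = 1 / 2 ^ k" by (rule side_length_cube) simp
      have "real n \<le> norm x"
      proof -
        obtain i where "\<not> (- real n \<le> x $ i \<and> x $ i < real n)" using out by (auto simp: mem_cube)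
        then have "real n \<le> \<bar>x $ i\<bar>" by linarith
        then show ?thesis using component_le_norm_cart[of x i] by linarith
      qed
      then have "(1 + norm x) powr (- \<alpha>) \<le> real n powr (- \<alpha>)"
        using assms False by (intro powr_mono2') auto
      then show "1 / 2 * (1 + norm x) powr (- \<alpha>) \<le> 1 / 2 ^ k" using k(2) by linarith
    qed
  qed
qed

lemma infnorm_less_cart:
  fixes x :: "real^'d"
  assumes "\<And>i. \<bar>x $ i\<bar> < r"
  shows "infnorm x < r"
  unfolding infnorm_Max using assms by (subst Max_less_iff) (auto simp: Basis_vec_def inner_axis)

text \<open>The grid cube R around x has side at least half of (1 + |x|)^(-\<alpha>), and
  \<open>N R\<close> contains every point closer to R than this side.\<close>

lemma admissible_region_nhd:
  fixes x :: "real^'d"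
  assumes "0 \<le> \<alpha>" "admissible_regions \<alpha> N"
  obtains R where "R \<in> grid \<alpha>" "{z. \<forall>i. \<bar>z $ i - x $ i\<bar> < 1 / 2 * (1 + norm x) powr (- \<alpha>)} \<subseteq> N R"
proof -
  obtain R s where R: "R \<in> grid \<alpha>" "x \<in> R" "side_length R = s" "1 / 2 * (1 + norm x) powr (- \<alpha>) \<le> s"
    by (rule grid_cover[OF assms(1)])
  have "rho {z} R < side_length R" if "\<forall>i. \<bar>z $ i - x $ i\<bar> < 1 / 2 * (1 + norm x) powr (- \<alpha>)" for z
  proof -
    have "rho {z} R \<le> infnorm (z - x)"
      unfolding rho_def using R by (intro cInf_lower) (auto intro!: bdd_belowI[of _ 0] infnorm_pos_le)
    also have "\<dots> < s"
    proof (rule infnorm_less_cart)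
      fix i
      have "\<bar>z $ i - x $ i\<bar> < 1 / 2 * (1 + norm x) powr (- \<alpha>)" using that by blast
      then show "\<bar>(z - x) $ i\<bar> < s" using R(4) unfolding vector_minus_component by linarith
    qed
    finally show ?thesis using R by simp
  qed
  then have "{z. \<forall>i. \<bar>z $ i - x $ i\<bar> < 1 / 2 * (1 + norm x) powr (- \<alpha>)} \<subseteq> {z. rho {z} R < side_length R}" by auto
  also have "\<dots> \<subseteq> N R" using assms(2) R(1) unfolding admissible_regions_def by blast
  finally show thesis using that R(1) by blast
qed

section \<open>The A_p condition as an inequality between real numbers\<close>

lemma nn_integral_cube_pos:
  fixes c :: "real^'d"
  assumes "f \<in> borel_measurable lebesgue" "\<And>x. 0 < f x" "0 < s"
  shows "0 < (\<integral>\<^sup>+x\<in>cube c s. f x \<partial>lebesgue)"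
proof (rule ccontr)
  assume "\<not> ?thesis"
  then have "(\<integral>\<^sup>+x. f x * indicator (cube c s) x \<partial>lebesgue) = 0" by simp
  then have "AE x in lebesgue. f x * indicator (cube c s) x = 0"
    using assms(1) by (subst (asm) nn_integral_0_iff_AE)
      (auto intro!: borel_measurable_times_ennreal borel_measurable_indicator cube_lebesgue)
  then have "AE x in lebesgue. x \<notin> cube c s"
    using assms(2) by (auto elim!: eventually_mono simp: less_imp_neq[symmetric] split: split_indicator_asm)
  then have "emeasure lebesgue (cube c s) = 0"
    by (subst (asm) AE_iff_measurable[OF cube_lebesgue]) auto
  then show False unfolding emeasure_cube[OF less_imp_le[OF assms(3)]] using assms(3) by simp
qed

text \<open>A finite product makes both averages finite only because neither is 0, as 0 * top = 0 in
  \<open>ennreal\<close>; hence the appeal to positivity of the weights. Raising to the power p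
  clears the roots.\<close>

lemma Ap_class_cubes:
  fixes \<omega> :: "real^'d \<Rightarrow> real"
  assumes "1 < p" "\<omega> \<in> Ap_class \<alpha> N p"
  obtains K where "0 < K" "\<And>c s R. R \<in> grid \<alpha> \<Longrightarrow> 0 < s \<Longrightarrow> cube c s \<subseteq> N R \<Longrightarrow>
    \<exists>W V. 0 < W \<and> 0 < V \<and> (\<integral>\<^sup>+x\<in>cube c s. ennreal (\<omega> x) \<partial>lebesgue) = ennreal W \<and>
      (\<integral>\<^sup>+x\<in>cube c s. ennreal (\<omega> x powr (- (1 / (p - 1)))) \<partial>lebesgue) = ennreal V \<and>
      W * V powr (p - 1) \<le> K * (s ^ CARD('d)) powr p"
proof -
  have \<omega> [measurable]: "\<omega> \<in> borel_measurable lebesgue" and pos: "\<And>x. 0 < \<omega> x" and fin: "Ap_constant \<alpha> N p \<omega> < top"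
    using assms(2) by (auto simp: Ap_class_def weight_def)
  obtain A where A: "Ap_constant \<alpha> N p \<omega> = ennreal A" "0 \<le> A" using fin by (cases "Ap_constant \<alpha> N p \<omega>") auto
  show thesis
  proof (rule that)
    \<comment> \<open>Adding 1 makes the constant positive without a separate argument.\<close>
    show "0 < (A + 1) powr p" using A by simp
    fix c :: "real^'d" and s :: real and R :: "(real^'d) set" assume R: "R \<in> grid \<alpha>" "0 < s" "cube c s \<subseteq> N R"
    define Q where "Q = cube c s"
    define m where "m = s ^ CARD('d)"
    have m: "0 < m" "emeasure lebesgue Q = ennreal m"
      unfolding m_def Q_def using R(2) emeasure_cube[of s c] by simp_all
    define I J where "I = (\<integral>\<^sup>+x\<in>Q. ennreal (\<omega> x) \<partial>lebesgue)"
      and "J = (\<integral>\<^sup>+x\<in>Q. ennreal (\<omega> x powr (- (1 / (p - 1)))) \<partial>lebesgue)"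
    have IJ0: "0 < I" "0 < J"
    proof -
      show "0 < I" unfolding I_def Q_def
        by (rule nn_integral_cube_pos) (use pos R in auto)
      have "0 < \<omega> x powr (- (1 / (p - 1)))" for x using pos[of x] by simp
      then show "0 < J" unfolding J_def Q_def
        by (intro nn_integral_cube_pos) (measurable, use R in \<open>simp_all only: ennreal_less_zero_iff\<close>)
    qed
    have "enn_powr (I / ennreal m) (1 / p) * enn_powr (J / ennreal m) ((p - 1) / p) =
        enn_powr (average Q \<omega>) (1 / p) * enn_powr (average Q (\<lambda>x. \<omega> x powr (- (1 / (p - 1))))) ((p - 1) / p)"
      unfolding average_def I_def J_def m ..
    also have "\<dots> \<le> ennreal A"
      unfolding A(1)[symmetric] Ap_constant_def
      by (rule SUP_upper2[OF R(1)], rule SUP_upper) (use R in \<open>auto simp: Q_def\<close>)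
    finally have le: "enn_powr (I / ennreal m) (1 / p) * enn_powr (J / ennreal m) ((p - 1) / p) \<le> ennreal A" .
    then have "enn_powr (I / ennreal m) (1 / p) * enn_powr (J / ennreal m) ((p - 1) / p) < top"
      by (rule le_less_trans) simp
    moreover have "I / ennreal m \<noteq> 0" "J / ennreal m \<noteq> 0" using IJ0 by (auto simp: ennreal_divide_eq_0_iff)
    ultimately have "I / ennreal m < top" "J / ennreal m < top"
      by (simp_all add: ennreal_mult_less_top)
    then have "I \<noteq> top" "J \<noteq> top" using m by (auto simp: ennreal_top_divide)
    then obtain W V where WV: "I = ennreal W" "J = ennreal V" "0 \<le> W" "0 \<le> V" by (metis ennreal_cases)
    with IJ0 have WV0: "0 < W" "0 < V" by auto
    have "(W / m) powr (1 / p) * (V / m) powr ((p - 1) / p) \<le> A"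
      using le WV WV0 m A by (simp add: divide_ennreal enn_powr_ennreal flip: ennreal_mult)
    then have "((W / m) powr (1 / p) * (V / m) powr ((p - 1) / p)) powr p \<le> (A + 1) powr p"
      using \<open>1 < p\<close> A by (intro powr_mono2) auto
    then have "(W / m) * (V / m) powr (p - 1) \<le> (A + 1) powr p"
      using \<open>1 < p\<close> WV0 m by (simp add: powr_mult powr_powr)
    moreover have "(W / m) * (V / m) powr (p - 1) = W * V powr (p - 1) / m powr p"
      using WV0 m by (simp add: powr_divide powr_diff)
    ultimately have "W * V powr (p - 1) / m powr p \<le> (A + 1) powr p" by simp
    then have "W * V powr (p - 1) \<le> (A + 1) powr p * m powr p"
      using m by (simp add: pos_divide_le_eq)
    then show "\<exists>W V. 0 < W \<and> 0 < V \<and> (\<integral>\<^sup>+x\<in>cube c s. ennreal (\<omega> x) \<partial>lebesgue) = ennreal W \<and>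
      (\<integral>\<^sup>+x\<in>cube c s. ennreal (\<omega> x powr (- (1 / (p - 1)))) \<partial>lebesgue) = ennreal V \<and>
      W * V powr (p - 1) \<le> (A + 1) powr p * (s ^ CARD('d)) powr p"
      using WV WV0 unfolding I_def J_def Q_def m_def by blast
  qed
qed

section \<open>Sums over shells\<close>

text \<open>Read \<delta> as |x - y| and \<rho> as 2 + |x| + |y|, up to rounding. Half of the
  exponent a \<delta> \<rho> pays for the chain, which is possible since \<alpha> < 1; with \<delta>
  >= c \<rho>^(-\<alpha>) the other half is at least a multiple of \<rho>^(1 - \<alpha>), whose
  exponential beats every power.\<close>

lemma gaussian_decay_beats_chain:
  fixes \<alpha> a A c \<beta> :: real
  assumes "0 \<le> \<alpha>" "\<alpha> < 1" "0 < a" "0 \<le> A" "0 < c"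
  obtains C where "0 < C" "\<And>\<rho> \<delta>. 1 \<le> \<rho> \<Longrightarrow> c * \<rho> powr (- \<alpha>) \<le> \<delta> \<Longrightarrow> \<delta> \<le> \<rho> \<Longrightarrow>
     exp (- (a * \<delta> * \<rho>) + A * \<delta> * \<rho> powr \<alpha>) \<le> C * \<rho> powr (- \<beta>)"
proof -
  \<comment> \<open>From this threshold on A \<rho>^\<alpha> <= a \<rho> / 2. Below it \<delta>
    \<rho>^\<alpha> is bounded by \<rho>0^2 and only enters the constant.\<close>
  define \<rho>0 where "\<rho>0 = max 1 ((2 * A / a) powr (1 / (1 - \<alpha>)))"
  define b where "b = a * c / 2"
  have b: "0 < b" using assms by (simp add: b_def)
  obtain n :: nat where n: "\<beta> / (1 - \<alpha>) \<le> real n" using real_arch_simple by blast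
  define C where "C = exp (A * \<rho>0\<^sup>2) * (fact n / b ^ n)"
  show thesis
  proof (rule that)
    show "0 < C" using b by (simp add: C_def)
    fix \<rho> \<delta> :: real assume h: "1 \<le> \<rho>" "c * \<rho> powr (- \<alpha>) \<le> \<delta>" "\<delta> \<le> \<rho>"
    have \<delta>: "0 \<le> \<delta>" using h assms by (smt (verit) mult_nonneg_nonneg powr_ge_zero)
    have split: "\<rho> = \<rho> powr (1 - \<alpha>) * \<rho> powr \<alpha>" using h by (simp flip: powr_add)
    have "A * \<delta> * \<rho> powr \<alpha> \<le> a / 2 * \<delta> * \<rho> + A * \<rho>0\<^sup>2"
    proof (cases "\<rho>0 \<le> \<rho>")
      case True
      have "2 * A / a \<le> \<rho> powr (1 - \<alpha>)"
      proof (cases "A = 0")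
        case False
        then have "2 * A / a = ((2 * A / a) powr (1 / (1 - \<alpha>))) powr (1 - \<alpha>)"
          using assms by (simp add: powr_powr)
        also have "\<dots> \<le> \<rho> powr (1 - \<alpha>)"
          using True assms unfolding \<rho>0_def by (intro powr_mono2) auto
        finally show ?thesis .
      qed simp
      then have "A \<le> a / 2 * \<rho> powr (1 - \<alpha>)" using assms by (simp add: field_simps)
      then have "A * (\<delta> * \<rho> powr \<alpha>) \<le> a / 2 * \<rho> powr (1 - \<alpha>) * (\<delta> * \<rho> powr \<alpha>)"
        using \<delta> by (intro mult_right_mono) auto
      also have "\<dots> = a / 2 * \<delta> * (\<rho> powr (1 - \<alpha>) * \<rho> powr \<alpha>)" by (simp only: mult_ac)
      also have "\<dots> = a / 2 * \<delta> * \<rho>" by (simp only: split[symmetric])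
      finally have "A * \<delta> * \<rho> powr \<alpha> \<le> a / 2 * \<delta> * \<rho>" by (simp only: mult.assoc)
      moreover have "0 \<le> A * \<rho>0\<^sup>2" using assms by simp
      ultimately show ?thesis by linarith
    next
      case False
      have "\<rho> powr \<alpha> \<le> \<rho> powr 1" using h assms by (intro powr_mono) auto
      then have "\<delta> * \<rho> powr \<alpha> \<le> \<rho>0 * \<rho>0" using False h \<delta> by (intro mult_mono) auto
      then have "A * (\<delta> * \<rho> powr \<alpha>) \<le> A * (\<rho>0 * \<rho>0)" using assms by (intro mult_left_mono) auto
      moreover have "0 \<le> a / 2 * \<delta> * \<rho>" using assms \<delta> h by simp
      ultimately show ?thesis by (simp add: power2_eq_square mult.assoc)
    qed
    moreover have "b * \<rho> powr (1 - \<alpha>) \<le> a / 2 * \<delta> * \<rho>"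
    proof -
      have "a / 2 * (c * \<rho> powr (- \<alpha>)) * \<rho> \<le> a / 2 * \<delta> * \<rho>"
        using h assms by (intro mult_right_mono mult_left_mono) auto
      moreover have "\<rho> powr (- \<alpha>) * \<rho> = \<rho> powr (1 - \<alpha>)"
        using h by (simp add: powr_diff powr_minus field_simps)
      ultimately show ?thesis by (simp add: b_def mult.assoc)
    qed
    moreover have "a * \<delta> * \<rho> = a / 2 * \<delta> * \<rho> + a / 2 * \<delta> * \<rho>" by simp
    ultimately have "- (a * \<delta> * \<rho>) + A * \<delta> * \<rho> powr \<alpha> \<le> A * \<rho>0\<^sup>2 + - (b * \<rho> powr (1 - \<alpha>))"
      by linarith
    then have "exp (- (a * \<delta> * \<rho>) + A * \<delta> * \<rho> powr \<alpha>) \<le> exp (A * \<rho>0\<^sup>2 + - (b * \<rho> powr (1 - \<alpha>)))"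
      by simp
    also have "\<dots> = exp (A * \<rho>0\<^sup>2) * exp (- (b * \<rho> powr (1 - \<alpha>)))" by (rule exp_add)
    also have "exp (- (b * \<rho> powr (1 - \<alpha>))) \<le> (fact n / b ^ n) * \<rho> powr (- \<beta>)"
    proof -
      have "\<rho> powr \<beta> \<le> \<rho> powr ((1 - \<alpha>) * real n)"
        using h n assms by (intro powr_mono) (auto simp: field_simps)
      also have "\<dots> = (\<rho> powr (1 - \<alpha>)) ^ n" using h by (simp flip: powr_powr powr_realpow)
      also have "\<dots> = (b * \<rho> powr (1 - \<alpha>)) ^ n / b ^ n" using b by (simp add: power_mult_distrib)
      also have "\<dots> \<le> fact n * exp (b * \<rho> powr (1 - \<alpha>)) / b ^ n"
        using b by (intro divide_right_mono power_le_fact_exp) auto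
      finally show ?thesis using b h by (simp add: exp_minus powr_minus field_simps)
    qed
    finally show "exp (- (a * \<delta> * \<rho>) + A * \<delta> * \<rho> powr \<alpha>) \<le> C * \<rho> powr (- \<beta>)"
      by (simp add: C_def mult.assoc)
  qed
qed

definition ccube :: "real^'d \<Rightarrow> real \<Rightarrow> (real^'d) set" where
  "ccube z r = cube (\<chi> i. z $ i - r) (2 * r)"

lemma mem_ccube: "y \<in> ccube z r \<longleftrightarrow> (\<forall>i. z $ i - r \<le> y $ i \<and> y $ i < z $ i + r)"
  by (simp add: ccube_def mem_cube algebra_simps)

lemma ccube_lebesgue [measurable]: "ccube z r \<in> sets lebesgue"
  by (simp add: ccube_def)

text \<open>Euclidean shells, used only to sum over space; they are unrelated to
  \<open>grid_shell\<close>.\<close>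

definition shell :: "nat \<Rightarrow> (real^'d) set" where
  "shell n = {y. real n \<le> norm y \<and> norm y < real n + 1}"

lemma shell_lebesgue [measurable]: "shell n \<in> sets (lebesgue :: (real^'d) measure)"
proof -
  have "shell n = ball 0 (real n + 1) - ball (0::real^'d) (real n)" by (auto simp: shell_def)
  then show ?thesis by simp
qed

lemma mem_shell_floor: "y \<in> shell (nat \<lfloor>norm y\<rfloor>)"
  unfolding shell_def using floor_correct[of "norm y"] by simp

lemma card_int_box_le:
  "finite {m::int^'d. \<forall>i. m $ i \<in> I} \<and> card {m::int^'d. \<forall>i. m $ i \<in> I} \<le> card I ^ CARD('d)" if "finite I" for I
proof -
  have eq: "{m::int^'d. \<forall>i. m $ i \<in> I} = vec_lambda ` (PiE UNIV (\<lambda>_. I))"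
    by (auto simp: image_iff PiE_def Pi_def intro!: exI[of _ "vec_nth _"])
  have fin: "finite (PiE (UNIV :: 'd set) (\<lambda>_. I))" using that by (intro finite_PiE) auto
  have "card (PiE (UNIV :: 'd set) (\<lambda>_. I)) = card I ^ CARD('d)" by (simp add: card_PiE)
  then show ?thesis unfolding eq using card_image_le[OF fin, of vec_lambda] fin by auto
qed

text \<open>One representative is chosen from each nonempty cell of a mesh of width r, since points
  of one cell differ by less than r in each coordinate. Choosing it inside the shell keeps the norm
  of every centre under control.\<close>

lemma shell_cover:
  assumes "0 < r"
  obtains Z :: "(real^'d) set" where "finite Z" "Z \<subseteq> shell n" "shell n \<subseteq> (\<Union>z\<in>Z. ccube z r)"
    "real (card Z) \<le> (2 * (real n + 1) / r + 3) ^ CARD('d)"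
proof -
  define \<phi> :: "real^'d \<Rightarrow> int^'d" where "\<phi> y = (\<chi> i. \<lfloor>y $ i / r\<rfloor>)" for y
  define M where "M = \<lceil>(real n + 1) / r\<rceil>"
  have M: "(real n + 1) / r \<le> M" "M < (real n + 1) / r + 1" unfolding M_def by linarith+
  have "0 \<le> (real n + 1) / r" using assms by simp
  then have M0: "0 \<le> M" using M(1) by (metis of_int_0_le_iff order_trans)
  have im: "\<phi> ` shell n \<subseteq> {m. \<forall>i. m $ i \<in> {-M..M}}"
  proof -
    have "-M \<le> \<lfloor>y $ i / r\<rfloor> \<and> \<lfloor>y $ i / r\<rfloor> \<le> M" if "y \<in> shell n" for y :: "real^'d" and i
    proof -
      have "\<bar>y $ i\<bar> \<le> real n + 1" using that component_le_norm_cart[of y i] by (simp add: shell_def)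
      then have "\<bar>y $ i / r\<bar> \<le> (real n + 1) / r" using assms by (simp add: abs_divide divide_right_mono)
      then have "- M \<le> y $ i / r" "y $ i / r \<le> M" using M by linarith+
      then show ?thesis by (simp add: le_floor_iff) linarith
    qed
    then show ?thesis by (auto simp: \<phi>_def)
  qed
  have fin: "finite (\<phi> ` shell n)" using card_int_box_le[of "{-M..M}"] im by (auto intro: finite_subset)
  have "card (\<phi> ` shell n) \<le> card {-M..M} ^ CARD('d)"
    using card_int_box_le[of "{-M..M}"] card_mono[OF _ im] by (auto intro: order_trans)
  also have "card {-M..M} = nat (2 * M + 1)" by simp
  finally have "real (card (\<phi> ` shell n)) \<le> real (nat (2 * M + 1)) ^ CARD('d)"
    by (metis of_nat_le_iff of_nat_power)
  also have "real (nat (2 * M + 1)) = 2 * real_of_int M + 1" using M0 by simp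
  also have "(2 * real_of_int M + 1) ^ CARD('d) \<le> (2 * (real n + 1) / r + 3) ^ CARD('d)"
  proof (intro power_mono)
    have "2 * (real n + 1) / r = 2 * ((real n + 1) / r)" by simp
    then show "2 * real_of_int M + 1 \<le> 2 * (real n + 1) / r + 3" using M by linarith
  qed (use M0 in simp)
  finally have card: "real (card (\<phi> ` shell n)) \<le> (2 * (real n + 1) / r + 3) ^ CARD('d)" .
  define rep where "rep m = (SOME z. z \<in> shell n \<and> \<phi> z = m)" for m
  have rep: "rep m \<in> shell n \<and> \<phi> (rep m) = m" if "m \<in> \<phi> ` shell n" for m
    unfolding rep_def by (rule someI_ex) (use that in auto)
  show thesis
  proof (rule that[of "rep ` \<phi> ` shell n"])
    show "finite (rep ` \<phi> ` shell n)" using fin by blast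
    show "rep ` \<phi> ` shell n \<subseteq> shell n" using rep by blast
    show "real (card (rep ` \<phi> ` shell n)) \<le> (2 * (real n + 1) / r + 3) ^ CARD('d)"
      using card card_image_le[OF fin, of rep] by linarith
    show "shell n \<subseteq> (\<Union>z\<in>rep ` \<phi> ` shell n. ccube z r)"
    proof
      fix y :: "real^'d" assume y: "y \<in> shell n"
      define z where "z = rep (\<phi> y)"
      have "\<phi> z = \<phi> y" using rep[of "\<phi> y"] y by (auto simp: z_def)
      then have fl: "\<lfloor>z $ i / r\<rfloor> = \<lfloor>y $ i / r\<rfloor>" for i by (simp add: \<phi>_def vec_eq_iff)
      have "\<bar>z $ i / r - y $ i / r\<bar> < 1" for i using fl[of i] by linarith
      then have "\<bar>(z $ i - y $ i) / r\<bar> < 1" for i by (simp add: diff_divide_distrib)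
      then have "\<bar>z $ i - y $ i\<bar> < r" for i using assms by (simp add: abs_divide)
      then have "y \<in> ccube z r" by (simp add: mem_ccube abs_less_iff) (smt (verit))
      then show "y \<in> (\<Union>z\<in>rep ` \<phi> ` shell n. ccube z r)" using y by (auto simp: z_def)
    qed
  qed
qed

text \<open>In both applications t is the norm of the variable that is held fixed. At most 19^d
  \<rho>^(2d) cells cover a shell, so the exponent 2d + 2 in the cell estimate leaves \<rho>^(-2) <=
  (n + 1)^(-2), which is summable.\<close>

lemma nn_integral_shells:
  fixes \<Phi> :: "real^'d \<Rightarrow> ennreal"
  assumes [measurable]: "\<Phi> \<in> borel_measurable lebesgue" and "0 \<le> \<alpha>" "\<alpha> < 1" "0 \<le> t"
    and cell: "\<And>n z \<rho>. z \<in> shell n \<Longrightarrow> \<rho> = 2 + t + real n \<Longrightarrow>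
      (\<integral>\<^sup>+y\<in>shell n \<inter> ccube z (\<rho> powr (- \<alpha>) / 8). \<Phi> y \<partial>lebesgue) \<le> ennreal (\<rho> powr (- (2 * real CARD('d) + 2))) * B"
  shows "(\<integral>\<^sup>+y. \<Phi> y \<partial>lebesgue) \<le> ennreal (19 ^ CARD('d) * (\<Sum>n. 1 / (real n + 1)\<^sup>2)) * B"
proof -
  define d where "d = CARD('d)"
  define \<rho> where "\<rho> n = 2 + t + real n" for n
  define r where "r n = \<rho> n powr (- \<alpha>) / 8" for n
  have \<rho>: "1 \<le> \<rho> n" "real n + 1 \<le> \<rho> n" for n using assms(4) by (auto simp: \<rho>_def)
  have r: "0 < r n" for n using \<rho>(1)[of n] by (simp add: r_def)
  have "\<exists>Z :: (real^'d) set. finite Z \<and> Z \<subseteq> shell n \<and> shell n \<subseteq> (\<Union>z\<in>Z. ccube z (r n)) \<and>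
    real (card Z) \<le> (2 * (real n + 1) / r n + 3) ^ CARD('d)" for n
    using shell_cover[OF r[of n], of n] by metis
  then obtain Z :: "nat \<Rightarrow> (real^'d) set" where Z: "\<And>n. finite (Z n)" "\<And>n. Z n \<subseteq> shell n"
    "\<And>n. shell n \<subseteq> (\<Union>z\<in>Z n. ccube z (r n))" "\<And>n. real (card (Z n)) \<le> (2 * (real n + 1) / r n + 3) ^ d"
    unfolding d_def by metis
  \<comment> \<open>19 = 16 + 3: since \<alpha> < 1 the inverse radius is at most 8 \<rho>, and
    \<rho> >= 1 absorbs the summand 3.\<close>
  have count: "real (card (Z n)) \<le> 19 ^ d * \<rho> n ^ (2 * d)" for n
  proof -
    have "1 / r n = 8 * \<rho> n powr \<alpha>" unfolding r_def by (simp add: powr_minus field_simps)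
    also have "\<dots> \<le> 8 * \<rho> n powr 1" using \<rho>[of n] assms by (intro mult_left_mono powr_mono) auto
    finally have "1 / r n \<le> 8 * \<rho> n" using \<rho>[of n] by simp
    then have "2 * (real n + 1) * (1 / r n) \<le> 2 * \<rho> n * (8 * \<rho> n)"
      using \<rho>[of n] r[of n] by (intro mult_mono) auto
    moreover have "1 * 1 \<le> \<rho> n * \<rho> n" using \<rho>[of n] by (intro mult_mono) auto
    ultimately have "2 * (real n + 1) / r n + 3 \<le> 19 * (\<rho> n)\<^sup>2" by (simp add: power2_eq_square)
    then have "(2 * (real n + 1) / r n + 3) ^ d \<le> (19 * (\<rho> n)\<^sup>2) ^ d"
      using r[of n] by (intro power_mono) auto
    also have "\<dots> = 19 ^ d * \<rho> n ^ (2 * d)" by (simp add: power_mult_distrib power_mult)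
    finally show ?thesis using Z(4)[of n] by linarith
  qed
  have "(\<integral>\<^sup>+y. \<Phi> y \<partial>lebesgue) \<le> (\<integral>\<^sup>+y. (\<Sum>n. \<Sum>z\<in>Z n. \<Phi> y * indicator (shell n \<inter> ccube z (r n)) y) \<partial>lebesgue)"
  proof (rule nn_integral_mono)
    fix y :: "real^'d"
    define n where "n = nat \<lfloor>norm y\<rfloor>"
    have y: "y \<in> shell n" unfolding n_def by (rule mem_shell_floor)
    then obtain z where z: "z \<in> Z n" "y \<in> ccube z (r n)" using Z(3) by blast
    have "\<Phi> y = \<Phi> y * indicator (shell n \<inter> ccube z (r n)) y" using y z by simp
    also have "\<dots> \<le> (\<Sum>z\<in>Z n. \<Phi> y * indicator (shell n \<inter> ccube z (r n)) y)"
      using Z z by (intro member_le_sum) auto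
    also have "\<dots> = (\<Sum>n\<in>{n}. \<Sum>z\<in>Z n. \<Phi> y * indicator (shell n \<inter> ccube z (r n)) y)" by simp
    also have "\<dots> \<le> (\<Sum>n. \<Sum>z\<in>Z n. \<Phi> y * indicator (shell n \<inter> ccube z (r n)) y)"
      by (rule sum_le_suminf) auto
    finally show "\<Phi> y \<le> (\<Sum>n. \<Sum>z\<in>Z n. \<Phi> y * indicator (shell n \<inter> ccube z (r n)) y)" .
  qed
  also have "\<dots> = (\<Sum>n. \<Sum>z\<in>Z n. (\<integral>\<^sup>+y\<in>shell n \<inter> ccube z (r n). \<Phi> y \<partial>lebesgue))"
    by (simp add: nn_integral_suminf nn_integral_sum)
  also have "\<dots> \<le> (\<Sum>n. ennreal (19 ^ d * (1 / (real n + 1)\<^sup>2)) * B)"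
  proof (rule suminf_le)
    fix n
    have "(\<Sum>z\<in>Z n. (\<integral>\<^sup>+y\<in>shell n \<inter> ccube z (r n). \<Phi> y \<partial>lebesgue)) \<le>
        (\<Sum>z\<in>Z n. ennreal (\<rho> n powr (- (2 * real d + 2))) * B)"
      unfolding d_def r_def using Z(2)[of n] by (intro sum_mono cell) (auto simp: \<rho>_def)
    also have "\<dots> = ennreal (real (card (Z n)) * \<rho> n powr (- (2 * real d + 2))) * B"
      by (simp add: ennreal_mult ennreal_of_nat_eq_real_of_nat mult.assoc)
    also have "real (card (Z n)) * \<rho> n powr (- (2 * real d + 2)) \<le> 19 ^ d * (1 / (real n + 1)\<^sup>2)"
    proof -
      have e: "\<rho> n powr (- (2 * real d + 2)) = 1 / (\<rho> n ^ (2 * d) * (\<rho> n)\<^sup>2)"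
      proof -
        have "\<rho> n powr (2 * real d + 2) = \<rho> n ^ (2 * d + 2)"
          using \<rho>(1)[of n] powr_realpow[of "\<rho> n" "2 * d + 2"] by (simp add: add.commute)
        then show ?thesis by (simp only: powr_minus_divide power_add)
      qed
      have "real (card (Z n)) * (1 / (\<rho> n ^ (2 * d) * (\<rho> n)\<^sup>2)) \<le>
          19 ^ d * \<rho> n ^ (2 * d) * (1 / (\<rho> n ^ (2 * d) * (\<rho> n)\<^sup>2))"
        using count \<rho>(1)[of n] by (intro mult_right_mono) auto
      also have "19 ^ d * \<rho> n ^ (2 * d) * (1 / (\<rho> n ^ (2 * d) * (\<rho> n)\<^sup>2)) = 19 ^ d * (1 / (\<rho> n)\<^sup>2)"
        using \<rho>(1)[of n] by simp
      also have "\<dots> \<le> 19 ^ d * (1 / (real n + 1)\<^sup>2)"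
        using \<rho>[of n] by (intro mult_left_mono divide_left_mono power_mono) auto
      finally show ?thesis unfolding e .
    qed
    finally show "(\<Sum>z\<in>Z n. (\<integral>\<^sup>+y\<in>shell n \<inter> ccube z (r n). \<Phi> y \<partial>lebesgue)) \<le> ennreal (19 ^ d * (1 / (real n + 1)\<^sup>2)) * B"
      by (simp add: ennreal_leI mult_right_mono)
  qed auto
  also have "\<dots> = (\<Sum>n. ennreal (19 ^ d * (1 / (real n + 1)\<^sup>2))) * B"
    by (rule ennreal_suminf_multc)
  also have "(\<Sum>n. ennreal (19 ^ d * (1 / (real n + 1)\<^sup>2))) = ennreal (19 ^ d * (\<Sum>n. 1 / (real n + 1)\<^sup>2))"
  proof -
    have "summable (\<lambda>n. 1 / (real n + 1)\<^sup>2)"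
    proof -
      have "summable (\<lambda>n. inverse (real (Suc n) ^ 2))"
        by (subst summable_Suc_iff) (rule inverse_power_summable, simp)
      then show ?thesis by (simp add: inverse_eq_divide add.commute)
    qed
    note s = this
    have "(\<Sum>n. ennreal (19 ^ d * (1 / (real n + 1)\<^sup>2))) = ennreal (\<Sum>n. 19 ^ d * (1 / (real n + 1)\<^sup>2))"
      by (rule suminf_ennreal2[OF _ summable_mult[OF s]]) simp
    also have "(\<Sum>n. 19 ^ d * (1 / (real n + 1)\<^sup>2)) = 19 ^ d * (\<Sum>n. 1 / (real n + 1)\<^sup>2)"
      by (rule suminf_mult[OF s])
    finally show ?thesis .
  qed
  finally show ?thesis unfolding d_def .
qed

section \<open>The far part of the operator\<close>

text \<open>Up to a constant it dominates the conjugated kernel beyond distance c (1 +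
  |x|)^(-\<alpha>) for all times at once; the polynomial stands in for the singular factor in
  t.\<close>

definition far_kernel :: "real \<Rightarrow> real \<Rightarrow> real^'d \<Rightarrow> real^'d \<Rightarrow> real" where
  "far_kernel \<alpha> c x y =
     (if c * (1 + norm x) powr (- \<alpha>) \<le> norm (x - y)
      then (2 + norm x + norm y) ^ CARD('d) * exp (- (norm (x - y) * (2 + norm x + norm y) / 32))
      else 0)"

lemma far_kernel_nonneg: "0 \<le> far_kernel \<alpha> c x y"
  by (simp add: far_kernel_def)

text \<open>\<rho> is 2 + |x| + |y| with one norm rounded down, so that it is constant on a shell.
  The polynomial factor of the kernel is absorbed by asking
  \<open>gaussian_decay_beats_chain\<close> for the extra decay \<gamma> = d e. The exponential in A
  is the price of a chain of cubes.\<close>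

lemma far_kernel_decay:
  fixes \<alpha> c e A \<beta> :: real
  assumes "0 \<le> \<alpha>" "\<alpha> < 1" "0 < c" "0 < e" "0 \<le> A"
  obtains C where "0 < C" "\<And>(x::real^'d) y \<rho>. 1 \<le> \<rho> \<Longrightarrow> \<rho> \<le> 2 + norm x + norm y \<Longrightarrow> 1 + norm x + norm y \<le> \<rho> \<Longrightarrow>
    far_kernel \<alpha> c x y powr e * exp (A * norm (x - y) * \<rho> powr \<alpha>) \<le> C * \<rho> powr (- \<beta>)"
proof -
  define d where "d = CARD('d)"
  define \<gamma> where "\<gamma> = real d * e"
  have \<gamma>: "0 \<le> \<gamma>" using assms by (simp add: \<gamma>_def)
  obtain C where C: "0 < C" and decay: "\<And>\<rho> \<delta>. 1 \<le> \<rho> \<Longrightarrow> c * \<rho> powr (- \<alpha>) \<le> \<delta> \<Longrightarrow> \<delta> \<le> \<rho> \<Longrightarrow>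
     exp (- (e / 32 * \<delta> * \<rho>) + A * \<delta> * \<rho> powr \<alpha>) \<le> C * \<rho> powr (- (\<beta> + \<gamma>))"
    using gaussian_decay_beats_chain[OF assms(1,2) _ assms(5,3), of "e / 32" "\<beta> + \<gamma>"] assms(4) by auto
  show thesis
  proof (rule that)
    show "0 < C * 2 powr \<gamma>" using C by simp
    fix x y :: "real^'d" and \<rho> :: real
    assume \<rho>: "1 \<le> \<rho>" "\<rho> \<le> 2 + norm x + norm y" "1 + norm x + norm y \<le> \<rho>"
    define \<delta> where "\<delta> = norm (x - y)"
    define \<rho>' where "\<rho>' = 2 + norm x + norm y"
    have \<rho>': "\<rho> \<le> \<rho>'" "\<rho>' \<le> 2 * \<rho>" "0 < \<rho>'" using \<rho> by (auto simp: \<rho>'_def)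
    show "far_kernel \<alpha> c x y powr e * exp (A * norm (x - y) * \<rho> powr \<alpha>) \<le> C * 2 powr \<gamma> * \<rho> powr (- \<beta>)"
    proof (cases "c * (1 + norm x) powr (- \<alpha>) \<le> norm (x - y)")
      case True
      have "\<rho> powr (- \<alpha>) \<le> (1 + norm x) powr (- \<alpha>)"
      proof (rule powr_mono2')
        show "1 + norm x \<le> \<rho>" using \<rho>(3) norm_ge_zero[of y] by linarith
      qed (use assms in \<open>auto intro: add_pos_nonneg\<close>)
      then have "c * \<rho> powr (- \<alpha>) \<le> c * (1 + norm x) powr (- \<alpha>)"
        using assms by (intro mult_left_mono) auto
      then have \<delta>1: "c * \<rho> powr (- \<alpha>) \<le> \<delta>" using True by (simp add: \<delta>_def)
      have \<delta>2: "\<delta> \<le> \<rho>" using norm_triangle_ineq4[of x y] \<rho> by (simp add: \<delta>_def)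
      have \<delta>0: "0 \<le> \<delta>" by (simp add: \<delta>_def)
      have "far_kernel \<alpha> c x y = \<rho>' ^ d * exp (- (\<delta> * \<rho>' / 32))"
        using True by (simp add: far_kernel_def \<rho>'_def \<delta>_def d_def)
      then have "far_kernel \<alpha> c x y powr e = \<rho>' powr \<gamma> * exp (- (\<delta> * \<rho>' / 32) * e)"
        using \<rho>' by (simp add: powr_mult powr_powr exp_powr_real \<gamma>_def flip: powr_realpow)
      also have "\<dots> \<le> (2 * \<rho>) powr \<gamma> * exp (- (e / 32 * \<delta> * \<rho>))"
      proof (intro mult_mono powr_mono2)
        have "\<delta> * \<rho> * (e / 32) \<le> \<delta> * \<rho>' * (e / 32)"
          using \<rho>' \<delta>0 assms by (intro mult_right_mono mult_left_mono) auto
        then show "exp (- (\<delta> * \<rho>' / 32) * e) \<le> exp (- (e / 32 * \<delta> * \<rho>))" by (simp add: mult_ac)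
      qed (use \<rho>' \<gamma> in auto)
      finally have "far_kernel \<alpha> c x y powr e * exp (A * \<delta> * \<rho> powr \<alpha>) \<le>
          (2 * \<rho>) powr \<gamma> * exp (- (e / 32 * \<delta> * \<rho>)) * exp (A * \<delta> * \<rho> powr \<alpha>)"
        by (rule mult_right_mono) simp
      also have "\<dots> = (2 * \<rho>) powr \<gamma> * exp (- (e / 32 * \<delta> * \<rho>) + A * \<delta> * \<rho> powr \<alpha>)"
        by (simp only: exp_add mult.assoc)
      also have "\<dots> \<le> (2 * \<rho>) powr \<gamma> * (C * \<rho> powr (- (\<beta> + \<gamma>)))"
        by (intro mult_left_mono decay \<rho> \<delta>1 \<delta>2) simp
      also have "\<dots> = C * 2 powr \<gamma> * (\<rho> powr \<gamma> * \<rho> powr (- (\<beta> + \<gamma>)))"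
        using \<rho> by (simp add: powr_mult)
      also have "\<rho> powr \<gamma> * \<rho> powr (- (\<beta> + \<gamma>)) = \<rho> powr (- \<beta>)"
        by (simp flip: powr_add)
      finally show ?thesis by (simp only: \<delta>_def)
    next
      case False
      then show ?thesis using C assms by (simp add: far_kernel_def)
    qed
  qed
qed

text \<open>Separates the weighted estimates from the grid: \<open>G\<close> marks good cubes, which
  include all cubes close to x at the local scale, and the A_p inequality holds on them with one
  constant.\<close>

locale local_Ap =
  fixes p \<alpha> K :: real and \<omega> :: "real^'d \<Rightarrow> real" and G :: "(real^'d) set \<Rightarrow> bool"
  assumes p: "1 < p" and \<alpha>: "0 \<le> \<alpha>" "\<alpha> < 1" and K: "0 < K"
    and \<omega> [measurable]: "\<omega> \<in> borel_measurable lebesgue" and \<omega>_pos: "\<And>x. 0 < \<omega> x"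
    and good: "\<And>x c s. 0 < s \<Longrightarrow>
      cube c s \<subseteq> {z. \<forall>i. \<bar>z $ i - x $ i\<bar> < 1 / 2 * (1 + norm x) powr (- \<alpha>)} \<Longrightarrow> G (cube c s)"
    and Ap: "\<And>c s. 0 < s \<Longrightarrow> G (cube c s) \<Longrightarrow>
      \<exists>W V. 0 < W \<and> 0 < V \<and> (\<integral>\<^sup>+x\<in>cube c s. ennreal (\<omega> x) \<partial>lebesgue) = ennreal W \<and>
        (\<integral>\<^sup>+x\<in>cube c s. ennreal (\<omega> x powr (- (1 / (p - 1)))) \<partial>lebesgue) = ennreal V \<and>
        W * V powr (p - 1) \<le> K * (s ^ CARD('d)) powr p"
begin

section \<open>Masses of the weight and of its dual: doubling and chains\<close>

definition \<sigma> :: "real^'d \<Rightarrow> real" where "\<sigma> x = \<omega> x powr (- (1 / (p - 1)))"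
text \<open>\<open>enn2real\<close> would turn an infinite mass into 0; on good cubes the masses are
  finite, so there the real value is faithful.\<close>

definition W :: "(real^'d) set \<Rightarrow> real" where "W Q = enn2real (\<integral>\<^sup>+x\<in>Q. ennreal (\<omega> x) \<partial>lebesgue)"
definition V :: "(real^'d) set \<Rightarrow> real" where "V Q = enn2real (\<integral>\<^sup>+x\<in>Q. ennreal (\<sigma> x) \<partial>lebesgue)"
definition q :: real where "q = p / (p - 1)"

lemma q: "1 < q" "1 / p + 1 / q = 1" "p / q = p - 1" "q / p = 1 / (p - 1)"
  using p by (auto simp: q_def field_simps)

lemma \<sigma>_pos: "0 < \<sigma> x"
  using \<omega>_pos[of x] by (simp add: \<sigma>_def)

lemma \<sigma>_measurable [measurable]: "\<sigma> \<in> borel_measurable lebesgue"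
  unfolding \<sigma>_def[abs_def] by measurable

lemma WV:
  assumes "0 < s" "G (cube c s)"
  shows "0 < W (cube c s)" "0 < V (cube c s)"
    "(\<integral>\<^sup>+x\<in>cube c s. ennreal (\<omega> x) \<partial>lebesgue) = ennreal (W (cube c s))"
    "(\<integral>\<^sup>+x\<in>cube c s. ennreal (\<sigma> x) \<partial>lebesgue) = ennreal (V (cube c s))"
    "W (cube c s) * V (cube c s) powr (p - 1) \<le> K * (s ^ CARD('d)) powr p"
proof -
  obtain w v where wv: "0 < w" "0 < v" "(\<integral>\<^sup>+x\<in>cube c s. ennreal (\<omega> x) \<partial>lebesgue) = ennreal w"
    "(\<integral>\<^sup>+x\<in>cube c s. ennreal (\<sigma> x) \<partial>lebesgue) = ennreal v"
    "w * v powr (p - 1) \<le> K * (s ^ CARD('d)) powr p"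
    using Ap[OF assms] unfolding \<sigma>_def by blast
  have "W (cube c s) = w" "V (cube c s) = v"
    unfolding W_def V_def wv using wv(1,2) by simp_all
  then show "0 < W (cube c s)" "0 < V (cube c s)"
    "(\<integral>\<^sup>+x\<in>cube c s. ennreal (\<omega> x) \<partial>lebesgue) = ennreal (W (cube c s))"
    "(\<integral>\<^sup>+x\<in>cube c s. ennreal (\<sigma> x) \<partial>lebesgue) = ennreal (V (cube c s))"
    "W (cube c s) * V (cube c s) powr (p - 1) \<le> K * (s ^ CARD('d)) powr p"
    using wv by simp_all
qed

lemma WV_mono:
  assumes "0 < s" "G (cube c s)" "0 < s'" "G (cube c' s')" "cube c' s' \<subseteq> cube c s"
  shows "W (cube c' s') \<le> W (cube c s)" "V (cube c' s') \<le> V (cube c s)"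
proof -
  have "(\<integral>\<^sup>+x\<in>cube c' s'. ennreal (\<omega> x) \<partial>lebesgue) \<le> (\<integral>\<^sup>+x\<in>cube c s. ennreal (\<omega> x) \<partial>lebesgue)"
    "(\<integral>\<^sup>+x\<in>cube c' s'. ennreal (\<sigma> x) \<partial>lebesgue) \<le> (\<integral>\<^sup>+x\<in>cube c s. ennreal (\<sigma> x) \<partial>lebesgue)"
    using assms(5) by (auto intro!: nn_integral_mono split: split_indicator)
  then show "W (cube c' s') \<le> W (cube c s)" "V (cube c' s') \<le> V (cube c s)"
    using WV(1,2)[OF assms(1,2)] unfolding WV(3,4)[OF assms(1,2)] WV(3,4)[OF assms(3,4)] by simp_all
qed

text \<open>Hoelder's inequality for 1 = \<omega>^(1/p) \<sigma>^(1/q): the inequality converse to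
  A_p.\<close>

lemma cube_volume_le:
  assumes "0 < s" "G (cube c s)"
  shows "(s ^ CARD('d)) powr p \<le> W (cube c s) * V (cube c s) powr (p - 1)"
proof -
  let ?Q = "cube c s"
  define m where "m = s ^ CARD('d)"
  have m: "0 < m" using assms by (simp add: m_def)
  note [measurable] = cube_lebesgue
  have e: "ennreal (\<omega> x powr (1 / p)) * ennreal (\<sigma> x powr (1 / q)) = 1" for x
  proof -
    have "\<omega> x powr (1 / p) * \<sigma> x powr (1 / q) = \<omega> x powr (1 / p + - (1 / (p - 1)) * (1 / q))"
      by (simp only: \<sigma>_def powr_powr powr_add)
    also have "1 / p + - (1 / (p - 1)) * (1 / q) = 0" using p by (simp add: q_def field_simps)
    finally show ?thesis using \<omega>_pos[of x] by (simp flip: ennreal_mult)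
  qed
  have "ennreal m = emeasure lebesgue ?Q"
    unfolding m_def using assms by (intro emeasure_cube[symmetric]) simp
  also have "\<dots> = (\<integral>\<^sup>+x. indicator ?Q x \<partial>lebesgue)"
    by (rule nn_integral_indicator[symmetric]) (rule cube_lebesgue)
  also have "\<dots> = (\<integral>\<^sup>+x. (ennreal (\<omega> x powr (1 / p)) * indicator ?Q x) * (ennreal (\<sigma> x powr (1 / q)) * indicator ?Q x) \<partial>lebesgue)"
    using e by (intro nn_integral_cong) (simp split: split_indicator)
  also have "\<dots> \<le> enn_powr (\<integral>\<^sup>+x. enn_powr (ennreal (\<omega> x powr (1 / p)) * indicator ?Q x) p \<partial>lebesgue) (1 / p) *
      enn_powr (\<integral>\<^sup>+x. enn_powr (ennreal (\<sigma> x powr (1 / q)) * indicator ?Q x) q \<partial>lebesgue) (1 / q)"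
    by (rule nn_integral_Holder[OF p q(2)]) measurable
  also have "(\<integral>\<^sup>+x. enn_powr (ennreal (\<omega> x powr (1 / p)) * indicator ?Q x) p \<partial>lebesgue) = ennreal (W ?Q)"
    unfolding WV(3)[OF assms, symmetric] using p \<omega>_pos
    by (intro nn_integral_cong) (simp split: split_indicator add: enn_powr_ennreal powr_powr less_imp_le)
  also have "(\<integral>\<^sup>+x. enn_powr (ennreal (\<sigma> x powr (1 / q)) * indicator ?Q x) q \<partial>lebesgue) = ennreal (V ?Q)"
    unfolding WV(4)[OF assms, symmetric] using q(1) \<sigma>_pos
    by (intro nn_integral_cong) (simp split: split_indicator add: enn_powr_ennreal powr_powr less_imp_le)
  finally have "m \<le> W ?Q powr (1 / p) * V ?Q powr (1 / q)"
    using WV(1,2)[OF assms] by (simp add: enn_powr_ennreal flip: ennreal_mult)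
  then have "m powr p \<le> (W ?Q powr (1 / p) * V ?Q powr (1 / q)) powr p"
    using m p by (intro powr_mono2) auto
  also have "\<dots> = W ?Q * V ?Q powr (p - 1)"
    using WV(1,2)[OF assms] p q(3) by (simp add: powr_mult powr_powr)
  finally show ?thesis by (simp only: m_def)
qed

text \<open>The volume of the small cube is bounded by Hoelder's inequality, W passes to the large
  cube by monotonicity, and there A_p trades W V^(p-1) for the volume of the large cube. What
  remains compares the two values of V.\<close>

lemma dual_doubling:
  assumes "0 < s" "G (cube c s)" "0 < s'" "G (cube c' s')" "cube c' s' \<subseteq> cube c s"
  shows "V (cube c s) \<le> (K * ((s / s') ^ CARD('d)) powr p) powr (1 / (p - 1)) * V (cube c' s')"
proof -
  let ?Q = "cube c s" and ?R = "cube c' s'"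
  define m m' where "m = s ^ CARD('d)" and "m' = s' ^ CARD('d)"
  have m: "0 < m" "0 < m'" using assms by (auto simp: m_def m'_def)
  note pos = WV(1,2)[OF assms(1,2)] WV(1,2)[OF assms(3,4)]
  have "m' powr p * V ?Q powr (p - 1) \<le> W ?R * V ?R powr (p - 1) * V ?Q powr (p - 1)"
    using cube_volume_le[OF assms(3,4)] unfolding m'_def by (intro mult_right_mono) auto
  also have "\<dots> \<le> W ?Q * V ?R powr (p - 1) * V ?Q powr (p - 1)"
    using WV_mono[OF assms] by (intro mult_right_mono) auto
  also have "\<dots> = (W ?Q * V ?Q powr (p - 1)) * V ?R powr (p - 1)" by (simp only: mult_ac)
  also have "\<dots> \<le> (K * m powr p) * V ?R powr (p - 1)"
    using WV(5)[OF assms(1,2)] unfolding m_def by (intro mult_right_mono) auto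
  finally have "V ?Q powr (p - 1) \<le> (K * m powr p) * V ?R powr (p - 1) / m' powr p"
    using m by (simp add: pos_le_divide_eq mult.commute)
  also have "\<dots> = K * (m / m') powr p * V ?R powr (p - 1)"
    using m by (simp add: powr_divide)
  also have "m / m' = (s / s') ^ CARD('d)" by (simp add: m_def m'_def power_divide)
  finally have "(V ?Q powr (p - 1)) powr (1 / (p - 1)) \<le>
      (K * ((s / s') ^ CARD('d)) powr p * V ?R powr (p - 1)) powr (1 / (p - 1))"
    using p by (intro powr_mono2) auto
  then show ?thesis using pos p K assms by (simp add: powr_mult powr_powr)
qed

text \<open>The doubling constant of \<open>dual_doubling\<close> for side ratio 2, made at least 1
  so that its powers increase with the exponent.\<close>

definition D :: real where "D = max 1 ((K * (2 ^ CARD('d)) powr p) powr (1 / (p - 1)))"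

lemma D: "1 \<le> D" by (simp add: D_def)

text \<open>The parameter \<rho> allows one radius for all points of norm at most \<rho> - 1, as
  chains require.\<close>

lemma good_ccube:
  assumes "1 + norm x \<le> \<rho>" "0 < r" "\<And>i. \<bar>z $ i - x $ i\<bar> + r < 1 / 2 * \<rho> powr (- \<alpha>)"
  shows "G (ccube z r)"
  unfolding ccube_def
proof (rule good[of _ _ x])
  have "\<rho> powr (- \<alpha>) \<le> (1 + norm x) powr (- \<alpha>)"
    using assms(1) \<alpha> by (intro powr_mono2') (auto intro: add_pos_nonneg)
  then have le: "1 / 2 * \<rho> powr (- \<alpha>) \<le> 1 / 2 * (1 + norm x) powr (- \<alpha>)" by simp
  show "cube (\<chi> i. z $ i - r) (2 * r) \<subseteq> {w. \<forall>i. \<bar>w $ i - x $ i\<bar> < 1 / 2 * (1 + norm x) powr (- \<alpha>)}"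
  proof (clarify)
    fix w i assume "w \<in> cube (\<chi> i. z $ i - r) (2 * r)"
    then have "z $ i - r \<le> w $ i \<and> w $ i < z $ i + r" unfolding ccube_def[symmetric] mem_ccube by blast
    then show "\<bar>w $ i - x $ i\<bar> < 1 / 2 * (1 + norm x) powr (- \<alpha>)" using assms(3)[of i] le by linarith
  qed
qed (use assms in simp)

text \<open>Both cubes lie in \<open>ccube x (2 * r)\<close>, which is still good because the local
  scale is at least 4 r; doubling from this cube to \<open>ccube x r\<close> gives the factor
  D.\<close>

lemma adjacent:
  assumes "1 + norm x \<le> \<rho>" "r = \<rho> powr (- \<alpha>) / 8" "\<And>i. \<bar>z $ i - x $ i\<bar> \<le> r"
  shows "V (ccube z r) \<le> D * V (ccube x r)"
proof -
  have "0 < \<rho>" using assms(1) norm_ge_zero[of x] by linarith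
  then have r: "0 < r" unfolding assms(2) by simp
  have half: "1 / 2 * \<rho> powr (- \<alpha>) = 4 * r" using assms(2) by simp
  have G: "G (ccube z r)" "G (ccube x r)" "G (ccube x (2 * r))"
  proof -
    show "G (ccube z r)"
    proof (rule good_ccube[OF assms(1) r])
      show "\<bar>z $ i - x $ i\<bar> + r < 1 / 2 * \<rho> powr (- \<alpha>)" for i
        using assms(3)[of i] r unfolding half by linarith
    qed
    show "G (ccube x r)" "G (ccube x (2 * r))"
      using r half by (auto intro!: good_ccube[OF assms(1)])
  qed
  have sub: "ccube z r \<subseteq> ccube x (2 * r)" "ccube x r \<subseteq> ccube x (2 * r)"
  proof -
    show "ccube z r \<subseteq> ccube x (2 * r)"
    proof
      fix w assume w: "w \<in> ccube z r"
      show "w \<in> ccube x (2 * r)" unfolding mem_ccube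
      proof
        fix i show "x $ i - 2 * r \<le> w $ i \<and> w $ i < x $ i + 2 * r"
          using w assms(3)[of i] unfolding mem_ccube by (smt (verit))
      qed
    qed
    show "ccube x r \<subseteq> ccube x (2 * r)" using r unfolding mem_ccube subset_iff by (smt (verit))
  qed
  have "V (ccube z r) \<le> V (ccube x (2 * r))"
    using WV_mono(2)[of "2 * (2 * r)" _ "2 * r"] r G sub unfolding ccube_def by simp
  also have "\<dots> \<le> (K * ((2 * (2 * r) / (2 * r)) ^ CARD('d)) powr p) powr (1 / (p - 1)) * V (ccube x r)"
    using r G sub unfolding ccube_def by (intro dual_doubling) auto
  also have "\<dots> = (K * (2 ^ CARD('d)) powr p) powr (1 / (p - 1)) * V (ccube x r)"
    using r by simp
  also have "\<dots> \<le> D * V (ccube x r)"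
    unfolding D_def by (intro mult_right_mono) (auto simp: V_def)
  finally show ?thesis .
qed

lemma V_nonneg: "0 \<le> V Q" by (simp add: V_def)

text \<open>Equally spaced points on the segment from x to y, at distance at most r from each other.
  By convexity their norms stay below \<rho> - 1, so the same r is admissible along the whole
  segment.\<close>

lemma chain:
  assumes "1 + norm x \<le> \<rho>" "1 + norm y \<le> \<rho>" "r = \<rho> powr (- \<alpha>) / 8"
  shows "V (ccube y r) \<le> D powr (1 + norm (x - y) / r) * V (ccube x r)"
proof -
  have "0 < \<rho>" using assms(1) norm_ge_zero[of x] by linarith
  then have r: "0 < r" unfolding assms(3) by simp
  define n where "n = nat \<lfloor>norm (x - y) / r\<rfloor> + 1"
  have "0 \<le> norm (x - y) / r" using r by simp
  then have n: "0 < n" "norm (x - y) / r \<le> real n" "real n \<le> 1 + norm (x - y) / r"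
    unfolding n_def by linarith+
  define z where "z j = x + (real j / real n) *\<^sub>R (y - x)" for j
  have "V (ccube (z j) r) \<le> D ^ j * V (ccube x r)" if "j \<le> n" for j
    using that
  proof (induction j)
    case (Suc j)
    have conv: "z j = (1 - real j / real n) *\<^sub>R x + (real j / real n) *\<^sub>R y"
      by (simp add: z_def algebra_simps)
    have "norm (z j) \<le> (1 - real j / real n) * norm x + (real j / real n) * norm y"
      unfolding conv using Suc.prems by (intro order_trans[OF norm_triangle_ineq]) simp
    also have "\<dots> \<le> (1 - real j / real n) * (\<rho> - 1) + (real j / real n) * (\<rho> - 1)"
      using assms Suc.prems by (intro add_mono mult_left_mono) auto
    also have "\<dots> = \<rho> - 1" by (simp add: algebra_simps)
    finally have nz: "1 + norm (z j) \<le> \<rho>" by simp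
    have "\<bar>z (Suc j) $ i - z j $ i\<bar> \<le> r" for i
    proof -
      have "z (Suc j) - z j = (1 / real n) *\<^sub>R (y - x)"
        by (simp add: z_def add_divide_distrib scaleR_add_left)
      then have "norm (z (Suc j) - z j) = norm (x - y) / real n"
        by (simp add: norm_minus_commute)
      also have "\<dots> \<le> r" using n r by (simp add: field_simps)
      finally show ?thesis using component_le_norm_cart[of "z (Suc j) - z j" i] by simp
    qed
    then have "V (ccube (z (Suc j)) r) \<le> D * V (ccube (z j) r)"
      by (intro adjacent[OF nz assms(3)])
    also have "\<dots> \<le> D * (D ^ j * V (ccube x r))"
      using Suc D by (intro mult_left_mono) auto
    finally show ?case by (simp add: mult.assoc)
  qed (simp add: z_def)
  from this[of n] have "V (ccube y r) \<le> D ^ n * V (ccube x r)" using n by (simp add: z_def)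
  also have "D ^ n = D powr real n" using D by (simp add: powr_realpow)
  also have "D powr real n \<le> D powr (1 + norm (x - y) / r)" using n D by (intro powr_mono) auto
  finally show ?thesis by (simp add: V_nonneg mult_right_mono)
qed

end

section \<open>Joint measurability over two copies of Lebesgue measure\<close>

lemma sigma_finite_lebesgue: "sigma_finite_measure (lebesgue :: 'a::euclidean_space measure)"
proof
  show "\<exists>A::'a set set. countable A \<and> A \<subseteq> sets lebesgue \<and> \<Union> A = space lebesgue \<and> (\<forall>a\<in>A. emeasure lebesgue a \<noteq> \<infinity>)"
  proof (intro exI[of _ "range (\<lambda>n. ball (0::'a) (real n))"] conjI)
    show "\<Union> (range (\<lambda>n. ball (0::'a) (real n))) = space lebesgue"
      by (auto intro: reals_Archimedean2)
    show "\<forall>a\<in>range (\<lambda>n. ball (0::'a) (real n)). emeasure lebesgue a \<noteq> \<infinity>"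
      using emeasure_lborel_ball_finite[of "0::'a"] by (auto simp: less_le)
  qed auto
qed

lemma pair_sigma_finite_lebesgue: "pair_sigma_finite (lebesgue :: 'a::euclidean_space measure) (lebesgue :: 'b::euclidean_space measure)"
  by (intro pair_sigma_finite.intro sigma_finite_lebesgue)

lemma measurable_id_lebesgue: "(\<lambda>x::real^'d. x) \<in> lebesgue \<rightarrow>\<^sub>M borel"
  by (rule measurable_completion) simp

lemma far_kernel_measurable [measurable]:
  "(\<lambda>z. far_kernel \<alpha> c (fst z) (snd z)) \<in> borel_measurable (lebesgue \<Otimes>\<^sub>M lebesgue)"
proof -
  have [measurable]: "fst \<in> lebesgue \<Otimes>\<^sub>M lebesgue \<rightarrow>\<^sub>M (borel :: (real^'d) measure)"
    "snd \<in> lebesgue \<Otimes>\<^sub>M lebesgue \<rightarrow>\<^sub>M (borel :: (real^'d) measure)"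
    by (rule measurable_compose[OF measurable_fst measurable_id_lebesgue]
        measurable_compose[OF measurable_snd measurable_id_lebesgue])+
  show ?thesis unfolding far_kernel_def by measurable
qed

lemma far_kernel_measurable1 [measurable]: "far_kernel \<alpha> c x \<in> borel_measurable lebesgue"
  using measurable_compose[OF measurable_Pair1'[of x lebesgue lebesgue] far_kernel_measurable] by simp

lemma far_kernel_measurable2 [measurable]: "(\<lambda>x. far_kernel \<alpha> c x y) \<in> borel_measurable lebesgue"
  using measurable_compose[OF measurable_Pair2'[of y lebesgue lebesgue] far_kernel_measurable] by simp

section \<open>Schur test for the far kernel\<close>

context local_Ap
begin

text \<open>The dual factor that Hoelder's inequality leaves when the kernel is split into two
  square roots.\<close>

definition S :: "real \<Rightarrow> real^'d \<Rightarrow> ennreal" where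
  "S c x = (\<integral>\<^sup>+y. ennreal (far_kernel \<alpha> c x y powr (q / 2)) * ennreal (\<sigma> y) \<partial>lebesgue)"

lemma S_measurable [measurable]: "S c \<in> borel_measurable lebesgue"
proof -
  interpret sigma_finite_measure "lebesgue :: (real^'d) measure" by (rule sigma_finite_lebesgue)
  have [measurable]: "(\<lambda>z. \<sigma> (snd z)) \<in> borel_measurable (lebesgue \<Otimes>\<^sub>M (lebesgue :: (real^'d) measure))"
    by measurable
  have "(\<lambda>z. ennreal (far_kernel \<alpha> c (fst z) (snd z) powr (q / 2)) * ennreal (\<sigma> (snd z))) \<in>
      borel_measurable ((lebesgue :: (real^'d) measure) \<Otimes>\<^sub>M lebesgue)"
    by measurable
  then show ?thesis unfolding S_def[abs_def]
    by (intro borel_measurable_nn_integral) (simp add: case_prod_unfold)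
qed

text \<open>On each cell the kernel is estimated relative to the dual mass of the cell, so
  integrating \<sigma> over the cell cancels that mass and leaves the dual mass around x. The chain
  makes this comparison and the decay of the kernel pays for it.\<close>

lemma S_bound:
  assumes "0 < c"
  obtains C where "0 < C" "\<And>x. S c x \<le> ennreal (C * V (ccube x ((2 + norm x) powr (- \<alpha>) / 8)))"
proof -
  define d where "d = CARD('d)"
  \<comment> \<open>Since 1 / r = 8 \<rho>^\<alpha>, the chain factor D^(|x - y| / r) is exp (A |x -
    y| \<rho>^\<alpha>).\<close>
  define A where "A = 8 * ln D"
  have A: "0 \<le> A" using D by (simp add: A_def)
  have e: "0 < q / 2" using q by simp
  obtain C where C: "0 < C" and decay: "\<And>(x::real^'d) y \<rho>. 1 \<le> \<rho> \<Longrightarrow> \<rho> \<le> 2 + norm x + norm y \<Longrightarrow> 1 + norm x + norm y \<le> \<rho> \<Longrightarrow>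
    far_kernel \<alpha> c x y powr (q / 2) * exp (A * norm (x - y) * \<rho> powr \<alpha>) \<le> C * \<rho> powr (- (2 * real d + 2))"
    using far_kernel_decay[OF \<alpha> assms e A, of "2 * real d + 2"] by metis
  define T where "T = 19 ^ d * (\<Sum>n. 1 / (real n + 1)\<^sup>2)"
  show thesis
  proof (rule that)
    show "0 < C * D\<^sup>2 * max 1 T" using C D by simp
    fix x :: "real^'d"
    define Vx where "Vx = V (ccube x ((2 + norm x) powr (- \<alpha>) / 8))"
    have "S c x \<le> ennreal T * ennreal (C * D\<^sup>2 * Vx)"
      unfolding S_def T_def d_def
    proof (rule nn_integral_shells[OF _ \<alpha> norm_ge_zero[of x]])
      fix n and z :: "real^'d" and \<rho> :: real
      assume z: "z \<in> shell n" and \<rho>: "\<rho> = 2 + norm x + real n"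
      define r where "r = \<rho> powr (- \<alpha>) / 8"
      have \<rho>0: "0 < \<rho>" "1 \<le> \<rho>" using \<rho> norm_ge_zero[of x] by linarith+
      have r: "0 < r" using \<rho>0 by (simp add: r_def)
      have half: "1 / 2 * \<rho> powr (- \<alpha>) = 4 * r" by (simp add: r_def)
      have nz: "1 + norm z \<le> \<rho>" using z \<rho> by (simp add: shell_def) (smt (verit) norm_ge_zero)
      have nx: "1 + norm x \<le> \<rho>" using \<rho> by simp
      have Gz: "G (ccube z r)" by (rule good_ccube[OF nz r]) (use r half in simp)
      have Gx: "G (ccube x r)" by (rule good_ccube[OF nx r]) (use r half in simp)
      have Vz: "0 < V (ccube z r)" "(\<integral>\<^sup>+y\<in>ccube z r. ennreal (\<sigma> y) \<partial>lebesgue) = ennreal (V (ccube z r))"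
        using WV[of "2 * r"] Gz r unfolding ccube_def by auto
      \<comment> \<open>The chain uses the radius r, which shrinks with the shell; passing to the
        larger radius \<open>rx\<close> makes the cube around x independent of the shell.\<close>
      define rx where "rx = (2 + norm x) powr (- \<alpha>) / 8"
      have "r \<le> rx" unfolding r_def rx_def using \<rho> \<alpha> by (intro divide_right_mono powr_mono2') (auto intro: add_pos_nonneg)
      have rx: "0 < rx" unfolding rx_def using norm_ge_zero[of x] by (simp add: add_nonneg_eq_0_iff)
      have "G (ccube x rx)" by (rule good_ccube[of x "2 + norm x"]) (use rx in \<open>auto simp: rx_def\<close>)
      then have Vxr: "V (ccube x r) \<le> Vx"
        using WV_mono(2)[of "2 * rx" "\<chi> i. x $ i - rx" "2 * r" "\<chi> i. x $ i - r"] Gx r rx \<open>r \<le> rx\<close>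
        unfolding Vx_def rx_def[symmetric] ccube_def[symmetric] by (auto simp: mem_ccube subset_iff) (smt (verit))
      \<comment> \<open>One factor D moves from the cell centre z to y, the other comes from the
        summand 1 in the exponent of \<open>chain\<close>.\<close>
      have ptw: "far_kernel \<alpha> c x y powr (q / 2) \<le> C * \<rho> powr (- (2 * real d + 2)) * D\<^sup>2 * Vx / V (ccube z r)"
        if y: "y \<in> shell n" "y \<in> ccube z r" for y
      proof -
        have ny: "1 + norm y \<le> \<rho>" "\<rho> \<le> 2 + norm x + norm y" "1 + norm x + norm y \<le> \<rho>"
          using y(1) \<rho> norm_ge_zero[of x] unfolding shell_def mem_Collect_eq by linarith+
        have "V (ccube z r) \<le> D * V (ccube y r)"
        proof (rule adjacent[OF ny(1) r_def])
          show "\<bar>z $ i - y $ i\<bar> \<le> r" for i using y(2) unfolding mem_ccube by (smt (verit))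
        qed
        also have "\<dots> \<le> D * (D powr (1 + norm (x - y) / r) * V (ccube x r))"
          using D by (intro mult_left_mono chain[OF nx ny(1) r_def]) simp
        also have "D powr (1 + norm (x - y) / r) = D * exp (A * norm (x - y) * \<rho> powr \<alpha>)"
        proof -
          have "norm (x - y) / r = 8 * norm (x - y) * \<rho> powr \<alpha>"
            by (simp add: r_def powr_minus field_simps)
          moreover have "D powr (1 + norm (x - y) / r) = D * exp (norm (x - y) / r * ln D)"
            using D by (simp only: powr_add) (simp add: powr_def)
          ultimately show ?thesis by (simp add: A_def mult_ac)
        qed
        also have "D * (D * exp (A * norm (x - y) * \<rho> powr \<alpha>) * V (ccube x r)) \<le>
            D * (D * exp (A * norm (x - y) * \<rho> powr \<alpha>) * Vx)"
          using Vxr D by (intro mult_left_mono) auto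
        finally have "far_kernel \<alpha> c x y powr (q / 2) * V (ccube z r) \<le>
            far_kernel \<alpha> c x y powr (q / 2) * (D * (D * exp (A * norm (x - y) * \<rho> powr \<alpha>) * Vx))"
          by (rule mult_left_mono) simp
        also have "\<dots> = (far_kernel \<alpha> c x y powr (q / 2) * exp (A * norm (x - y) * \<rho> powr \<alpha>)) * (D\<^sup>2 * Vx)"
          by (simp only: power2_eq_square mult_ac)
        also have "\<dots> \<le> (C * \<rho> powr (- (2 * real d + 2))) * (D\<^sup>2 * Vx)"
          using D by (intro mult_right_mono decay \<rho>0 ny) (auto simp: Vx_def V_nonneg)
        finally show ?thesis using Vz by (simp add: pos_le_divide_eq mult.assoc)
      qed
      define X where "X = C * \<rho> powr (- (2 * real d + 2)) * D\<^sup>2 * Vx / V (ccube z r)"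
      have X: "0 \<le> X" using C D Vz by (simp add: X_def Vx_def V_nonneg)
      have "(\<integral>\<^sup>+y\<in>shell n \<inter> ccube z (\<rho> powr (- \<alpha>) / 8). ennreal (far_kernel \<alpha> c x y powr (q / 2)) * ennreal (\<sigma> y) \<partial>lebesgue) \<le>
          (\<integral>\<^sup>+y. ennreal X * (ennreal (\<sigma> y) * indicator (ccube z r) y) \<partial>lebesgue)"
        unfolding r_def[symmetric] using ptw unfolding X_def[symmetric]
        by (intro nn_integral_mono) (auto split: split_indicator intro!: mult_right_mono ennreal_leI)
      also have "\<dots> = ennreal X * (\<integral>\<^sup>+y\<in>ccube z r. ennreal (\<sigma> y) \<partial>lebesgue)"
        by (rule nn_integral_cmult) measurable
      also have "\<dots> = ennreal (X * V (ccube z r))"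
        unfolding Vz using X by (simp add: ennreal_mult V_nonneg)
      also have "X * V (ccube z r) = \<rho> powr (- (2 * real d + 2)) * (C * D\<^sup>2 * Vx)"
        unfolding X_def using Vz by (simp add: mult_ac)
      also have "ennreal \<dots> = ennreal (\<rho> powr (- (2 * real d + 2))) * ennreal (C * D\<^sup>2 * Vx)"
        by (rule ennreal_mult') simp
      finally show "(\<integral>\<^sup>+y\<in>shell n \<inter> ccube z (\<rho> powr (- \<alpha>) / 8). ennreal (far_kernel \<alpha> c x y powr (q / 2)) * ennreal (\<sigma> y) \<partial>lebesgue) \<le>
        ennreal (\<rho> powr (- (2 * real CARD('d) + 2))) * ennreal (C * D\<^sup>2 * Vx)" unfolding d_def .
    qed measurable
    also have "\<dots> \<le> ennreal (max 1 T) * ennreal (C * D\<^sup>2 * Vx)"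
      by (intro mult_right_mono ennreal_leI) auto
    also have "\<dots> = ennreal (C * D\<^sup>2 * max 1 T * Vx)"
      using C D by (simp add: mult_ac Vx_def V_nonneg flip: ennreal_mult)
    finally show "S c x \<le> ennreal (C * D\<^sup>2 * max 1 T * V (ccube x ((2 + norm x) powr (- \<alpha>) / 8)))"
      unfolding Vx_def .
  qed
qed

lemma far_dual_bound:
  assumes "0 < c"
  obtains C where "0 < C" "\<And>y. (\<integral>\<^sup>+x. ennreal (far_kernel \<alpha> c x y powr (p / 2)) * (ennreal (\<omega> x) * enn_powr (S c x) (p - 1)) \<partial>lebesgue) \<le> ennreal C"
proof -
  define d where "d = CARD('d)"
  obtain CS where CS: "0 < CS" "\<And>x. S c x \<le> ennreal (CS * V (ccube x ((2 + norm x) powr (- \<alpha>) / 8)))"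
    using S_bound[OF assms] by blast
  have e: "0 < p / 2" using p by simp
  obtain C where C: "0 < C" and decay: "\<And>(x::real^'d) y \<rho>. 1 \<le> \<rho> \<Longrightarrow> \<rho> \<le> 2 + norm x + norm y \<Longrightarrow> 1 + norm x + norm y \<le> \<rho> \<Longrightarrow>
    far_kernel \<alpha> c x y powr (p / 2) * exp (0 * norm (x - y) * \<rho> powr \<alpha>) \<le> C * \<rho> powr (- (2 * real d + 2))"
    using far_kernel_decay[OF \<alpha> assms e order_refl, of "2 * real d + 2"] by metis
  define T where "T = 19 ^ d * (\<Sum>n. 1 / (real n + 1)\<^sup>2)"
  define B where "B = C * CS powr (p - 1) * K"
  have B: "0 < B" using C CS K by (simp add: B_def)
  show thesis
  proof (rule that)
    show "0 < max 1 T * B" using B by simp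
    fix y :: "real^'d"
    have "(\<integral>\<^sup>+x. ennreal (far_kernel \<alpha> c x y powr (p / 2)) * (ennreal (\<omega> x) * enn_powr (S c x) (p - 1)) \<partial>lebesgue) \<le> ennreal T * ennreal B"
      unfolding T_def d_def
    proof (rule nn_integral_shells[OF _ \<alpha> norm_ge_zero[of y]])
      fix n and z :: "real^'d" and \<rho> :: real
      assume z: "z \<in> shell n" and \<rho>: "\<rho> = 2 + norm y + real n"
      have \<rho>0: "1 \<le> \<rho>" using \<rho> by (auto intro: add_pos_nonneg)
      \<comment> \<open>A radius depending on the shell of x but not on y: it bounds both the cell
        radius and the radius of the cube from \<open>S_bound\<close>, so
        \<open>ccube z (2 * h)\<close> contains both cubes. Its side 4 h is at most 1, hence the
        volume factor of A_p is at most 1.\<close>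
      define h where "h = (2 + real n) powr (- \<alpha>) / 8"
      have h: "0 < h" by (simp add: h_def)
      have "(2 + real n) powr (- \<alpha>) \<le> 1 powr (- \<alpha>)" using \<alpha> by (intro powr_mono2') auto
      then have h1: "4 * h \<le> 1" by (simp add: h_def)
      have rh: "\<rho> powr (- \<alpha>) / 8 \<le> h"
        unfolding h_def using \<rho> \<alpha> by (intro divide_right_mono powr_mono2') auto
      have nz: "1 + norm z \<le> 2 + real n" using z by (simp add: shell_def)
      have GP: "G (ccube z (2 * h))" by (rule good_ccube[OF nz]) (use h in \<open>auto simp: h_def\<close>)
      define w v where "w = W (ccube z (2 * h))" and "v = V (ccube z (2 * h))"
      have wv: "0 < w" "0 < v" "(\<integral>\<^sup>+x\<in>ccube z (2 * h). ennreal (\<omega> x) \<partial>lebesgue) = ennreal w"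
        "w * v powr (p - 1) \<le> K * ((4 * h) ^ CARD('d)) powr p"
        using WV[of "2 * (2 * h)"] GP h unfolding w_def v_def ccube_def by auto
      have "((4 * h) ^ CARD('d)) powr p \<le> 1 powr p"
        using p h h1 by (intro powr_mono2 power_le_one) auto
      then have "K * ((4 * h) ^ CARD('d)) powr p \<le> K * 1"
        using K by (intro mult_left_mono) auto
      then have wvK: "w * v powr (p - 1) \<le> K" using wv(4) by linarith
      define X where "X = C * \<rho> powr (- (2 * real d + 2)) * (CS * v) powr (p - 1)"
      have X: "0 \<le> X" using C by (simp add: X_def)
      have ptw: "ennreal (far_kernel \<alpha> c x y powr (p / 2)) * (ennreal (\<omega> x) * enn_powr (S c x) (p - 1)) \<le> ennreal X * ennreal (\<omega> x)"
        if x: "x \<in> shell n" "x \<in> ccube z (\<rho> powr (- \<alpha>) / 8)" for x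
      proof -
        define rx where "rx = (2 + norm x) powr (- \<alpha>) / 8"
        have rx: "0 < rx" unfolding rx_def using norm_ge_zero[of x] by (simp add: add_nonneg_eq_0_iff)
        have "rx \<le> h" unfolding h_def rx_def using x(1) \<alpha> by (intro divide_right_mono powr_mono2') (auto simp: shell_def)
        have "G (ccube x rx)" by (rule good_ccube[of x "2 + norm x"]) (use rx in \<open>auto simp: rx_def\<close>)
        moreover have "ccube x rx \<subseteq> ccube z (2 * h)"
        proof
          fix u assume u: "u \<in> ccube x rx"
          show "u \<in> ccube z (2 * h)" unfolding mem_ccube
          proof
            fix i show "z $ i - 2 * h \<le> u $ i \<and> u $ i < z $ i + 2 * h"
              using u x(2) rh \<open>rx \<le> h\<close> unfolding mem_ccube by (smt (verit))
          qed
        qed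
        ultimately have "V (ccube x rx) \<le> v"
          using WV_mono(2)[of "2 * (2 * h)" "\<chi> i. z $ i - 2 * h" "2 * rx" "\<chi> i. x $ i - rx"] GP h rx
          unfolding v_def ccube_def by simp
        then have "CS * V (ccube x rx) \<le> CS * v" using CS(1) by (intro mult_left_mono) auto
        then have "S c x \<le> ennreal (CS * v)"
          using CS(2)[of x] unfolding rx_def[symmetric] by (meson ennreal_leI order_trans)
        then have "enn_powr (S c x) (p - 1) \<le> enn_powr (ennreal (CS * v)) (p - 1)"
          using p by (intro enn_powr_mono) auto
        also have "\<dots> = ennreal ((CS * v) powr (p - 1))" using CS wv by (simp add: enn_powr_ennreal)
        finally have 1: "enn_powr (S c x) (p - 1) \<le> ennreal ((CS * v) powr (p - 1))" .
        have "far_kernel \<alpha> c x y powr (p / 2) \<le> C * \<rho> powr (- (2 * real d + 2))"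
          using decay[of \<rho> x y] \<rho>0 \<rho> x(1) by (simp add: shell_def)
        then have "ennreal (far_kernel \<alpha> c x y powr (p / 2)) * (ennreal (\<omega> x) * enn_powr (S c x) (p - 1)) \<le>
            ennreal (C * \<rho> powr (- (2 * real d + 2))) * (ennreal (\<omega> x) * ennreal ((CS * v) powr (p - 1)))"
          using 1 by (intro mult_mono ennreal_leI) auto
        also have "\<dots> = ennreal X * ennreal (\<omega> x)"
          using C unfolding X_def by (simp add: ennreal_mult mult_ac)
        finally show ?thesis .
      qed
      have sub: "ccube z (\<rho> powr (- \<alpha>) / 8) \<subseteq> ccube z (2 * h)"
        using rh h unfolding mem_ccube subset_iff by (smt (verit))
      have "(\<integral>\<^sup>+x\<in>shell n \<inter> ccube z (\<rho> powr (- \<alpha>) / 8). ennreal (far_kernel \<alpha> c x y powr (p / 2)) * (ennreal (\<omega> x) * enn_powr (S c x) (p - 1)) \<partial>lebesgue) \<le>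
          (\<integral>\<^sup>+x. ennreal X * (ennreal (\<omega> x) * indicator (ccube z (2 * h)) x) \<partial>lebesgue)"
      proof (rule nn_integral_mono)
        fix x
        show "ennreal (far_kernel \<alpha> c x y powr (p / 2)) * (ennreal (\<omega> x) * enn_powr (S c x) (p - 1)) *
            indicator (shell n \<inter> ccube z (\<rho> powr (- \<alpha>) / 8)) x \<le> ennreal X * (ennreal (\<omega> x) * indicator (ccube z (2 * h)) x)"
        proof (cases "x \<in> shell n \<inter> ccube z (\<rho> powr (- \<alpha>) / 8)")
          case True
          then have "x \<in> ccube z (2 * h)" using sub by blast
          then show ?thesis using True ptw[of x] by simp
        qed simp
      qed
      also have "\<dots> = ennreal X * (\<integral>\<^sup>+x\<in>ccube z (2 * h). ennreal (\<omega> x) \<partial>lebesgue)"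
        by (rule nn_integral_cmult) measurable
      also have "\<dots> = ennreal (X * w)"
        unfolding wv using X wv by (simp add: ennreal_mult)
      also have "X * w = \<rho> powr (- (2 * real d + 2)) * (C * CS powr (p - 1) * (w * v powr (p - 1)))"
        unfolding X_def using CS wv by (simp add: powr_mult mult_ac)
      also have "ennreal \<dots> \<le> ennreal (\<rho> powr (- (2 * real d + 2)) * B)"
        unfolding B_def using wvK C by (intro ennreal_leI mult_left_mono) auto
      also have "\<dots> = ennreal (\<rho> powr (- (2 * real d + 2))) * ennreal B"
        by (rule ennreal_mult') simp
      finally show "(\<integral>\<^sup>+x\<in>shell n \<inter> ccube z (\<rho> powr (- \<alpha>) / 8). ennreal (far_kernel \<alpha> c x y powr (p / 2)) * (ennreal (\<omega> x) * enn_powr (S c x) (p - 1)) \<partial>lebesgue) \<le>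
        ennreal (\<rho> powr (- (2 * real CARD('d) + 2))) * ennreal B" unfolding d_def .
    qed measurable
    also have "\<dots> \<le> ennreal (max 1 T) * ennreal B"
      by (intro mult_right_mono ennreal_leI) auto
    also have "\<dots> = ennreal (max 1 T * B)"
      using B by (intro ennreal_mult[symmetric]) auto
    finally show "(\<integral>\<^sup>+x. ennreal (far_kernel \<alpha> c x y powr (p / 2)) * (ennreal (\<omega> x) * enn_powr (S c x) (p - 1)) \<partial>lebesgue) \<le> ennreal (max 1 T * B)" .
  qed
qed

text \<open>Schur test: Hoelder's inequality inside the integral, then exchange of the integrals,
  then \<open>far_dual_bound\<close> for the inner one.\<close>

theorem far_bound:
  assumes "0 < c"
  obtains C where "0 < C" "\<And>g. g \<in> borel_measurable lebesgue \<Longrightarrow>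
    (\<integral>\<^sup>+x. ennreal (\<omega> x) * enn_powr (\<integral>\<^sup>+y. ennreal (far_kernel \<alpha> c x y) * g y \<partial>lebesgue) p \<partial>lebesgue) \<le>
      ennreal C * (\<integral>\<^sup>+x. ennreal (\<omega> x) * enn_powr (g x) p \<partial>lebesgue)"
proof -
  obtain C where C: "0 < C" "\<And>y. (\<integral>\<^sup>+x. ennreal (far_kernel \<alpha> c x y powr (p / 2)) * (ennreal (\<omega> x) * enn_powr (S c x) (p - 1)) \<partial>lebesgue) \<le> ennreal C"
    using far_dual_bound[OF assms] by blast
  show thesis
  proof (rule that[OF C(1)])
    fix g :: "real^'d \<Rightarrow> ennreal" assume g [measurable]: "g \<in> borel_measurable lebesgue"
    define k where "k x y = far_kernel \<alpha> c x y" for x y :: "real^'d"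
    have k0: "0 \<le> k x y" for x y by (simp add: k_def far_kernel_nonneg)
    have [measurable]: "k x \<in> borel_measurable lebesgue" "(\<lambda>x. k x y) \<in> borel_measurable lebesgue" for x y
      unfolding k_def[abs_def] by measurable
    define h where "h y = ennreal (\<omega> y) * enn_powr (g y) p" for y
    have [measurable]: "h \<in> borel_measurable lebesgue" unfolding h_def[abs_def] by measurable
    \<comment> \<open>The factor \<omega>^(1/p) goes with g and its inverse with the other square
      root; the power q of that inverse is \<sigma> because q / p = 1 / (p - 1).\<close>
    have ptw: "enn_powr (\<integral>\<^sup>+y. ennreal (k x y) * g y \<partial>lebesgue) p \<le>
        (\<integral>\<^sup>+y. ennreal (k x y powr (p / 2)) * h y \<partial>lebesgue) * enn_powr (S c x) (p - 1)" for x
    proof -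
      have "(\<integral>\<^sup>+y. ennreal (k x y) * g y \<partial>lebesgue) =
          (\<integral>\<^sup>+y. (ennreal (k x y powr (1 / 2) * \<omega> y powr (1 / p)) * g y) * ennreal (k x y powr (1 / 2) * \<omega> y powr (- (1 / p))) \<partial>lebesgue)"
      proof (rule nn_integral_cong)
        fix y
        have "(k x y powr (1 / 2) * \<omega> y powr (1 / p)) * (k x y powr (1 / 2) * \<omega> y powr (- (1 / p))) =
            (k x y powr (1 / 2) * k x y powr (1 / 2)) * (\<omega> y powr (1 / p) * \<omega> y powr (- (1 / p)))"
          by (simp only: mult_ac)
        also have "\<dots> = k x y" using k0[of x y] \<omega>_pos[of y] by (simp add: less_imp_neq[symmetric] flip: powr_add)
        finally have "ennreal (k x y powr (1 / 2) * \<omega> y powr (1 / p)) * ennreal (k x y powr (1 / 2) * \<omega> y powr (- (1 / p))) = ennreal (k x y)"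
          by (simp flip: ennreal_mult)
        then show "ennreal (k x y) * g y = (ennreal (k x y powr (1 / 2) * \<omega> y powr (1 / p)) * g y) * ennreal (k x y powr (1 / 2) * \<omega> y powr (- (1 / p)))"
          by (metis mult.assoc mult.commute)
      qed
      also have "\<dots> \<le> enn_powr (\<integral>\<^sup>+y. enn_powr (ennreal (k x y powr (1 / 2) * \<omega> y powr (1 / p)) * g y) p \<partial>lebesgue) (1 / p) *
          enn_powr (\<integral>\<^sup>+y. enn_powr (ennreal (k x y powr (1 / 2) * \<omega> y powr (- (1 / p)))) q \<partial>lebesgue) (1 / q)"
        by (rule nn_integral_Holder[OF p q(2)]) measurable
      also have "(\<integral>\<^sup>+y. enn_powr (ennreal (k x y powr (1 / 2) * \<omega> y powr (1 / p)) * g y) p \<partial>lebesgue) =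
          (\<integral>\<^sup>+y. ennreal (k x y powr (p / 2)) * h y \<partial>lebesgue)"
        using p k0 \<omega>_pos unfolding h_def
        by (intro nn_integral_cong)
          (simp add: enn_powr_mult enn_powr_ennreal powr_mult powr_powr ennreal_mult less_imp_le mult.assoc)
      also have "(\<integral>\<^sup>+y. enn_powr (ennreal (k x y powr (1 / 2) * \<omega> y powr (- (1 / p)))) q \<partial>lebesgue) = S c x"
        using q(1) q(4) k0 \<omega>_pos unfolding S_def k_def[symmetric] \<sigma>_def
        by (intro nn_integral_cong) (simp add: enn_powr_mult enn_powr_ennreal powr_mult powr_powr ennreal_mult less_imp_le)
      finally have "enn_powr (\<integral>\<^sup>+y. ennreal (k x y) * g y \<partial>lebesgue) p \<le>
          enn_powr (enn_powr (\<integral>\<^sup>+y. ennreal (k x y powr (p / 2)) * h y \<partial>lebesgue) (1 / p) * enn_powr (S c x) (1 / q)) p"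
        using p by (intro enn_powr_mono) auto
      also have "\<dots> = (\<integral>\<^sup>+y. ennreal (k x y powr (p / 2)) * h y \<partial>lebesgue) * enn_powr (S c x) (p - 1)"
        using p q(3) by (simp add: enn_powr_mult enn_powr_powr)
      finally show ?thesis .
    qed
    define \<Psi> where "\<Psi> x y = (ennreal (k x y powr (p / 2)) * (ennreal (\<omega> x) * enn_powr (S c x) (p - 1))) * h y" for x y
    have meas: "(\<lambda>(x, y). \<Psi> x y) \<in> borel_measurable (lebesgue \<Otimes>\<^sub>M lebesgue)"
      unfolding \<Psi>_def k_def case_prod_unfold by measurable
    have "(\<integral>\<^sup>+x. ennreal (\<omega> x) * enn_powr (\<integral>\<^sup>+y. ennreal (k x y) * g y \<partial>lebesgue) p \<partial>lebesgue) \<le>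
        (\<integral>\<^sup>+x. (\<integral>\<^sup>+y. \<Psi> x y \<partial>lebesgue) \<partial>lebesgue)"
    proof (rule nn_integral_mono)
      fix x
      have "ennreal (\<omega> x) * enn_powr (\<integral>\<^sup>+y. ennreal (k x y) * g y \<partial>lebesgue) p \<le>
          ennreal (\<omega> x) * ((\<integral>\<^sup>+y. ennreal (k x y powr (p / 2)) * h y \<partial>lebesgue) * enn_powr (S c x) (p - 1))"
        by (intro mult_left_mono ptw) simp
      also have "\<dots> = (ennreal (\<omega> x) * enn_powr (S c x) (p - 1)) * (\<integral>\<^sup>+y. ennreal (k x y powr (p / 2)) * h y \<partial>lebesgue)"
        by (simp only: mult_ac)
      also have "\<dots> = (\<integral>\<^sup>+y. (ennreal (\<omega> x) * enn_powr (S c x) (p - 1)) * (ennreal (k x y powr (p / 2)) * h y) \<partial>lebesgue)"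
        by (rule nn_integral_cmult[symmetric]) measurable
      also have "\<dots> = (\<integral>\<^sup>+y. \<Psi> x y \<partial>lebesgue)"
        unfolding \<Psi>_def by (simp only: mult_ac)
      finally show "ennreal (\<omega> x) * enn_powr (\<integral>\<^sup>+y. ennreal (k x y) * g y \<partial>lebesgue) p \<le> (\<integral>\<^sup>+y. \<Psi> x y \<partial>lebesgue)" .
    qed
    also have "\<dots> = (\<integral>\<^sup>+y. (\<integral>\<^sup>+x. \<Psi> x y \<partial>lebesgue) \<partial>lebesgue)"
      by (rule pair_sigma_finite.Fubini'[OF pair_sigma_finite_lebesgue meas, symmetric])
    also have "\<dots> \<le> (\<integral>\<^sup>+y. ennreal C * h y \<partial>lebesgue)"
    proof (rule nn_integral_mono)
      fix y
      have "(\<integral>\<^sup>+x. \<Psi> x y \<partial>lebesgue) =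
          (\<integral>\<^sup>+x. ennreal (k x y powr (p / 2)) * (ennreal (\<omega> x) * enn_powr (S c x) (p - 1)) \<partial>lebesgue) * h y"
        unfolding \<Psi>_def by (rule nn_integral_multc) measurable
      also have "\<dots> \<le> ennreal C * h y"
        unfolding k_def by (intro mult_right_mono C) simp
      finally show "(\<integral>\<^sup>+x. \<Psi> x y \<partial>lebesgue) \<le> ennreal C * h y" .
    qed
    also have "\<dots> = ennreal C * (\<integral>\<^sup>+y. h y \<partial>lebesgue)"
      by (rule nn_integral_cmult) measurable
    finally show "(\<integral>\<^sup>+x. ennreal (\<omega> x) * enn_powr (\<integral>\<^sup>+y. ennreal (far_kernel \<alpha> c x y) * g y \<partial>lebesgue) p \<partial>lebesgue) \<le>
      ennreal C * (\<integral>\<^sup>+x. ennreal (\<omega> x) * enn_powr (g x) p \<partial>lebesgue)"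
      unfolding k_def h_def .
  qed
qed

end

section \<open>Pointwise bounds for the Mehler kernel\<close>

text \<open>With s = (1 - r) / (1 + r) and r = exp (-t), conjugation by the square root of the Gaussian turns
  the kernel into the symmetric Mehler kernel.\<close>

lemma Mehler_exponent:
  fixes x y :: "'a::real_inner" and r :: real
  assumes "0 < r" "r < 1" and s: "s = (1 - r) / (1 + r)"
  shows "(norm (r *\<^sub>R x - y))\<^sup>2 / (1 - r\<^sup>2) + (norm x)\<^sup>2 / 2 =
    ((norm (x - y))\<^sup>2 / s + s * (norm (x + y))\<^sup>2) / 4 + (norm y)\<^sup>2 / 2"
proof -
  define X Y Z where "X = x \<bullet> x" and "Y = y \<bullet> y" and "Z = x \<bullet> y"
  have n: "(norm (r *\<^sub>R x - y))\<^sup>2 = r\<^sup>2 * X - 2 * r * Z + Y" "(norm x)\<^sup>2 = X" "(norm y)\<^sup>2 = Y"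
    "(norm (x - y))\<^sup>2 = X - 2 * Z + Y" "(norm (x + y))\<^sup>2 = X + 2 * Z + Y"
    unfolding power2_norm_eq_inner X_def Y_def Z_def
    by (simp_all add: power2_eq_square inner_commute algebra_simps)
  \<comment> \<open>In these variables s = u / v and 1 - r^2 = u v, so clearing denominators leaves
    a polynomial identity.\<close>
  define u v where "u = 1 - r" and "v = 1 + r"
  have uv: "u \<noteq> 0" "v \<noteq> 0" "1 - r\<^sup>2 = u * v" "s = u / v"
    using assms by (auto simp: u_def v_def power2_eq_square algebra_simps)
  have r: "r = (v - u) / 2" "u + v = 2" by (auto simp: u_def v_def)
  have "(r\<^sup>2 * X - 2 * r * Z + Y) / (u * v) + X / 2 - (((X - 2 * Z + Y) / (u / v) + (u / v) * (X + 2 * Z + Y)) / 4 + Y / 2)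
     = (4 * (r\<^sup>2 * X - 2 * r * Z + Y) + 2 * u * v * X - (v\<^sup>2 * (X - 2 * Z + Y) + u\<^sup>2 * (X + 2 * Z + Y) + 2 * u * v * Y)) / (4 * u * v)"
    using uv(1,2) by (simp add: field_simps power2_eq_square)
  also have "4 * (r\<^sup>2 * X - 2 * r * Z + Y) + 2 * u * v * X - (v\<^sup>2 * (X - 2 * Z + Y) + u\<^sup>2 * (X + 2 * Z + Y) + 2 * u * v * Y) = 0"
    unfolding u_def v_def by algebra
  finally show ?thesis unfolding n uv(3,4) by simp
qed

text \<open>Half of the term |x - y|^2 / (4 s) is kept for the near part. With A = |x - y| and B =
  |x + y|, the rest Q is at least A^2 / 8 and, by completing a square, at least A B / 4; as |x| +
  |y| <= A + B, it controls A (|x| + |y|) uniformly in s. Replacing |x| + |y| by 2 + |x| + |y| uses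
  2 A <= 1 + A^2 and costs the 1/32.\<close>

lemma Mehler_exponent_ge:
  fixes x y :: "'a::real_inner" and s :: real
  assumes s: "0 < s" "s \<le> 1"
  shows "(norm (x - y))\<^sup>2 / (8 * s) + norm (x - y) * (2 + norm x + norm y) / 32 - 1 / 32 \<le>
    ((norm (x - y))\<^sup>2 / s + s * (norm (x + y))\<^sup>2) / 4"
proof -
  define A B n where "A = norm (x - y)" and "B = norm (x + y)" and "n = norm x + norm y"
  have AB: "0 \<le> A" "0 \<le> B" by (simp_all add: A_def B_def)
  have nAB: "n \<le> A + B"
  proof -
    have "norm (2 *\<^sub>R x) \<le> B + A" "norm (2 *\<^sub>R y) \<le> B + A"
      using norm_triangle_ineq[of "x + y" "x - y"] norm_triangle_ineq4[of "x + y" "x - y"]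
      by (simp_all add: A_def B_def scaleR_2)
    then show ?thesis by (simp add: n_def)
  qed
  have An: "A \<le> n" using norm_triangle_ineq4[of x y] by (simp add: A_def n_def)
  define Q where "Q = A\<^sup>2 / (8 * s) + s * B\<^sup>2 / 4"
  have "A\<^sup>2 / 8 / 1 \<le> A\<^sup>2 / 8 / s" using s by (intro divide_left_mono) auto
  then have Q1: "A\<^sup>2 / 8 \<le> Q" using s by (simp add: Q_def mult.commute) (smt (verit) mult_nonneg_nonneg zero_le_power2)
  have "Q - A * B / 4 = ((A - s * B)\<^sup>2 + s\<^sup>2 * B\<^sup>2) / (8 * s)"
    using s by (simp add: Q_def field_simps power2_eq_square)
  also have "\<dots> \<ge> 0" using s by simp
  finally have Q2: "A * B / 4 \<le> Q" by simp
  have "A * n \<le> A\<^sup>2 + A * B" using mult_left_mono[OF nAB AB(1)] by (simp add: power2_eq_square distrib_left)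
  then have Q3: "A * n / 16 \<le> Q" using Q1 Q2 zero_le_power2[of A] by linarith
  have "A * A \<le> A * n" using An AB by (intro mult_left_mono) auto
  moreover have "2 * A \<le> 1 + A * A" using zero_le_power2[of "A - 1"] by (simp add: power2_eq_square algebra_simps)
  ultimately have "A * (2 + n) \<le> 2 * (A * n) + 1" by (simp add: distrib_left)
  then have "A * (2 + n) / 32 - 1 / 32 \<le> Q" using Q3 by linarith
  moreover have "(A\<^sup>2 / s + s * B\<^sup>2) / 4 = A\<^sup>2 / (8 * s) + Q"
    using s by (simp add: Q_def field_simps)
  ultimately show ?thesis unfolding A_def B_def n_def by (simp add: add.assoc)
qed

text \<open>Here \<tau> is the square root of s. The prefactor is at most \<tau>^(-d) because 1 -
  r^2 = s (1 + r)^2 >= s, and the factor 2 absorbs exp (1/32).\<close>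

lemma OU_kernel_le:
  assumes "0 < t"
  obtains \<tau> where "0 < \<tau>" "\<And>x y :: real^'d. OU_kernel t x y * exp (- ((norm x)\<^sup>2 / 2)) \<le>
    2 * (exp (- ((norm (x - y) / \<tau>)\<^sup>2 / 8)) / \<tau> ^ CARD('d)) *
      exp (- (norm (x - y) * (2 + norm x + norm y) / 32)) * exp (- ((norm y)\<^sup>2 / 2))"
proof -
  define r s where "r = exp (- t)" and "s = (1 - r) / (1 + r)"
  have r: "0 < r" "r < 1" using assms by (auto simp: r_def)
  have s: "0 < s" "s \<le> 1" using r by (auto simp: s_def)
  have r2: "exp (- 2 * t) = r\<^sup>2" by (simp add: r_def power2_eq_square flip: exp_add)
  define \<tau> where "\<tau> = sqrt s"
  have \<tau>: "0 < \<tau>" "\<tau>\<^sup>2 = s" using s by (auto simp: \<tau>_def)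
  have "1 - r\<^sup>2 = s * (1 + r)\<^sup>2" using r by (simp add: s_def power2_eq_square field_simps)
  moreover have "s * 1 \<le> s * (1 + r)\<^sup>2" using s r by (intro mult_left_mono one_le_power) auto
  ultimately have s1: "s \<le> 1 - r\<^sup>2" by simp
  have "1 * s \<le> pi * (1 - r\<^sup>2)" using s s1 pi_gt3 by (intro mult_mono) auto
  then have "1 / (pi * (1 - r\<^sup>2)) \<le> 1 / s" using s by (intro divide_left_mono) auto
  then have "(1 / (pi * (1 - r\<^sup>2))) powr (real CARD('d) / 2) \<le> (1 / s) powr (real CARD('d) / 2)"
    using s s1 by (intro powr_mono2) auto
  also have "(1 / s) powr (real CARD('d) / 2) = ((1 / s) powr (1 / 2)) powr (real CARD('d))"
    by (simp add: powr_powr)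
  also have "(1 / s) powr (1 / 2) = 1 / \<tau>" using s by (simp add: powr_half_sqrt real_sqrt_divide \<tau>_def)
  also have "(1 / \<tau>) powr (real CARD('d)) = 1 / \<tau> ^ CARD('d)"
    using \<tau> by (simp add: powr_realpow power_divide)
  finally have pre: "(1 / (pi * (1 - r\<^sup>2))) powr (real CARD('d) / 2) \<le> 1 / \<tau> ^ CARD('d)" .
  show thesis
  proof (rule that[OF \<tau>(1)])
    fix x y :: "real^'d"
    define E where "E = ((norm (x - y))\<^sup>2 / s + s * (norm (x + y))\<^sup>2) / 4"
    have "OU_kernel t x y * exp (- ((norm x)\<^sup>2 / 2)) =
        (1 / (pi * (1 - r\<^sup>2))) powr (real CARD('d) / 2) * exp (- ((norm (r *\<^sub>R x - y))\<^sup>2 / (1 - r\<^sup>2) + (norm x)\<^sup>2 / 2))"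
      unfolding OU_kernel_def r2 r_def[symmetric]
      by (simp add: mult.assoc exp_add[symmetric])
    also have "\<dots> = (1 / (pi * (1 - r\<^sup>2))) powr (real CARD('d) / 2) * exp (- (E + (norm y)\<^sup>2 / 2))"
      unfolding E_def Mehler_exponent[OF r s_def] ..
    also have "\<dots> \<le> 1 / \<tau> ^ CARD('d) * exp (1 / 32 - (norm (x - y))\<^sup>2 / (8 * s) - norm (x - y) * (2 + norm x + norm y) / 32 - (norm y)\<^sup>2 / 2)"
    proof (intro mult_mono pre)
      have "(norm (x - y))\<^sup>2 / (8 * s) + norm (x - y) * (2 + norm x + norm y) / 32 - 1 / 32 \<le> E"
        unfolding E_def by (rule Mehler_exponent_ge[OF s])
      then have "- (E + (norm y)\<^sup>2 / 2) \<le>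
          1 / 32 - (norm (x - y))\<^sup>2 / (8 * s) - norm (x - y) * (2 + norm x + norm y) / 32 - (norm y)\<^sup>2 / 2"
        by linarith
      then show "exp (- (E + (norm y)\<^sup>2 / 2)) \<le>
          exp (1 / 32 - (norm (x - y))\<^sup>2 / (8 * s) - norm (x - y) * (2 + norm x + norm y) / 32 - (norm y)\<^sup>2 / 2)"
        by (simp only: exp_le_cancel_iff)
    qed (use \<tau> in auto)
    also have "exp (1 / 32 - (norm (x - y))\<^sup>2 / (8 * s) - norm (x - y) * (2 + norm x + norm y) / 32 - (norm y)\<^sup>2 / 2) =
        exp (1 / 32) * (exp (- ((norm (x - y))\<^sup>2 / (8 * s))) * exp (- (norm (x - y) * (2 + norm x + norm y) / 32)) * exp (- ((norm y)\<^sup>2 / 2)))"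
      by (simp only: exp_add[symmetric] diff_conv_add_uminus add.assoc)
    also have "\<dots> \<le> 2 * (exp (- ((norm (x - y))\<^sup>2 / (8 * s))) * exp (- (norm (x - y) * (2 + norm x + norm y) / 32)) * exp (- ((norm y)\<^sup>2 / 2)))"
    proof (intro mult_right_mono)
      have "exp (1 / 32 :: real) \<le> 1 + 1 / 32 + (1 / 32)\<^sup>2" by (rule exp_bound) auto
      then show "exp (1 / 32 :: real) \<le> 2" by (simp add: power2_eq_square)
    qed simp
    also have "(norm (x - y))\<^sup>2 / (8 * s) = (norm (x - y) / \<tau>)\<^sup>2 / 8"
      using \<tau>(2) by (simp add: power_divide)
    finally show "OU_kernel t x y * exp (- ((norm x)\<^sup>2 / 2)) \<le>
      2 * (exp (- ((norm (x - y) / \<tau>)\<^sup>2 / 8)) / \<tau> ^ CARD('d)) *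
      exp (- (norm (x - y) * (2 + norm x + norm y) / 32)) * exp (- ((norm y)\<^sup>2 / 2))"
      using \<tau>(1) by (simp add: mult_left_mono divide_right_mono)
  qed
qed

text \<open>Beyond the local scale the Gaussian is traded for d powers of \<tau> / |x - y|, which
  cancel \<tau>^(-d). Since |x - y| >= c (1 + |x|)^(-\<alpha>) >= c / \<rho> with \<rho> = 2 + |x| +
  |y|, what remains is a polynomial in \<rho>.\<close>

lemma OU_kernel_near_far:
  assumes "0 \<le> \<alpha>" "\<alpha> < 1" "0 < t" "0 < c"
  obtains \<tau> where "0 < \<tau>" "\<And>x y :: real^'d. OU_kernel t x y * exp (- ((norm x)\<^sup>2 / 2)) \<le>
    2 * ((if norm (x - y) < c * (1 + norm x) powr (- \<alpha>) then exp (- ((norm (x - y) / \<tau>)\<^sup>2 / 8)) / \<tau> ^ CARD('d) else 0) +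
      (1 + 8 ^ CARD('d) * fact CARD('d)) / c ^ CARD('d) * far_kernel \<alpha> c x y) * exp (- ((norm y)\<^sup>2 / 2))"
proof -
  define d where "d = CARD('d)"
  obtain \<tau> where \<tau>: "0 < \<tau>" and le: "\<And>x y :: real^'d. OU_kernel t x y * exp (- ((norm x)\<^sup>2 / 2)) \<le>
    2 * (exp (- ((norm (x - y) / \<tau>)\<^sup>2 / 8)) / \<tau> ^ d) *
      exp (- (norm (x - y) * (2 + norm x + norm y) / 32)) * exp (- ((norm y)\<^sup>2 / 2))"
    using OU_kernel_le[OF assms(3)] unfolding d_def by metis
  show thesis
  proof (rule that[OF \<tau>])
    fix x y :: "real^'d"
    define A \<rho> C where "A = norm (x - y)" and "\<rho> = 2 + norm x + norm y" and "C = (1 + 8 ^ d * fact d) / c ^ d"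
    have C: "0 < C" using assms by (simp add: C_def add_pos_nonneg)
    have "(exp (- ((A / \<tau>)\<^sup>2 / 8)) / \<tau> ^ d) * exp (- (A * \<rho> / 32)) \<le>
      (if A < c * (1 + norm x) powr (- \<alpha>) then exp (- ((A / \<tau>)\<^sup>2 / 8)) / \<tau> ^ d else 0) + C * far_kernel \<alpha> c x y"
    proof (cases "A < c * (1 + norm x) powr (- \<alpha>)")
      case True
      have "exp (- (A * \<rho> / 32)) \<le> 1" by (simp add: A_def \<rho>_def)
      then have "(exp (- ((A / \<tau>)\<^sup>2 / 8)) / \<tau> ^ d) * exp (- (A * \<rho> / 32)) \<le> (exp (- ((A / \<tau>)\<^sup>2 / 8)) / \<tau> ^ d) * 1"
        using \<tau> by (intro mult_left_mono) auto
      then show ?thesis using True C far_kernel_nonneg[of \<alpha> c x y] by (simp add: add_increasing2)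
    next
      case False
      have x1: "0 < 1 + norm x" "1 \<le> 1 + norm x" using norm_ge_zero[of x] by linarith+
      have "1 + norm x \<noteq> 0" using x1 by linarith
      then have low: "0 < c * (1 + norm x) powr (- \<alpha>)" using assms by simp
      then have A: "0 < A" using False by linarith
      have "c / \<rho> \<le> c * (1 + norm x) powr (- \<alpha>)"
      proof -
        have "(1 + norm x) powr \<alpha> \<le> (1 + norm x) powr 1" using assms x1 by (intro powr_mono) auto
        also have "\<dots> \<le> \<rho>" using x1 by (simp add: \<rho>_def)
        finally have le: "(1 + norm x) powr \<alpha> \<le> \<rho>" .
        have "0 < (1 + norm x) powr \<alpha>" using \<open>1 + norm x \<noteq> 0\<close> by simp
        then have "c / \<rho> \<le> c / (1 + norm x) powr \<alpha>"
          using le assms by (intro divide_left_mono mult_pos_pos) linarith+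
        then show ?thesis by (simp add: powr_minus_divide)
      qed
      then have cA: "c / \<rho> \<le> A" using False by linarith
      have \<rho>: "0 < \<rho>" by (simp add: \<rho>_def add_pos_nonneg)
      have "exp (- ((A / \<tau>)\<^sup>2 / 8)) / \<tau> ^ d \<le> (1 + 8 ^ d * fact d) / (A / \<tau>) ^ d / \<tau> ^ d"
        using A \<tau> by (intro divide_right_mono exp_neg_square_le) auto
      also have "\<dots> = (1 + 8 ^ d * fact d) / A ^ d" using A \<tau> by (simp add: power_divide)
      also have "\<dots> \<le> (1 + 8 ^ d * fact d) / (c / \<rho>) ^ d"
        using cA A assms \<rho> by (intro divide_left_mono power_mono) auto
      also have "\<dots> = C * \<rho> ^ d" using assms by (simp add: C_def power_divide)
      finally have "(exp (- ((A / \<tau>)\<^sup>2 / 8)) / \<tau> ^ d) * exp (- (A * \<rho> / 32)) \<le> (C * \<rho> ^ d) * exp (- (A * \<rho> / 32))"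
        by (rule mult_right_mono) simp
      also have "\<dots> = C * far_kernel \<alpha> c x y"
        using False unfolding far_kernel_def A_def \<rho>_def d_def by (simp add: not_less)
      finally show ?thesis using False by simp
    qed
    then have "2 * ((exp (- ((A / \<tau>)\<^sup>2 / 8)) / \<tau> ^ d) * exp (- (A * \<rho> / 32))) * exp (- ((norm y)\<^sup>2 / 2)) \<le>
      2 * ((if A < c * (1 + norm x) powr (- \<alpha>) then exp (- ((A / \<tau>)\<^sup>2 / 8)) / \<tau> ^ d else 0) + C * far_kernel \<alpha> c x y) * exp (- ((norm y)\<^sup>2 / 2))"
      by (intro mult_right_mono mult_left_mono) auto
    then show "OU_kernel t x y * exp (- ((norm x)\<^sup>2 / 2)) \<le>
      2 * ((if norm (x - y) < c * (1 + norm x) powr (- \<alpha>) then exp (- ((norm (x - y) / \<tau>)\<^sup>2 / 8)) / \<tau> ^ CARD('d) else 0) +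
      (1 + 8 ^ CARD('d) * fact CARD('d)) / c ^ CARD('d) * far_kernel \<alpha> c x y) * exp (- ((norm y)\<^sup>2 / 2))"
      using le[of x y] unfolding A_def \<rho>_def C_def d_def by (simp only: mult.assoc)
  qed
qed

section \<open>Lower semicontinuity of the maximal operator\<close>

lemma OU_kernel_measurable [measurable]: "OU_kernel t x \<in> borel_measurable lebesgue"
proof -
  have "OU_kernel t x \<in> borel_measurable borel" unfolding OU_kernel_def[abs_def] by measurable
  then show ?thesis by (intro measurable_completion) simp
qed

text \<open>Fatou's lemma: the kernel is continuous in x, so the semigroup is lower semicontinuous
  even where the integral diverges.\<close>

lemma open_OU_semigroup_greater:
  fixes g :: "real^'d \<Rightarrow> ennreal"
  assumes [measurable]: "g \<in> borel_measurable lebesgue" and "0 < t"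
  shows "open {x. a < OU_semigroup t g x}"
proof -
  have "closed {x. OU_semigroup t g x \<le> a}"
    unfolding closed_sequential_limits
  proof (intro allI impI, elim conjE)
    fix X l assume X: "\<forall>n. X n \<in> {x. OU_semigroup t g x \<le> a}" "X \<longlonglongrightarrow> l"
    have lim: "(\<lambda>n. ennreal (OU_kernel t (X n) y) * g y) \<longlonglongrightarrow> ennreal (OU_kernel t l y) * g y"
      if "g y \<noteq> top" for y
    proof -
      have "(\<lambda>n. OU_kernel t (X n) y) \<longlonglongrightarrow> OU_kernel t l y"
        unfolding OU_kernel_def using \<open>0 < t\<close> by (intro tendsto_intros X) auto
      then have "(\<lambda>n. g y * ennreal (OU_kernel t (X n) y)) \<longlonglongrightarrow> g y * ennreal (OU_kernel t l y)"
        using that less_top by (intro ennreal_tendsto_cmult tendsto_ennrealI) blast+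
      then show ?thesis by (simp only: mult.commute)
    qed
    have "OU_semigroup t g l = (\<integral>\<^sup>+y. liminf (\<lambda>n. ennreal (OU_kernel t (X n) y) * g y) \<partial>lebesgue)"
      unfolding OU_semigroup_def
    proof (rule nn_integral_cong)
      fix y :: "real^'d"
      have pos: "0 < OU_kernel t z y" for z :: "real^'d" using \<open>0 < t\<close> by (simp add: OU_kernel_def)
      show "ennreal (OU_kernel t l y) * g y = liminf (\<lambda>n. ennreal (OU_kernel t (X n) y) * g y)"
      proof (cases "g y = top")
        case True
        then show ?thesis using pos by (simp add: ennreal_mult_top less_imp_neq[symmetric] not_le Liminf_const)
      next
        case False
        then show ?thesis using lim_imp_Liminf[OF _ lim] by simp
      qed
    qed
    also have "\<dots> \<le> liminf (\<lambda>n. OU_semigroup t g (X n))"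
      unfolding OU_semigroup_def by (rule nn_integral_liminf) measurable
    also have "\<dots> \<le> liminf (\<lambda>n. a)"
      using X by (intro Liminf_mono) auto
    also have "\<dots> = a" by (simp add: Liminf_const)
    finally show "l \<in> {x. OU_semigroup t g x \<le> a}" by simp
  qed
  then have "open (- {x. OU_semigroup t g x \<le> a})" by (rule open_Compl)
  also have "- {x. OU_semigroup t g x \<le> a} = {x. a < OU_semigroup t g x}" by auto
  finally show ?thesis .
qed

text \<open>The supremum runs over uncountably many t, so measurability comes from open superlevel
  sets, which survive arbitrary unions.\<close>

lemma OU_maximal_measurable:
  fixes f :: "real^'d \<Rightarrow> complex"
  assumes [measurable]: "f \<in> borel_measurable lebesgue"
  shows "OU_maximal f \<in> borel_measurable lebesgue"
proof -
  have "OU_maximal f \<in> borel_measurable borel"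
  proof (rule borel_measurableI_greater)
    fix a
    have "{x \<in> space borel. a < OU_maximal f x} =
        (\<Union>t\<in>{0<..}. {x. a < OU_semigroup t (\<lambda>y. ennreal (norm (f y))) x})"
      by (auto simp: OU_maximal_def less_SUP_iff)
    also have "open \<dots>" by (intro open_UN ballI open_OU_semigroup_greater) auto
    finally show "{x \<in> space borel. a < OU_maximal f x} \<in> sets borel" by auto
  qed
  then show ?thesis by (intro measurable_completion) simp
qed

section \<open>The weighted bound\<close>

context local_Ap
begin

text \<open>There are only finitely many shifts, so the supremum over them is bounded by a sum of
  laminar maximal functions.\<close>

lemma dyadic_maximal_bound:
  obtains C where "0 < C" "\<And>g. g \<in> borel_measurable lebesgue \<Longrightarrow>
    (\<integral>\<^sup>+x. ennreal (\<omega> x) * enn_powr (dyadic_maximal G g x) p \<partial>lebesgue) \<le>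
      ennreal C * (\<integral>\<^sup>+x. ennreal (\<omega> x) * enn_powr (g x) p \<partial>lebesgue)"
proof -
  define C where "C = K powr (p / (p - 1)) * p powr (p / (p - 1)) * (p / (p - 1)) powr p"
  have C: "0 < C" using p K by (simp add: C_def)
  define n where "n = real CARD(bool^'d)"
  have n: "0 < n" by (simp add: n_def)
  show thesis
  proof (rule that)
    show "0 < n * C" using C n by simp
    fix g :: "real^'d \<Rightarrow> ennreal" assume g [measurable]: "g \<in> borel_measurable lebesgue"
    define F where "F b = dyadic_family G b" for b :: "bool^'d"
    define I where "I = (\<integral>\<^sup>+x. ennreal (\<omega> x) * enn_powr (g x) p \<partial>lebesgue)"
    have F: "countable (F b)" "laminar (F b)" "F b \<subseteq> sets lebesgue" for b
      unfolding F_def dyadic_family_def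
      by (rule countable_dcubes, rule laminar_dcubes) (auto simp: dcube_eq_cube)
    have one: "(\<integral>\<^sup>+x. ennreal (\<omega> x) * enn_powr (maximal lebesgue (F b) g x) p \<partial>lebesgue) \<le> ennreal C * I" for b
      unfolding C_def I_def
    proof (rule Muckenhoupt_laminar[OF p K \<omega> \<omega>_pos F _ g])
      fix P assume "P \<in> F b"
      then obtain k m where P: "P = dcube (shift b) k m" "G P" by (auto simp: F_def dyadic_family_def)
      define c s where "c = (\<chi> i. shift b $ i + real_of_int (m $ i) / 2 ^ k)" and "s = 1 / (2::real) ^ k"
      have cs: "P = cube c s" "0 < s" unfolding P(1) dcube_eq_cube c_def s_def by simp_all
      have eP: "emeasure lebesgue P = ennreal (s ^ CARD('d))"
        unfolding cs(1) using cs(2) by (intro emeasure_cube) simp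
      obtain W V where "0 < W" "0 < V" "(\<integral>\<^sup>+x\<in>P. ennreal (\<omega> x) \<partial>lebesgue) = ennreal W"
        "(\<integral>\<^sup>+x\<in>P. ennreal (\<omega> x powr (- (1 / (p - 1)))) \<partial>lebesgue) = ennreal V"
        "W * V powr (p - 1) \<le> K * (s ^ CARD('d)) powr p"
        using Ap[OF cs(2), of c] P(2) unfolding cs(1) by blast
      moreover have "0 < s ^ CARD('d)" using cs(2) by simp
      ultimately show "\<exists>m W V. 0 < m \<and> 0 < W \<and> 0 < V \<and> emeasure lebesgue P = ennreal m \<and>
        (\<integral>\<^sup>+x\<in>P. ennreal (\<omega> x) \<partial>lebesgue) = ennreal W \<and>
        (\<integral>\<^sup>+x\<in>P. ennreal (\<omega> x powr (- (1 / (p - 1)))) \<partial>lebesgue) = ennreal V \<and>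
        W * V powr (p - 1) \<le> K * m powr p"
        using eP by blast
    qed
    have [measurable]: "maximal lebesgue (F b) g \<in> borel_measurable lebesgue" for b
      using F by (intro measurable_maximal)
    have "(\<integral>\<^sup>+x. ennreal (\<omega> x) * enn_powr (dyadic_maximal G g x) p \<partial>lebesgue) \<le>
        (\<integral>\<^sup>+x. (\<Sum>b\<in>UNIV. ennreal (\<omega> x) * enn_powr (maximal lebesgue (F b) g x) p) \<partial>lebesgue)"
    proof (rule nn_integral_mono)
      fix x
      have "enn_powr (dyadic_maximal G g x) p = (SUP b. enn_powr (maximal lebesgue (F b) g x) p)"
        unfolding dyadic_maximal_def F_def using p by (intro enn_powr_SUP) auto
      also have "\<dots> \<le> (\<Sum>b\<in>UNIV. enn_powr (maximal lebesgue (F b) g x) p)"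
        by (intro SUP_least member_le_sum) auto
      finally show "ennreal (\<omega> x) * enn_powr (dyadic_maximal G g x) p \<le>
          (\<Sum>b\<in>UNIV. ennreal (\<omega> x) * enn_powr (maximal lebesgue (F b) g x) p)"
        unfolding sum_distrib_left[symmetric] by (rule mult_left_mono) simp
    qed
    also have "\<dots> = (\<Sum>b\<in>UNIV. (\<integral>\<^sup>+x. ennreal (\<omega> x) * enn_powr (maximal lebesgue (F b) g x) p \<partial>lebesgue))"
      by (rule nn_integral_sum) measurable
    also have "\<dots> \<le> (\<Sum>b\<in>(UNIV :: (bool^'d) set). ennreal C * I)"
      by (rule sum_mono) (rule one)
    also have "\<dots> = ennreal (n * C) * I"
      using C n by (simp add: n_def ennreal_mult ennreal_of_nat_eq_real_of_nat mult.assoc)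
    finally show "(\<integral>\<^sup>+x. ennreal (\<omega> x) * enn_powr (dyadic_maximal G g x) p \<partial>lebesgue) \<le> ennreal (n * C) * (\<integral>\<^sup>+x. ennreal (\<omega> x) * enn_powr (g x) p \<partial>lebesgue)"
      unfolding I_def .
  qed
qed

text \<open>With \<Lambda> = (1 + |x|)^(-\<alpha>) / 2 the level satisfies \<Lambda> / 2 <
  2^(-\<kappa>) <= \<Lambda>. The lower bound puts the ball of radius \<Lambda> / 12 into the box of
  the one-third trick, which explains 1/24; the upper bound makes the dyadic cubes around x
  good.\<close>

lemma scale_level:
  fixes x :: "real^'d"
  obtains \<kappa> :: nat where "\<And>y. norm (x - y) < 1 / 24 * (1 + norm x) powr (- \<alpha>) \<Longrightarrow> \<forall>i. \<bar>y $ i - x $ i\<bar> < 1 / (6 * 2 ^ \<kappa>)"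
    "\<And>k b m. \<kappa> \<le> k \<Longrightarrow> x \<in> dcube (shift b) k m \<Longrightarrow> G (dcube (shift b) k m)"
proof -
  define \<Lambda> where "\<Lambda> = 1 / 2 * (1 + norm x) powr (- \<alpha>)"
  have "1 + norm x \<noteq> 0" using norm_ge_zero[of x] by linarith
  then have \<Lambda>0: "0 < \<Lambda>" by (simp add: \<Lambda>_def)
  have "(1 + norm x) powr (- \<alpha>) \<le> 1 powr (- \<alpha>)" using \<alpha> by (intro powr_mono2') auto
  then have \<Lambda>1: "\<Lambda> < 1" by (simp add: \<Lambda>_def)
  define \<kappa> where "\<kappa> = (LEAST k. 1 / 2 ^ k \<le> \<Lambda>)"
  have "\<exists>k. 1 / 2 ^ k \<le> \<Lambda>"
  proof -
    obtain k where "(1 / 2) ^ k < \<Lambda>" using real_arch_pow_inv[OF \<Lambda>0, of "1 / 2"] by auto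
    then show ?thesis by (intro exI[of _ k]) (simp add: power_divide)
  qed
  then have \<kappa>: "1 / 2 ^ \<kappa> \<le> \<Lambda>" unfolding \<kappa>_def by (rule LeastI_ex)
  \<comment> \<open>Natural subtraction: at \<kappa> = 0 the predecessor would be 0 again and
    minimality would yield no lower bound for 2^(-\<kappa>).\<close>
  have "\<kappa> \<noteq> 0" using \<kappa> \<Lambda>1 by (intro notI) simp
  then have "\<not> 1 / 2 ^ (\<kappa> - 1) \<le> \<Lambda>" unfolding \<kappa>_def by (intro not_less_Least) simp
  moreover have "(2::real) ^ \<kappa> = 2 * 2 ^ (\<kappa> - 1)" using \<open>\<kappa> \<noteq> 0\<close> by (cases \<kappa>) auto
  ultimately have \<kappa>2: "\<Lambda> / 2 < 1 / 2 ^ \<kappa>" by (simp add: field_simps)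
  show thesis
  proof (rule that[of \<kappa>])
    fix y assume "norm (x - y) < 1 / 24 * (1 + norm x) powr (- \<alpha>)"
    then have "norm (x - y) < \<Lambda> / 2 / 6" by (simp add: \<Lambda>_def)
    also have "\<dots> < 1 / 2 ^ \<kappa> / 6" using \<kappa>2 by (intro divide_strict_right_mono) auto
    finally have "norm (x - y) < 1 / (6 * 2 ^ \<kappa>)" by simp
    then show "\<forall>i. \<bar>y $ i - x $ i\<bar> < 1 / (6 * 2 ^ \<kappa>)"
      using component_le_norm_cart[of "x - y"] by (auto simp: abs_minus_commute intro: le_less_trans)
  next
    fix k b m assume k: "\<kappa> \<le> k" and x: "x \<in> dcube (shift b) k m"
    have "1 / (2::real) ^ k \<le> 1 / 2 ^ \<kappa>" using k by (intro divide_left_mono power_increasing) auto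
    then have le: "1 / 2 ^ k \<le> \<Lambda>" using \<kappa> by linarith
    show "G (dcube (shift b) k m)"
      unfolding dcube_eq_cube
    proof (rule good[of _ _ x])
      show "cube (\<chi> i. shift b $ i + real_of_int (m $ i) / 2 ^ k) (1 / 2 ^ k) \<subseteq>
          {z. \<forall>i. \<bar>z $ i - x $ i\<bar> < 1 / 2 * (1 + norm x) powr (- \<alpha>)}"
      proof (clarify)
        fix z i assume "z \<in> cube (\<chi> i. shift b $ i + real_of_int (m $ i) / 2 ^ k) (1 / 2 ^ k)"
        then show "\<bar>z $ i - x $ i\<bar> < 1 / 2 * (1 + norm x) powr (- \<alpha>)"
          using x[unfolded dcube_eq_cube] le unfolding mem_cube \<Lambda>_def[symmetric] by (smt (verit))
      qed
    qed simp
  qed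
qed

text \<open>Both bounds are free of t, so the supremum can be taken after the near and far parts
  have been estimated for a single time.\<close>

lemma OU_maximal_pointwise:
  obtains C where "0 < C" "\<And>f x. f \<in> borel_measurable lebesgue \<Longrightarrow>
    OU_maximal f x * ennreal (exp (- ((norm x)\<^sup>2 / 2))) \<le>
    ennreal C * (dyadic_maximal G (\<lambda>y. ennreal (norm (f y) * exp (- ((norm y)\<^sup>2 / 2)))) x +
      (\<integral>\<^sup>+y. ennreal (far_kernel \<alpha> (1 / 24) x y) * ennreal (norm (f y) * exp (- ((norm y)\<^sup>2 / 2))) \<partial>lebesgue))"
proof -
  define C1 where "C1 = 1 + 2 * ((1 + 8 ^ (CARD('d) + 1) * fact (CARD('d) + 1)) * 12 ^ (CARD('d) + 1) :: real)"
  define C2 where "C2 = (1 + 8 ^ CARD('d) * fact CARD('d)) / (1 / 24 :: real) ^ CARD('d)"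
  have C12: "0 < C1" "0 < C2" by (simp_all add: C1_def C2_def add_pos_nonneg)
  define C where "C = 2 * max C1 C2"
  show thesis
  proof (rule that)
    show "0 < C" using C12 by (simp add: C_def)
    fix f :: "real^'d \<Rightarrow> complex" and x :: "real^'d" assume f [measurable]: "f \<in> borel_measurable lebesgue"
    define e where "e x = exp (- ((norm x)\<^sup>2 / 2))" for x :: "real^'d"
    have e0: "0 < e x" for x by (simp add: e_def)
    have [measurable]: "e \<in> borel_measurable lebesgue"
      unfolding e_def[abs_def] using measurable_id_lebesgue by measurable
    define g where "g y = ennreal (norm (f y) * e y)" for y
    have g [measurable]: "g \<in> borel_measurable lebesgue" unfolding g_def[abs_def] by measurable
    define T where "T = (\<integral>\<^sup>+y. ennreal (far_kernel \<alpha> (1 / 24) x y) * g y \<partial>lebesgue)"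
    define R where "R = 1 / 24 * (1 + norm x) powr (- \<alpha>)"
    obtain \<kappa> where \<kappa>: "\<And>y. norm (x - y) < R \<Longrightarrow> \<forall>i. \<bar>y $ i - x $ i\<bar> < 1 / (6 * 2 ^ \<kappa>)"
      "\<And>k b m. \<kappa> \<le> k \<Longrightarrow> x \<in> dcube (shift b) k m \<Longrightarrow> G (dcube (shift b) k m)"
      unfolding R_def by (rule scale_level[of x]) metis
    define B where "B = {y::real^'d. \<forall>i. \<bar>y $ i - x $ i\<bar> < 1 / (6 * 2 ^ \<kappa>)}"
    have "open B"
      unfolding B_def Collect_all_eq by (intro open_INT ballI open_Collect_less continuous_intros) auto
    then have [measurable]: "B \<in> sets lebesgue" by (simp add: lborelD borel_open)
    have each: "OU_semigroup t (\<lambda>y. ennreal (norm (f y))) x * ennreal (e x) \<le> ennreal C * (dyadic_maximal G g x + T)"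
      if "0 < t" for t
    proof -
      obtain \<tau> where \<tau>: "0 < \<tau>" and ker: "\<And>x y :: real^'d. OU_kernel t x y * e x \<le>
        2 * ((if norm (x - y) < 1 / 24 * (1 + norm x) powr (- \<alpha>) then exp (- ((norm (x - y) / \<tau>)\<^sup>2 / 8)) / \<tau> ^ CARD('d) else 0) +
          C2 * far_kernel \<alpha> (1 / 24) x y) * e y"
        using OU_kernel_near_far[OF \<alpha> \<open>0 < t\<close>, of "1 / 24", where 'd = 'd] unfolding C2_def e_def by auto
      define \<phi> where "\<phi> y = exp (- ((norm (x - y) / \<tau>)\<^sup>2 / 8)) / \<tau> ^ CARD('d)" for y
      have \<phi>0: "0 \<le> \<phi> y" for y using \<tau> by (simp add: \<phi>_def)
      have [measurable]: "\<phi> \<in> borel_measurable lebesgue"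
        unfolding \<phi>_def[abs_def] using measurable_id_lebesgue by measurable
      have "OU_semigroup t (\<lambda>y. ennreal (norm (f y))) x * ennreal (e x) =
          (\<integral>\<^sup>+y. ennreal (OU_kernel t x y) * ennreal (norm (f y)) * ennreal (e x) \<partial>lebesgue)"
        unfolding OU_semigroup_def by (rule nn_integral_multc[symmetric]) measurable
      also have "\<dots> \<le> (\<integral>\<^sup>+y. 2 * (ennreal (\<phi> y) * g y * indicator B y) + ennreal (2 * C2) * (ennreal (far_kernel \<alpha> (1 / 24) x y) * g y) \<partial>lebesgue)"
      proof (rule nn_integral_mono)
        fix y
        define b where "b = (indicator B y :: real)"
        have K0: "0 \<le> OU_kernel t x y" using \<open>0 < t\<close> by (simp add: OU_kernel_def)
        have "OU_kernel t x y * e x \<le> 2 * (\<phi> y * b + C2 * far_kernel \<alpha> (1 / 24) x y) * e y"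
        proof -
          \<comment> \<open>The ball that defines the near part is enlarged to the box B, on which
            the dyadic estimate applies.\<close>
          have "(if norm (x - y) < R then \<phi> y else 0) \<le> \<phi> y * b"
            using \<kappa>(1)[of y] \<phi>0[of y] by (auto simp: b_def B_def indicator_def)
          then have "2 * ((if norm (x - y) < R then \<phi> y else 0) + C2 * far_kernel \<alpha> (1 / 24) x y) * e y \<le>
              2 * (\<phi> y * b + C2 * far_kernel \<alpha> (1 / 24) x y) * e y"
            using e0[of y] by (intro mult_right_mono mult_left_mono add_right_mono) auto
          then show ?thesis using ker[of x y] unfolding R_def \<phi>_def by linarith
        qed
        then have "OU_kernel t x y * e x * norm (f y) \<le> (2 * (\<phi> y * b + C2 * far_kernel \<alpha> (1 / 24) x y) * e y) * norm (f y)"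
          by (rule mult_right_mono) simp
        then have "OU_kernel t x y * norm (f y) * e x \<le>
            2 * (\<phi> y * (norm (f y) * e y) * b) + (2 * C2) * (far_kernel \<alpha> (1 / 24) x y * (norm (f y) * e y))"
          by (simp add: algebra_simps)
        then have "ennreal (OU_kernel t x y * norm (f y) * e x) \<le>
            ennreal (2 * (\<phi> y * (norm (f y) * e y) * b) + (2 * C2) * (far_kernel \<alpha> (1 / 24) x y * (norm (f y) * e y)))"
          by (rule ennreal_leI)
        also have "\<dots> = 2 * (ennreal (\<phi> y) * g y * indicator B y) + ennreal (2 * C2) * (ennreal (far_kernel \<alpha> (1 / 24) x y) * g y)"
        proof -
          have "ennreal b = indicator B y" by (simp add: b_def indicator_def)
          moreover have "0 \<le> b" by (simp add: b_def)
          ultimately show ?thesis unfolding g_def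
            using \<phi>0[of y] C12 e0[of y] far_kernel_nonneg[of \<alpha> "1 / 24" x y]
            by (simp add: ennreal_plus ennreal_mult mult_nonneg_nonneg less_imp_le)
        qed
        finally show "ennreal (OU_kernel t x y) * ennreal (norm (f y)) * ennreal (e x) \<le>
            2 * (ennreal (\<phi> y) * g y * indicator B y) + ennreal (2 * C2) * (ennreal (far_kernel \<alpha> (1 / 24) x y) * g y)"
          using K0 e0[of x] by (simp add: ennreal_mult less_imp_le)
      qed
      also have "\<dots> = 2 * (\<integral>\<^sup>+y\<in>B. ennreal (\<phi> y) * g y \<partial>lebesgue) + ennreal (2 * C2) * T"
        unfolding T_def by (subst nn_integral_add) (measurable, simp add: nn_integral_cmult)
      also have "\<dots> \<le> 2 * (ennreal C1 * dyadic_maximal G g x) + ennreal (2 * C2) * T"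
        unfolding \<phi>_def B_def C1_def
        by (intro add_right_mono mult_left_mono exp_kernel_near_bound \<tau> g) (use \<kappa>(2) in auto)
      also have "\<dots> \<le> ennreal C * dyadic_maximal G g x + ennreal C * T"
      proof (intro add_mono)
        have "2 * (ennreal C1 * dyadic_maximal G g x) = ennreal (2 * C1) * dyadic_maximal G g x"
          using C12 by (simp add: ennreal_mult mult.assoc)
        also have "\<dots> \<le> ennreal C * dyadic_maximal G g x"
          by (intro mult_right_mono ennreal_leI) (auto simp: C_def)
        finally show "2 * (ennreal C1 * dyadic_maximal G g x) \<le> ennreal C * dyadic_maximal G g x" .
        show "ennreal (2 * C2) * T \<le> ennreal C * T"
          by (intro mult_right_mono ennreal_leI) (auto simp: C_def)
      qed
      finally show ?thesis by (simp only: distrib_left)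
    qed
    have "OU_maximal f x * ennreal (e x) = (SUP t\<in>{0<..}. OU_semigroup t (\<lambda>y. ennreal (norm (f y))) x * ennreal (e x))"
      unfolding OU_maximal_def by (rule SUP_mult_right_ennreal)
    also have "\<dots> \<le> ennreal C * (dyadic_maximal G g x + T)"
      by (rule SUP_least) (use each in auto)
    finally show "OU_maximal f x * ennreal (exp (- ((norm x)\<^sup>2 / 2))) \<le>
      ennreal C * (dyadic_maximal G (\<lambda>y. ennreal (norm (f y) * exp (- ((norm y)\<^sup>2 / 2)))) x +
        (\<integral>\<^sup>+y. ennreal (far_kernel \<alpha> (1 / 24) x y) * ennreal (norm (f y) * exp (- ((norm y)\<^sup>2 / 2))) \<partial>lebesgue))"
      unfolding T_def g_def e_def .
  qed
qed

theorem OU_maximal_bound: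
  obtains C where "0 < C" "\<And>f. f \<in> borel_measurable lebesgue \<Longrightarrow>
    (\<integral>\<^sup>+x. ennreal (\<omega> x) * enn_powr (OU_maximal f x * ennreal (exp (- ((norm x)\<^sup>2 / 2)))) p \<partial>lebesgue) \<le>
    ennreal C * (\<integral>\<^sup>+x. ennreal (\<omega> x) * enn_powr (ennreal (norm (f x) * exp (- ((norm x)\<^sup>2 / 2)))) p \<partial>lebesgue)"
proof -
  obtain C where C: "0 < C" and ptw: "\<And>f x. f \<in> borel_measurable lebesgue \<Longrightarrow>
    OU_maximal f x * ennreal (exp (- ((norm x)\<^sup>2 / 2))) \<le>
    ennreal C * (dyadic_maximal G (\<lambda>y. ennreal (norm (f y) * exp (- ((norm y)\<^sup>2 / 2)))) x +
      (\<integral>\<^sup>+y. ennreal (far_kernel \<alpha> (1 / 24) x y) * ennreal (norm (f y) * exp (- ((norm y)\<^sup>2 / 2))) \<partial>lebesgue))"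
    by (rule OU_maximal_pointwise) blast
  obtain CN where CN: "0 < CN" "\<And>g. g \<in> borel_measurable lebesgue \<Longrightarrow>
    (\<integral>\<^sup>+x. ennreal (\<omega> x) * enn_powr (dyadic_maximal G g x) p \<partial>lebesgue) \<le>
      ennreal CN * (\<integral>\<^sup>+x. ennreal (\<omega> x) * enn_powr (g x) p \<partial>lebesgue)"
    by (rule dyadic_maximal_bound) blast
  obtain CF where CF: "0 < CF" "\<And>g. g \<in> borel_measurable lebesgue \<Longrightarrow>
    (\<integral>\<^sup>+x. ennreal (\<omega> x) * enn_powr (\<integral>\<^sup>+y. ennreal (far_kernel \<alpha> (1 / 24) x y) * g y \<partial>lebesgue) p \<partial>lebesgue) \<le>
      ennreal CF * (\<integral>\<^sup>+x. ennreal (\<omega> x) * enn_powr (g x) p \<partial>lebesgue)"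
    by (rule far_bound[of "1 / 24"]) (simp, blast)
  define A where "A = C powr p * 2 powr p"
  have A: "0 < A" using C by (simp add: A_def)
  show thesis
  proof (rule that)
    show "0 < A * (CN + CF)" using A CN CF by simp
    fix f :: "real^'d \<Rightarrow> complex" assume f [measurable]: "f \<in> borel_measurable lebesgue"
    define g where "g y = ennreal (norm (f y) * exp (- ((norm y)\<^sup>2 / 2)))" for y
    have g [measurable]: "g \<in> borel_measurable lebesgue" unfolding g_def[abs_def] using measurable_id_lebesgue by measurable
    define D T I where "D = dyadic_maximal G g"
      and "T x = (\<integral>\<^sup>+y. ennreal (far_kernel \<alpha> (1 / 24) x y) * g y \<partial>lebesgue)"
      and "I = (\<integral>\<^sup>+x. ennreal (\<omega> x) * enn_powr (g x) p \<partial>lebesgue)" for x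
    have [measurable]: "D \<in> borel_measurable lebesgue"
    proof -
      have "maximal lebesgue (dyadic_family G b) g \<in> borel_measurable lebesgue" for b
        unfolding dyadic_family_def
        by (intro measurable_maximal countable_dcubes) (auto simp: dcube_eq_cube)
      then show ?thesis unfolding D_def dyadic_maximal_def[abs_def]
        by (intro borel_measurable_SUP) auto
    qed
    have [measurable]: "T \<in> borel_measurable lebesgue"
    proof -
      interpret sigma_finite_measure "lebesgue :: (real^'d) measure" by (rule sigma_finite_lebesgue)
      have "(\<lambda>z. ennreal (far_kernel \<alpha> (1 / 24) (fst z) (snd z)) * g (snd z)) \<in>
          borel_measurable ((lebesgue :: (real^'d) measure) \<Otimes>\<^sub>M lebesgue)" by measurable
      then show ?thesis unfolding T_def[abs_def]
        by (intro borel_measurable_nn_integral) (simp add: case_prod_unfold)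
    qed
    have "(\<integral>\<^sup>+x. ennreal (\<omega> x) * enn_powr (OU_maximal f x * ennreal (exp (- ((norm x)\<^sup>2 / 2)))) p \<partial>lebesgue) \<le>
        (\<integral>\<^sup>+x. ennreal A * (ennreal (\<omega> x) * enn_powr (D x) p + ennreal (\<omega> x) * enn_powr (T x) p) \<partial>lebesgue)"
    proof (rule nn_integral_mono)
      fix x
      have "enn_powr (OU_maximal f x * ennreal (exp (- ((norm x)\<^sup>2 / 2)))) p \<le> enn_powr (ennreal C * (D x + T x)) p"
        using ptw[OF f, of x] p unfolding D_def T_def g_def by (intro enn_powr_mono) auto
      also have "\<dots> = ennreal (C powr p) * enn_powr (D x + T x) p"
        using C by (simp add: enn_powr_mult enn_powr_ennreal)
      also have "\<dots> \<le> ennreal (C powr p) * (ennreal (2 powr p) * (enn_powr (D x) p + enn_powr (T x) p))"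
        using p by (intro mult_left_mono enn_powr_sum_le) auto
      also have "\<dots> = ennreal A * (enn_powr (D x) p + enn_powr (T x) p)"
        by (simp add: A_def ennreal_mult mult.assoc)
      finally have "ennreal (\<omega> x) * enn_powr (OU_maximal f x * ennreal (exp (- ((norm x)\<^sup>2 / 2)))) p \<le>
          ennreal (\<omega> x) * (ennreal A * (enn_powr (D x) p + enn_powr (T x) p))"
        by (rule mult_left_mono) simp
      also have "\<dots> = ennreal A * (ennreal (\<omega> x) * enn_powr (D x) p + ennreal (\<omega> x) * enn_powr (T x) p)"
        by (simp only: distrib_left mult.left_commute)
      finally show "ennreal (\<omega> x) * enn_powr (OU_maximal f x * ennreal (exp (- ((norm x)\<^sup>2 / 2)))) p \<le>
          ennreal A * (ennreal (\<omega> x) * enn_powr (D x) p + ennreal (\<omega> x) * enn_powr (T x) p)" .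
    qed
    also have "\<dots> = ennreal A * ((\<integral>\<^sup>+x. ennreal (\<omega> x) * enn_powr (D x) p \<partial>lebesgue) + (\<integral>\<^sup>+x. ennreal (\<omega> x) * enn_powr (T x) p \<partial>lebesgue))"
      by (simp add: nn_integral_cmult nn_integral_add)
    also have "\<dots> \<le> ennreal A * (ennreal CN * I + ennreal CF * I)"
      unfolding D_def T_def I_def by (intro mult_left_mono add_mono CN CF g) auto
    also have "\<dots> = ennreal (A * (CN + CF)) * I"
      using A CN(1) CF(1) by (simp add: ennreal_mult distrib_right mult.assoc less_imp_le)
    finally show "(\<integral>\<^sup>+x. ennreal (\<omega> x) * enn_powr (OU_maximal f x * ennreal (exp (- ((norm x)\<^sup>2 / 2)))) p \<partial>lebesgue) \<le>
      ennreal (A * (CN + CF)) * (\<integral>\<^sup>+x. ennreal (\<omega> x) * enn_powr (ennreal (norm (f x) * exp (- ((norm x)\<^sup>2 / 2)))) p \<partial>lebesgue)"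
      unfolding I_def g_def .
  qed
qed

end

text \<open>The density exp (- p |x|^2 / 2) is the p-th power of exp (- |x|^2 / 2), so it can be
  moved onto the function and only \<omega> remains as a weight.\<close>

lemma Lp_norm_gaussian:
  fixes \<omega> :: "real^'d \<Rightarrow> real"
  assumes "weight \<omega>" and [measurable]: "h \<in> borel_measurable lebesgue"
  shows "Lp_norm p (gaussian_weighted_measure p \<omega>) h =
    enn_powr (\<integral>\<^sup>+x. ennreal (\<omega> x) * enn_powr (h x * ennreal (exp (- ((norm x)\<^sup>2 / 2)))) p \<partial>lebesgue) (1 / p)"
proof -
  have [measurable]: "\<omega> \<in> borel_measurable lebesgue" and pos: "\<And>x. 0 < \<omega> x" using assms by (auto simp: weight_def)
  have m: "(\<lambda>x. ennreal (\<omega> x * exp (- (p / 2) * (norm x)\<^sup>2))) \<in> borel_measurable lebesgue"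
    using measurable_id_lebesgue by measurable
  have "(\<integral>\<^sup>+x. enn_powr (h x) p \<partial>gaussian_weighted_measure p \<omega>) =
      (\<integral>\<^sup>+x. ennreal (\<omega> x * exp (- (p / 2) * (norm x)\<^sup>2)) * enn_powr (h x) p \<partial>lebesgue)"
    unfolding gaussian_weighted_measure_def by (rule nn_integral_density[OF m]) measurable
  also have "\<dots> = (\<integral>\<^sup>+x. ennreal (\<omega> x) * enn_powr (h x * ennreal (exp (- ((norm x)\<^sup>2 / 2)))) p \<partial>lebesgue)"
  proof (rule nn_integral_cong)
    fix x :: "real^'d"
    have "enn_powr (ennreal (exp (- ((norm x)\<^sup>2 / 2)))) p = ennreal (exp (- (p / 2) * (norm x)\<^sup>2))"
      by (simp add: enn_powr_ennreal exp_powr_real mult.commute)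
    then show "ennreal (\<omega> x * exp (- (p / 2) * (norm x)\<^sup>2)) * enn_powr (h x) p =
        ennreal (\<omega> x) * enn_powr (h x * ennreal (exp (- ((norm x)\<^sup>2 / 2)))) p"
      using pos[of x] by (simp only: enn_powr_mult ennreal_mult less_imp_le exp_ge_zero mult_ac)
  qed
  finally show ?thesis unfolding Lp_norm_def by (rule arg_cong)
qed

theorem theorem1p3:
  fixes p \<alpha> :: real
    and N :: "(real^'d) set \<Rightarrow> (real^'d) set"
    and \<omega> :: "real^'d \<Rightarrow> real"
  assumes "1 < p"
    and "0 \<le> \<alpha>" and "\<alpha> < 1"
    and "admissible_regions \<alpha> N"
    and "weight \<omega>"
    and "\<omega> \<in> Ap_class \<alpha> N p"
  shows "\<exists>C::real. 0 < C \<and>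
    (\<forall>f \<in> Lp_space p (gaussian_weighted_measure p \<omega>).
       OU_maximal f \<in> borel_measurable (gaussian_weighted_measure p \<omega>) \<and>
       Lp_norm p (gaussian_weighted_measure p \<omega>) (OU_maximal f)
         \<le> ennreal C * Lp_norm p (gaussian_weighted_measure p \<omega>) (\<lambda>x. ennreal (norm (f x))))"
proof -
  obtain K where K: "0 < K" "\<And>c s R. R \<in> grid \<alpha> \<Longrightarrow> 0 < s \<Longrightarrow> cube c s \<subseteq> N R \<Longrightarrow>
    \<exists>W V. 0 < W \<and> 0 < V \<and> (\<integral>\<^sup>+x\<in>cube c s. ennreal (\<omega> x) \<partial>lebesgue) = ennreal W \<and>
      (\<integral>\<^sup>+x\<in>cube c s. ennreal (\<omega> x powr (- (1 / (p - 1)))) \<partial>lebesgue) = ennreal V \<and>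
      W * V powr (p - 1) \<le> K * (s ^ CARD('d)) powr p"
    by (rule Ap_class_cubes[OF assms(1,6)]) blast
  \<comment> \<open>A cube is good if some region \<open>N R\<close> contains it: the A_p class then
    gives the inequality on good cubes, and admissibility makes all cubes near x at the local scale
    good.\<close>
  interpret local_Ap p \<alpha> K \<omega> "\<lambda>Q. \<exists>R\<in>grid \<alpha>. Q \<subseteq> N R"
  proof
    show "\<omega> \<in> borel_measurable lebesgue" "\<And>x. 0 < \<omega> x" using assms(5) by (auto simp: weight_def)
    show "\<exists>R\<in>grid \<alpha>. cube c s \<subseteq> N R"
      if "cube c s \<subseteq> {z. \<forall>i. \<bar>z $ i - x $ i\<bar> < 1 / 2 * (1 + norm x) powr (- \<alpha>)}" for x c s
    proof -
      obtain R where "R \<in> grid \<alpha>" "{z. \<forall>i. \<bar>z $ i - x $ i\<bar> < 1 / 2 * (1 + norm x) powr (- \<alpha>)} \<subseteq> N R"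
        by (rule admissible_region_nhd[OF assms(2,4)])
      then show ?thesis using that by (intro bexI[of _ R] order_trans[OF that])
    qed
  next
    show "\<exists>W V. 0 < W \<and> 0 < V \<and> (\<integral>\<^sup>+x\<in>cube c s. ennreal (\<omega> x) \<partial>lebesgue) = ennreal W \<and>
        (\<integral>\<^sup>+x\<in>cube c s. ennreal (\<omega> x powr (- (1 / (p - 1)))) \<partial>lebesgue) = ennreal V \<and>
        W * V powr (p - 1) \<le> K * (s ^ CARD('d)) powr p"
      if "0 < s" "\<exists>R\<in>grid \<alpha>. cube c s \<subseteq> N R" for c s
      using that K(2) by blast
  qed (use assms K(1) in simp_all)
  obtain C where C: "0 < C" "\<And>f. f \<in> borel_measurable lebesgue \<Longrightarrow>
    (\<integral>\<^sup>+x. ennreal (\<omega> x) * enn_powr (OU_maximal f x * ennreal (exp (- ((norm x)\<^sup>2 / 2)))) p \<partial>lebesgue) \<le>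
    ennreal C * (\<integral>\<^sup>+x. ennreal (\<omega> x) * enn_powr (ennreal (norm (f x) * exp (- ((norm x)\<^sup>2 / 2)))) p \<partial>lebesgue)"
    by (rule OU_maximal_bound) blast
  show ?thesis
  proof (intro exI[of _ "C powr (1 / p)"] conjI ballI)
    show "0 < C powr (1 / p)" using C by simp
    fix f assume "f \<in> Lp_space p (gaussian_weighted_measure p \<omega>)"
    then have f [measurable]: "f \<in> borel_measurable lebesgue"
      by (simp add: Lp_space_def gaussian_weighted_measure_def)
    have mf: "(\<lambda>x. ennreal (norm (f x))) \<in> borel_measurable lebesgue" by measurable
    have m: "OU_maximal f \<in> borel_measurable lebesgue" by (rule OU_maximal_measurable[OF f])
    then show "OU_maximal f \<in> borel_measurable (gaussian_weighted_measure p \<omega>)"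
      by (simp add: gaussian_weighted_measure_def)
    have "Lp_norm p (gaussian_weighted_measure p \<omega>) (OU_maximal f) \<le>
        enn_powr (ennreal C * (\<integral>\<^sup>+x. ennreal (\<omega> x) * enn_powr (ennreal (norm (f x) * exp (- ((norm x)\<^sup>2 / 2)))) p \<partial>lebesgue)) (1 / p)"
      unfolding Lp_norm_gaussian[OF assms(5) m] using assms(1) by (intro enn_powr_mono C f) simp
    also have "\<dots> = ennreal (C powr (1 / p)) *
        enn_powr (\<integral>\<^sup>+x. ennreal (\<omega> x) * enn_powr (ennreal (norm (f x)) * ennreal (exp (- ((norm x)\<^sup>2 / 2)))) p \<partial>lebesgue) (1 / p)"
      using C(1) by (simp add: enn_powr_mult enn_powr_ennreal ennreal_mult)
    also have "\<dots> = ennreal (C powr (1 / p)) * Lp_norm p (gaussian_weighted_measure p \<omega>) (\<lambda>x. ennreal (norm (f x)))"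
      by (simp only: Lp_norm_gaussian[OF assms(5) mf])
    finally show "Lp_norm p (gaussian_weighted_measure p \<omega>) (OU_maximal f)
         \<le> ennreal (C powr (1 / p)) * Lp_norm p (gaussian_weighted_measure p \<omega>) (\<lambda>x. ennreal (norm (f x)))" .
  qed
qed

end
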